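(* Let $(X,\mu)$ be a $\sigma$-finite measure space and let $\{T_t:t\geq0\}$ be a semigroup on $L^2(X)$ satisfying the contraction property. Then there exists a positive semigroup $\{S_t:t\geq0\}$ on $L^2(X)$, satisfying the contraction property, such that \[|T_tf|\leq S_t|f|\qquad\forall f\in L^p(X)\] whenever $1\leq p<\infty$ and $t\geq0$. If $\{T_t:t\geq0\}$ is a measurable semigroup on $L^2(X)$ then $\{S_t:t\geq0\}$ extends to a measurable semigroup on $L^p(X)$ whenever $1\leq p<\infty$.
   Context: A semigroup $\{T_t:t\ge 0\}$ of bounded linear operators satisfies $T_0=I$ and $T_{s+t}=T_sT_t$ (no continuity is assumed). A semigroup $\{T_t:t\ge0\}$ on $L^2(X)$ has the contraction property if $\|T_tf\|_q\le\|f\|_q$ for all $f\in L^2(X)\cap L^q(X)$, all $t\ge0$ and all $q\in[1,\infty]$; each $T_t$ then extends uniquely to a contraction of $L^p(X)$ for $1\le p<\infty$, still denoted $T_t$. A linear operator $S$ on $L^p(X)$ is positive if $Sf\ge0$ whenever $f\ge0$; a semigroup is positive if each of its operators is. A family $\{T_t:t\ge0\}$ of operators on $L^p(X)$ is (strongly) measurable if for every $f\in L^p(X)$ the $L^p(X)$-valued map $t\mapsto T_tf$ is measurable with respect to Lebesgue measure on $[0,\infty)$. Function spaces are complex-valued. *)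

theory Defs
  imports "HOL-Analysis.Analysis" "HOL-Probability.Essential_Supremum"
begin

text \<open>
  Elements of \<open>L\<^sup>p\<close> are represented by complex-valued measurable functions, and operators by maps on
  such functions that respect equality almost everywhere; all identities between elements of
  \<open>L\<^sup>p\<close> are therefore stated almost everywhere. The exponent ranges over \<open>[1, \<infinity>]\<close>.
\<close>

definition Lp_space :: "'a measure \<Rightarrow> ennreal \<Rightarrow> ('a \<Rightarrow> complex) set" where
  "Lp_space M p =
     {f \<in> borel_measurable M.
        if p = \<infinity> then esssup M (\<lambda>x. ennreal (norm (f x))) < \<infinity>
        else integrable M (\<lambda>x. norm (f x) powr enn2real p)}"

definition Lp_norm :: "'a measure \<Rightarrow> ennreal \<Rightarrow> ('a \<Rightarrow> complex) \<Rightarrow> real" where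
  "Lp_norm M p f =
     (if p = \<infinity> then enn2real (esssup M (\<lambda>x. ennreal (norm (f x))))
      else (LINT x|M. norm (f x) powr enn2real p) powr (1 / enn2real p))"

definition Lp_linear ::
    "'a measure \<Rightarrow> ennreal \<Rightarrow> (('a \<Rightarrow> complex) \<Rightarrow> ('a \<Rightarrow> complex)) \<Rightarrow> bool" where
  "Lp_linear M p A \<longleftrightarrow>
     (\<forall>f\<in>Lp_space M p. A f \<in> Lp_space M p) \<and>
     (\<forall>f\<in>Lp_space M p. \<forall>g\<in>Lp_space M p.
        (AE x in M. f x = g x) \<longrightarrow> (AE x in M. A f x = A g x)) \<and>
     (\<forall>f\<in>Lp_space M p. \<forall>g\<in>Lp_space M p.
        AE x in M. A (\<lambda>y. f y + g y) x = A f x + A g x) \<and>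
     (\<forall>c. \<forall>f\<in>Lp_space M p. AE x in M. A (\<lambda>y. c * f y) x = c * A f x)"

definition Lp_bounded_linear ::
    "'a measure \<Rightarrow> ennreal \<Rightarrow> (('a \<Rightarrow> complex) \<Rightarrow> ('a \<Rightarrow> complex)) \<Rightarrow> bool" where
  "Lp_bounded_linear M p A \<longleftrightarrow>
     Lp_linear M p A \<and>
     (\<exists>C. \<forall>f\<in>Lp_space M p. Lp_norm M p (A f) \<le> C * Lp_norm M p f)"

definition Lp_contraction ::
    "'a measure \<Rightarrow> ennreal \<Rightarrow> (('a \<Rightarrow> complex) \<Rightarrow> ('a \<Rightarrow> complex)) \<Rightarrow> bool" where
  "Lp_contraction M p A \<longleftrightarrow>
     Lp_linear M p A \<and> (\<forall>f\<in>Lp_space M p. Lp_norm M p (A f) \<le> Lp_norm M p f)"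

text \<open>The order on \<^typ>\<open>complex\<close> is \<open>z \<le> w \<longleftrightarrow> Re z \<le> Re w \<and> Im z = Im w\<close>, so
  \<open>0 \<le> z\<close> says that \<open>z\<close> is real and nonnegative.\<close>

definition Lp_positive ::
    "'a measure \<Rightarrow> ennreal \<Rightarrow> (('a \<Rightarrow> complex) \<Rightarrow> ('a \<Rightarrow> complex)) \<Rightarrow> bool" where
  "Lp_positive M p A \<longleftrightarrow>
     (\<forall>f\<in>Lp_space M p. (AE x in M. 0 \<le> f x) \<longrightarrow> (AE x in M. 0 \<le> A f x))"

text \<open>Families are indexed by all of \<^typ>\<open>real\<close>, but only the parameters \<open>t \<ge> 0\<close> matter.\<close>

definition Lp_semigroup ::
    "'a measure \<Rightarrow> ennreal \<Rightarrow> (real \<Rightarrow> ('a \<Rightarrow> complex) \<Rightarrow> ('a \<Rightarrow> complex)) \<Rightarrow> bool" where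
  "Lp_semigroup M p T \<longleftrightarrow>
     (\<forall>t\<ge>0. Lp_bounded_linear M p (T t)) \<and>
     (\<forall>f\<in>Lp_space M p. AE x in M. T 0 f x = f x) \<and>
     (\<forall>s\<ge>0. \<forall>t\<ge>0. \<forall>f\<in>Lp_space M p. AE x in M. T (s + t) f x = T s (T t f) x)"

definition positive_Lp_semigroup ::
    "'a measure \<Rightarrow> ennreal \<Rightarrow> (real \<Rightarrow> ('a \<Rightarrow> complex) \<Rightarrow> ('a \<Rightarrow> complex)) \<Rightarrow> bool" where
  "positive_Lp_semigroup M p T \<longleftrightarrow>
     Lp_semigroup M p T \<and> (\<forall>t\<ge>0. Lp_positive M p (T t))"

definition contraction_property ::
    "'a measure \<Rightarrow> (real \<Rightarrow> ('a \<Rightarrow> complex) \<Rightarrow> ('a \<Rightarrow> complex)) \<Rightarrow> bool" where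
  "contraction_property M T \<longleftrightarrow>
     (\<forall>t\<ge>0. \<forall>q\<ge>1. \<forall>f\<in>Lp_space M 2 \<inter> Lp_space M q.
        T t f \<in> Lp_space M q \<and> Lp_norm M q (T t f) \<le> Lp_norm M q f)"

text \<open>
  The extension to \<open>L\<^sup>p\<close> of an operator \<open>A\<close> on \<open>L\<^sup>2\<close>: the contraction of \<open>L\<^sup>p\<close> that agrees with
  \<open>A\<close> on \<open>L\<^sup>2 \<inter> L\<^sup>p\<close>. For \<open>1 \<le> p < \<infinity>\<close> and \<open>A\<close> a member of a semigroup with the contraction
  property it exists and, by density of \<open>L\<^sup>2 \<inter> L\<^sup>p\<close>, is unique up to equality almost everywhere of
  its values. The choice below therefore only selects representatives.
\<close>

definition Lp_extension ::
    "'a measure \<Rightarrow> ennreal \<Rightarrow> (('a \<Rightarrow> complex) \<Rightarrow> ('a \<Rightarrow> complex)) \<Rightarrow> (('a \<Rightarrow> complex) \<Rightarrow> ('a \<Rightarrow> complex))" where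
  "Lp_extension M p A =
     (SOME B. Lp_contraction M p B \<and>
        (\<forall>f\<in>Lp_space M 2 \<inter> Lp_space M p. AE x in M. B f x = A f x))"

text \<open>
  Strong (Bochner) measurability of an \<open>L\<^sup>p\<close>-valued map on \<open>[0, \<infinity>)\<close>: almost everywhere in \<open>t\<close>
  it is the limit, in the norm of \<open>L\<^sup>p\<close>, of Lebesgue measurable simple functions with values in
  \<open>L\<^sup>p\<close>.
\<close>

definition Lp_strongly_measurable ::
    "'a measure \<Rightarrow> ennreal \<Rightarrow> (real \<Rightarrow> ('a \<Rightarrow> complex)) \<Rightarrow> bool" where
  "Lp_strongly_measurable M p u \<longleftrightarrow>
     (\<exists>s :: nat \<Rightarrow> real \<Rightarrow> ('a \<Rightarrow> complex).
        (\<forall>n. simple_function (lebesgue_on {0..}) (s n)) \<and>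
        (\<forall>n. \<forall>t\<ge>0. s n t \<in> Lp_space M p) \<and>
        (AE t in lebesgue_on {0..}. (\<lambda>n. Lp_norm M p (\<lambda>x. s n t x - u t x)) \<longlonglongrightarrow> 0))"

definition measurable_Lp_family ::
    "'a measure \<Rightarrow> ennreal \<Rightarrow> (real \<Rightarrow> ('a \<Rightarrow> complex) \<Rightarrow> ('a \<Rightarrow> complex)) \<Rightarrow> bool" where
  "measurable_Lp_family M p T \<longleftrightarrow>
     (\<forall>f\<in>Lp_space M p. Lp_strongly_measurable M p (\<lambda>t. T t f))"

end

theory Submission
  imports Defs
begin

text \<open>
  The modulus \<open>|A|\<close> of a contraction \<open>A\<close> of \<open>L\<^sup>1\<close> and \<open>L\<^sup>\<infinity>\<close> sends \<open>f \<ge> 0\<close> to the essential supremum of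
  the functions \<open>\<Sum> |A u\<^sub>i|\<close> with \<open>u\<^sub>i \<ge> 0\<close> and \<open>\<Sum> u\<^sub>i \<le> f\<close>. It is a positive contraction of \<open>L\<^sup>1\<close> and
  \<open>L\<^sup>\<infinity>\<close>, hence of \<open>L\<^sup>p\<close> by Jensen's inequality, and \<open>|A B| \<le> |A| |B|\<close>. Therefore
  \<open>|T\<^bsub>t\<^sub>1\<^esub>| \<cdots> |T\<^bsub>t\<^sub>n\<^esub>|\<close> increases when the partition \<open>t = t\<^sub>1 + \<cdots> + t\<^sub>n\<close> is refined, and the supremum
  over all partitions is the semigroup \<open>S\<^sub>t\<close>. Positive operators are represented on functions with
  values in \<open>[0, \<infinity>]\<close>, where they are continuous along increasing sequences; so a single \<open>S\<^sub>t\<close> acts on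
  all \<open>L\<^sup>p\<close> simultaneously.

  If \<open>T\<close> is measurable on \<open>L\<^sup>2\<close>, its orbits are continuous on \<open>(0, \<infinity>)\<close>, so \<open>S\<^sub>t u\<close>, being a supremum
  of such orbits, satisfies \<open>liminf S\<^sub>r u \<ge> S\<^sub>t u\<close> as \<open>r\<close> decreases to \<open>t\<close>. Contractivity gives
  \<open>\<parallel>S\<^sub>r u\<parallel> \<le> \<parallel>S\<^sub>t u\<parallel>\<close> for \<open>r \<ge> t\<close>. The two together yield right continuity of \<open>S\<close> in every \<open>L\<^sup>p\<close>, and
  hence strong measurability, without any separability of the measure space.
\<close>

section \<open>Essential suprema of families of functions\<close>

text \<open>Nothing singles out a countable set of decompositions or partitions, and a pointwise
  supremum of uncountably many functions known only up to null sets is meaningless. Sigma-finiteness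
  reduces it to countably many members, directedness turns these into an increasing sequence, and
  then monotone convergence applies. So the recurring task is directedness: for decompositions by
  the products \<open>u_i * v_j / m\<close>, for partitions by cutting intervals. The two
  contraction hypotheses act separately. Contractivity in \<open>L^1\<close> makes the image of a
  remainder with small integral small; this gives continuity of the modulus along increasing
  sequences and \<open>|A f| \<le> |A| |f|\<close>. Contractivity in \<open>L^\<infinity>\<close>
  gives \<open>|A| 1 \<le> 1\<close>. Both are used on \<open>L^1 \<inter> L^\<infinity>\<close>,
  which every \<open>T t\<close> maps into itself, so no extension of \<open>T t\<close> enters; the
  extensions to \<open>L^p\<close> are built afterwards from the domination. Continuity of orbits is
  available only in mean, so the lower bound on \<open>S_r u\<close> is formulated in measure, with
  a finite weight, and pointwise statements are recovered along subsequences.\<close>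

text \<open>The chosen function is required to be literally a countable supremum of members.
  Measurability and leastness then follow at once, because an almost everywhere upper bound of all
  members bounds countably many of them simultaneously.\<close>

definition ess_Sup :: "'a measure \<Rightarrow> ('a \<Rightarrow> ennreal) set \<Rightarrow> 'a \<Rightarrow> ennreal" where
  "ess_Sup M F = (SOME g. (\<exists>a::nat \<Rightarrow> 'a \<Rightarrow> ennreal. range a \<subseteq> F \<and> g = (\<lambda>x. SUP n. a n x)) \<and>
     (\<forall>f\<in>F. AE x in M. f x \<le> g x))"

lemma ennreal_inverse_less:
  fixes a b :: ennreal
  assumes "a < b"
  shows "inverse b < inverse a"
proof (cases a)
  case (real r)
  note r = this
  show ?thesis
  proof (cases b)
    case (real s)
    with r assms have "r < s" by (simp add: ennreal_less_iff)
    then show ?thesis using r real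
      by (cases "r = 0") (auto simp: inverse_ennreal ennreal_less_iff)
  next
    case top
    then show ?thesis using r by (cases "r = 0") (auto simp: inverse_ennreal ennreal_less_iff)
  qed
qed (use assms in auto)

lemma ennreal_inverse_antimono:
  fixes a b :: ennreal
  assumes "a \<le> b"
  shows "inverse b \<le> inverse a"
  using ennreal_inverse_less[of a b] assms by (cases "a = b") (auto simp: le_less)

text \<open>An exhaustion argument: among countable subfamilies one minimises a bounded, strictly
  decreasing functional of their supremum. At a minimiser, adjoining any further member cannot
  enlarge the supremum on a set of positive measure.\<close>

lemma (in sigma_finite_measure) ex_ess_Sup:
  fixes F :: "('a \<Rightarrow> ennreal) set"
  assumes F: "F \<subseteq> borel_measurable M" "F \<noteq> {}"
  shows "\<exists>a::nat \<Rightarrow> 'a \<Rightarrow> ennreal. range a \<subseteq> F \<and> (\<forall>f\<in>F. AE x in M. f x \<le> (SUP n. a n x))"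
proof -
  obtain h where h [measurable]: "h \<in> borel_measurable M" and hfin: "integral\<^sup>N M h \<noteq> \<infinity>"
    and hpos: "\<And>x. x \<in> space M \<Longrightarrow> 0 < h x \<and> h x < \<infinity>"
    using Ex_finite_integrable_function by auto
  \<comment> \<open>The map y to 1/(1+y) keeps the values bounded even where the supremum is
    infinite, and the integrable positive weight \<open>h\<close> makes the integral finite, so
    strict inequality of integrands is detected.\<close>
  define J where "J a = (\<integral>\<^sup>+x. inverse (1 + (SUP n. a n x)) * h x \<partial>M)" for a :: "nat \<Rightarrow> 'a \<Rightarrow> ennreal"
  define \<A> where "\<A> = {a :: nat \<Rightarrow> 'a \<Rightarrow> ennreal. range a \<subseteq> F}"
  have meas: "a n \<in> borel_measurable M" if "a \<in> \<A>" for a n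
    using that F(1) unfolding \<A>_def by auto
  have Jmono: "J b \<le> J a" if "\<And>n x. \<exists>m. a n x \<le> b m x" for a b
    unfolding J_def
    by (intro nn_integral_mono mult_right_mono ennreal_inverse_antimono add_mono SUP_mono) (use that in auto)
  obtain f where "f \<in> F" using F by auto
  then have ne: "J ` \<A> \<noteq> {}" unfolding \<A>_def by (auto intro!: exI[of _ "\<lambda>_. f"])
  obtain q :: "nat \<Rightarrow> ennreal" where q: "range q \<subseteq> J ` \<A>" "Inf (J ` \<A>) = (INF i. q i)"
    using ennreal_Inf_countable_INF[OF ne] by auto
  have "\<forall>k. \<exists>a\<in>\<A>. q k = J a" using q(1) by auto
  then obtain B where B: "\<And>k. B k \<in> \<A>" "\<And>k. q k = J (B k)" by metis
  \<comment> \<open>Merging a minimising sequence of subfamilies into a single one by the pairing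
    function attains the infimum.\<close>
  define a where "a n = (case prod_decode n of (k, i) \<Rightarrow> B k i)" for n
  have aA: "a \<in> \<A>" using B(1) unfolding \<A>_def a_def image_subset_iff by (auto split: prod.split)
  have "J a \<le> q k" for k
    unfolding B(2) by (rule Jmono) (auto simp: a_def intro!: exI[of _ "prod_encode (k, _)"])
  then have amin: "J a \<le> J b" if "b \<in> \<A>" for b
    using INF_greatest[of UNIV "J a" q] that unfolding q(2)[symmetric] 
    by (meson INF_lower order_trans)
  have "AE x in M. f x \<le> (SUP n. a n x)" if "f \<in> F" for f
  proof (rule ccontr)
    assume *: "\<not> (AE x in M. f x \<le> (SUP n. a n x))"
    define b where "b = case_nat f a"
    have bA: "b \<in> \<A>" using aA that unfolding \<A>_def b_def image_subset_iff by (auto split: nat.split)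
    note [measurable] = meas[OF aA] meas[OF bA]
    have le: "a n x \<le> (SUP n. b n x)" for n x
      by (rule SUP_upper2[of "Suc n"]) (auto simp: b_def)
    have fle: "f x \<le> (SUP n. b n x)" for x
      by (rule SUP_upper2[of "0"]) (auto simp: b_def)
    have "J b < J a"
      unfolding J_def
    proof (rule nn_integral_less)
      have "J b \<le> (\<integral>\<^sup>+x. h x \<partial>M)"
        unfolding J_def
      proof (intro nn_integral_mono)
        fix x
        have "inverse (1 + (SUP n. b n x)) \<le> inverse (1::ennreal)"
          by (rule ennreal_inverse_antimono) (simp add: add_increasing2)
        then have "inverse (1 + (SUP n. b n x)) * h x \<le> 1 * h x"
          by (intro mult_right_mono) simp_all
        then show "inverse (1 + (SUP n. b n x)) * h x \<le> h x" by simp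
      qed
      then show "(\<integral>\<^sup>+x. inverse (1 + (SUP n. b n x)) * h x \<partial>M) \<noteq> \<infinity>"
        using hfin unfolding J_def by (auto simp: top_unique)
      show "AE x in M. inverse (1 + (SUP n. b n x)) * h x \<le> inverse (1 + (SUP n. a n x)) * h x"
        by (intro AE_I2 mult_right_mono ennreal_inverse_antimono add_mono SUP_least le) auto
      show "\<not> (AE x in M. inverse (1 + (SUP n. a n x)) * h x \<le> inverse (1 + (SUP n. b n x)) * h x)"
      proof
        assume "AE x in M. inverse (1 + (SUP n. a n x)) * h x \<le> inverse (1 + (SUP n. b n x)) * h x"
        with AE_space have "AE x in M. f x \<le> (SUP n. a n x)"
        proof (eventually_elim, goal_cases)
          case x: (1 x)
          show "f x \<le> (SUP n. a n x)"
          proof (rule ccontr)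
            assume "\<not> ?thesis"
            then have "1 + (SUP n. a n x) < 1 + (SUP n. b n x)"
              using fle[of x] by (simp add: ennreal_add_left_cancel_less)
            from ennreal_inverse_less[OF this] have "inverse (1 + (SUP n. b n x)) * h x < inverse (1 + (SUP n. a n x)) * h x"
              using hpos x by (intro ennreal_mult_strict_right_mono) auto
            with x show False by simp
          qed
        qed
        with * show False by simp
      qed
    qed measurable
    then show False using amin[OF bA] by simp
  qed
  then show ?thesis using aA unfolding \<A>_def by auto
qed

lemma (in sigma_finite_measure) ess_Sup:
  assumes "F \<subseteq> borel_measurable M" "F \<noteq> {}"
  shows ess_Sup_sequence: "\<exists>a::nat \<Rightarrow> 'a \<Rightarrow> ennreal. range a \<subseteq> F \<and> ess_Sup M F = (\<lambda>x. SUP n. a n x)"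
    and ess_Sup_upper: "f \<in> F \<Longrightarrow> AE x in M. f x \<le> ess_Sup M F x"
proof -
  have "\<exists>g. (\<exists>a::nat \<Rightarrow> 'a \<Rightarrow> ennreal. range a \<subseteq> F \<and> g = (\<lambda>x. SUP n. a n x)) \<and> (\<forall>f\<in>F. AE x in M. f x \<le> g x)"
    using ex_ess_Sup[OF assms] by auto
  from someI_ex[OF this, folded ess_Sup_def]
  show "\<exists>a::nat \<Rightarrow> 'a \<Rightarrow> ennreal. range a \<subseteq> F \<and> ess_Sup M F = (\<lambda>x. SUP n. a n x)"
    and "f \<in> F \<Longrightarrow> AE x in M. f x \<le> ess_Sup M F x" by auto
qed

lemma (in sigma_finite_measure) ess_Sup_measurable:
  assumes "F \<subseteq> borel_measurable M" "F \<noteq> {}"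
  shows "ess_Sup M F \<in> borel_measurable M"
proof -
  obtain a :: "nat \<Rightarrow> 'a \<Rightarrow> ennreal" where a: "range a \<subseteq> F" "ess_Sup M F = (\<lambda>x. SUP n. a n x)"
    using ess_Sup_sequence[OF assms] by auto
  then have [measurable]: "a n \<in> borel_measurable M" for n using assms(1) by auto
  show ?thesis unfolding a(2) by measurable
qed

lemma (in sigma_finite_measure) ess_Sup_least:
  assumes "F \<subseteq> borel_measurable M" "F \<noteq> {}" "\<And>f. f \<in> F \<Longrightarrow> AE x in M. f x \<le> g x"
  shows "AE x in M. ess_Sup M F x \<le> g x"
proof -
  obtain a :: "nat \<Rightarrow> 'a \<Rightarrow> ennreal" where a: "range a \<subseteq> F" "ess_Sup M F = (\<lambda>x. SUP n. a n x)"
    using ess_Sup_sequence[OF assms(1,2)] by auto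
  have "AE x in M. \<forall>n. a n x \<le> g x"
    using a(1) assms(3) by (auto simp: AE_all_countable)
  then show ?thesis unfolding a(2) by eventually_elim (auto intro: SUP_least)
qed

text \<open>Choosing \<open>b (Suc n)\<close> above both \<open>b n\<close> and the next term of a
  countable family that realises the supremum replaces that family by an increasing one.\<close>

lemma (in sigma_finite_measure) ess_Sup_directed:
  assumes F: "F \<subseteq> borel_measurable M" "F \<noteq> {}"
    and dir: "\<And>f g. f \<in> F \<Longrightarrow> g \<in> F \<Longrightarrow> \<exists>h\<in>F. (AE x in M. f x \<le> h x) \<and> (AE x in M. g x \<le> h x)"
  obtains b :: "nat \<Rightarrow> 'a \<Rightarrow> ennreal" where "range b \<subseteq> F" "AE x in M. incseq (\<lambda>n. b n x)"
    "AE x in M. ess_Sup M F x = (SUP n. b n x)"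
proof -
  obtain a :: "nat \<Rightarrow> 'a \<Rightarrow> ennreal" where a: "range a \<subseteq> F" "ess_Sup M F = (\<lambda>x. SUP n. a n x)"
    using ess_Sup_sequence[OF F] by auto
  have "\<exists>b. \<forall>n. (b n \<in> F \<and> (AE x in M. a n x \<le> b n x)) \<and> (AE x in M. b n x \<le> b (Suc n) x)"
  proof (intro dependent_nat_choice)
    show "\<exists>f. f \<in> F \<and> (AE x in M. a 0 x \<le> f x)" using a(1) by (intro exI[of _ "a 0"]) auto
    show "\<exists>y. (y \<in> F \<and> (AE x in M. a (Suc n) x \<le> y x)) \<and> (AE x in M. f x \<le> y x)"
      if "f \<in> F \<and> (AE x in M. a n x \<le> f x)" for f n
      using dir[of f "a (Suc n)"] that a(1) by auto
  qed
  then obtain b where b: "\<And>n. b n \<in> F" "\<And>n. AE x in M. a n x \<le> b n x"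
      "\<And>n. AE x in M. b n x \<le> b (Suc n) x" by auto
  have "AE x in M. \<forall>n. b n x \<le> b (Suc n) x" using b(3) by (simp add: AE_all_countable)
  then have 1: "AE x in M. incseq (\<lambda>n. b n x)" by eventually_elim (rule incseq_SucI, simp)
  have "AE x in M. \<forall>n. a n x \<le> b n x" using b(2) by (simp add: AE_all_countable)
  moreover have "AE x in M. \<forall>n. b n x \<le> ess_Sup M F x"
    using ess_Sup_upper[OF F b(1)] by (simp add: AE_all_countable)
  ultimately have "AE x in M. ess_Sup M F x = (SUP n. b n x)"
  proof eventually_elim
    case (elim x)
    then have "ess_Sup M F x \<le> (SUP n. b n x)"
      unfolding a(2) by (intro SUP_mono) auto
    with elim show ?case by (intro antisym SUP_least) auto
  qed
  with 1 b(1) show ?thesis by (intro that[of b]) auto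
qed

section \<open>Positive contractions\<close>

text \<open>The convex function \<open>x powr p\<close> lies above its tangent at \<open>a\<close>;
  for p > 1 this is Young's inequality for \<open>x\<close> and \<open>a powr (p - 1)\<close> with
  the conjugate exponent p/(p-1).\<close>

lemma tangent_line_powr:
  fixes a x p :: real
  assumes "1 \<le> p" "0 < a" "0 \<le> x"
  shows "p * a powr (p - 1) * x \<le> x powr p + (p - 1) * a powr p"
proof (cases "p = 1")
  case False
  then have p: "1 < p" using assms by simp
  define q where "q = p / (p - 1)"
  have q: "1 < q" "1 / p + 1 / q = 1" "(p - 1) * q = p" using p by (auto simp: q_def field_simps)
  from Youngs_inequality[OF p q(1,2) assms(3), of "a powr (p - 1)"]
  have "x * a powr (p - 1) \<le> x powr p / p + a powr p / q"
    by (simp add: powr_powr q(3))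
  then have "p * (x * a powr (p - 1)) \<le> p * (x powr p / p + a powr p / q)"
    using p by (intro mult_left_mono) auto
  also have "\<dots> = x powr p + (p - 1) * a powr p" using p by (simp add: q_def field_simps)
  finally show ?thesis by (simp add: mult_ac)
qed (use assms in auto)

text \<open>Operators act on all extended nonnegative functions, so one map serves every exponent.
  Continuity along increasing sequences, \<open>SUP\<close>, takes the place of norm continuity; the
  last two assumptions are contractivity in \<open>L^1\<close> and, via monotonicity, in
  \<open>L^\<infinity>\<close>.\<close>

locale positive_contraction = sigma_finite_measure M for M :: "'a measure" +
  fixes P :: "('a \<Rightarrow> ennreal) \<Rightarrow> 'a \<Rightarrow> ennreal"
  assumes measurable_op: "f \<in> borel_measurable M \<Longrightarrow> P f \<in> borel_measurable M"
    and mono: "\<lbrakk>f \<in> borel_measurable M; g \<in> borel_measurable M; AE x in M. f x \<le> g x\<rbrakk>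
      \<Longrightarrow> AE x in M. P f x \<le> P g x"
    and add: "\<lbrakk>f \<in> borel_measurable M; g \<in> borel_measurable M\<rbrakk>
      \<Longrightarrow> AE x in M. P (\<lambda>x. f x + g x) x = P f x + P g x"
    and cmult: "\<lbrakk>f \<in> borel_measurable M; 0 \<le> c\<rbrakk> \<Longrightarrow> AE x in M. P (\<lambda>x. ennreal c * f x) x = ennreal c * P f x"
    and SUP: "\<lbrakk>\<And>n::nat. F n \<in> borel_measurable M; incseq F\<rbrakk>
      \<Longrightarrow> AE x in M. P (\<lambda>x. SUP n. F n x) x \<le> (SUP n. P (F n) x)"
    and nn_integral_le: "f \<in> borel_measurable M \<Longrightarrow> (\<integral>\<^sup>+x. P f x \<partial>M) \<le> (\<integral>\<^sup>+x. f x \<partial>M)"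
    and one_le: "AE x in M. P (\<lambda>_. 1) x \<le> 1"
begin

lemma AE_cong:
  assumes [measurable]: "f \<in> borel_measurable M" "g \<in> borel_measurable M" and "AE x in M. f x = g x"
  shows "AE x in M. P f x = P g x"
proof -
  have "AE x in M. P f x \<le> P g x" by (rule mono) (use assms in auto)
  moreover have "AE x in M. P g x \<le> P f x" by (rule mono) (use assms in auto)
  ultimately show ?thesis by eventually_elim auto
qed

lemma SUP_eq:
  assumes F: "\<And>n::nat. F n \<in> borel_measurable M" "incseq F"
  shows "AE x in M. P (\<lambda>x. SUP n. F n x) x = (SUP n. P (F n) x)"
proof -
  note [measurable] = F(1)
  have "AE x in M. \<forall>n. P (F n) x \<le> P (\<lambda>x. SUP n. F n x) x"
    unfolding AE_all_countable by (intro allI mono AE_I2 SUP_upper) measurable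
  with SUP[OF F] show ?thesis by eventually_elim (auto intro: antisym SUP_least)
qed

lemma incseq_AE:
  assumes F: "\<And>n::nat. F n \<in> borel_measurable M" "incseq F"
  shows "AE x in M. incseq (\<lambda>n. P (F n) x)"
proof -
  have "AE x in M. \<forall>n. P (F n) x \<le> P (F (Suc n)) x"
    unfolding AE_all_countable using F by (intro allI mono AE_I2) (auto simp: incseq_def le_fun_def)
  then show ?thesis by eventually_elim (auto intro: incseq_SucI)
qed

text \<open>Images under another operator increase only almost everywhere; running maxima give a
  sequence that increases everywhere and agrees with the given one almost everywhere.\<close>

lemma SUP_eq_AE:
  assumes F: "\<And>n::nat. F n \<in> borel_measurable M" "AE x in M. incseq (\<lambda>n. F n x)"
  shows "AE x in M. P (\<lambda>x. SUP n. F n x) x = (SUP n. P (F n) x)"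
proof -
  note [measurable] = F(1)
  define G where "G n x = (SUP k\<in>{..n}. F k x)" for n x
  have [measurable]: "G n \<in> borel_measurable M" for n unfolding G_def by measurable
  have "incseq G" unfolding G_def incseq_def le_fun_def by (auto intro!: SUP_subset_mono)
  have eq: "AE x in M. \<forall>n. G n x = F n x"
    using F(2)
  proof eventually_elim
    case (elim x)
    then show ?case unfolding G_def by (auto simp: incseq_def intro!: antisym SUP_least SUP_upper)
  qed
  have "AE x in M. \<forall>n. P (G n) x = P (F n) x"
    unfolding AE_all_countable by (intro allI AE_cong) (use eq in \<open>auto simp: AE_all_countable\<close>)
  moreover have "AE x in M. P (\<lambda>x. SUP n. G n x) x = P (\<lambda>x. SUP n. F n x) x"
    by (rule AE_cong) (use eq in \<open>auto\<close>)
  moreover have "AE x in M. P (\<lambda>x. SUP n. G n x) x = (SUP n. P (G n) x)"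
    by (rule SUP_eq) (use \<open>incseq G\<close> in auto)
  ultimately show ?thesis by eventually_elim auto
qed

lemma const_le:
  assumes "0 \<le> c"
  shows "AE x in M. P (\<lambda>_. ennreal c) x \<le> ennreal c"
proof -
  have "AE x in M. P (\<lambda>x. ennreal c * 1) x = ennreal c * P (\<lambda>_. 1) x"
    by (rule cmult) (use assms in auto)
  with one_le show ?thesis
    by eventually_elim (use mult_left_mono[of _ 1 "ennreal c"] in auto)
qed

lemma Linf:
  assumes [measurable]: "f \<in> borel_measurable M" and "0 \<le> c" "AE x in M. f x \<le> ennreal c"
  shows "AE x in M. P f x \<le> ennreal c"
proof -
  have "AE x in M. P f x \<le> P (\<lambda>_. ennreal c) x" by (rule mono) (use assms in auto)
  with const_le[OF assms(2)] show ?thesis by eventually_elim auto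
qed

lemma finite_AE:
  assumes [measurable]: "f \<in> borel_measurable M" and "(\<integral>\<^sup>+x. f x \<partial>M) < \<infinity>"
  shows "AE x in M. P f x < \<infinity>"
proof -
  have "(\<integral>\<^sup>+x. P f x \<partial>M) < \<infinity>" using nn_integral_le[of f] assms by auto
  then have "AE x in M. P f x \<noteq> \<infinity>"
    by (intro nn_integral_PInf_AE measurable_op) auto
  then show ?thesis by eventually_elim (simp add: less_top)
qed

text \<open>Jensen's inequality: \<open>x\<^sup>p\<close> is the supremum of its tangents at rational points, and each
  tangent inequality is preserved because the operator is positive and maps 1 below 1.\<close>

lemma powr_le:
  assumes [measurable]: "u \<in> borel_measurable M" and u0: "\<And>x. 0 \<le> u x" and p: "1 \<le> p"
    and fin: "(\<integral>\<^sup>+x. ennreal (u x powr p) \<partial>M) < \<infinity>"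
  shows "AE x in M. P (\<lambda>x. ennreal (u x)) x < \<infinity> \<and>
    ennreal (enn2real (P (\<lambda>x. ennreal (u x)) x) powr p) \<le> P (\<lambda>x. ennreal (u x powr p)) x"
proof -
  let ?Pu = "P (\<lambda>x. ennreal (u x))" and ?Pp = "P (\<lambda>x. ennreal (u x powr p))"
  have tan: "AE x in M. ennreal (p * a powr (p - 1)) * ?Pu x \<le> ?Pp x + ennreal ((p - 1) * a powr p)" 
    if a: "0 < a" for a
  proof -
    have "AE x in M. P (\<lambda>x. ennreal (p * a powr (p - 1)) * ennreal (u x)) x
        \<le> P (\<lambda>x. ennreal (u x powr p) + ennreal ((p - 1) * a powr p)) x"
    proof (rule mono)
      show "AE x in M. ennreal (p * a powr (p - 1)) * ennreal (u x)
          \<le> ennreal (u x powr p) + ennreal ((p - 1) * a powr p)"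
        using tangent_line_powr[OF p a u0] p u0
        by (intro AE_I2) (simp add: ennreal_mult'[symmetric] ennreal_plus[symmetric] ennreal_leI del: ennreal_plus)
    qed measurable
    moreover have "AE x in M. P (\<lambda>x. ennreal (p * a powr (p - 1)) * ennreal (u x)) x = ennreal (p * a powr (p - 1)) * ?Pu x"
      by (rule cmult) (use p in auto)
    moreover have "AE x in M. P (\<lambda>x. ennreal (u x powr p) + ennreal ((p - 1) * a powr p)) x
        = ?Pp x + P (\<lambda>_. ennreal ((p - 1) * a powr p)) x"
      by (rule add) measurable
    moreover have "AE x in M. P (\<lambda>_. ennreal ((p - 1) * a powr p)) x \<le> ennreal ((p - 1) * a powr p)"
      by (rule const_le) (use p in auto)
    ultimately show ?thesis
      by eventually_elim (use add_left_mono in \<open>fastforce intro: order_trans\<close>)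
  qed
  have "AE x in M. ?Pp x < \<infinity>" by (rule finite_AE) (use fin in auto)
  moreover have "AE x in M. \<forall>a\<in>\<rat>\<inter>{0<..}. ennreal (p * a powr (p - 1)) * ?Pu x \<le> ?Pp x + ennreal ((p - 1) * a powr p)"
    by (subst AE_ball_countable) (auto intro: tan countable_Int1 countable_rat)
  ultimately show ?thesis
  proof eventually_elim
    case (elim x)
    obtain z where z: "?Pp x = ennreal z" "0 \<le> z" using elim(1) by (cases "?Pp x") auto
    \<comment> \<open>The tangent at 1 already bounds \<open>?Pu x\<close> by the finite
      \<open>?Pp x\<close>, so real arithmetic becomes available.\<close>
    have "ennreal p * ?Pu x \<le> ennreal (z + (p - 1))"
      using elim(2)[rule_format, of 1] z p by (simp add: ennreal_plus[symmetric] del: ennreal_plus)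
    then have "?Pu x \<noteq> top" using p by (auto simp: ennreal_mult_top top_unique)
    then obtain y where y: "?Pu x = ennreal y" "0 \<le> y" by (cases "?Pu x") auto
    have rat: "p * a powr (p - 1) * y \<le> z + (p - 1) * a powr p" if "a \<in> \<rat>" "0 < a" for a
    proof -
      have "ennreal (p * a powr (p - 1)) * ennreal y \<le> ennreal z + ennreal ((p - 1) * a powr p)"
        using elim(2)[rule_format, of a] that y z by simp
      then have "ennreal (p * a powr (p - 1) * y) \<le> ennreal (z + (p - 1) * a powr p)"
        using p y z by (simp add: ennreal_mult'[symmetric] ennreal_plus[symmetric] del: ennreal_plus)
      then show ?thesis using p y z by (subst (asm) ennreal_le_iff) auto
    qed
    have "y powr p \<le> z"
    proof (cases "y = 0")
      case False
      then have y0: "0 < y" using y by simp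
      obtain r where r: "\<And>n::nat. r n \<in> \<rat>" "\<And>n. y < r n" "r \<longlonglongrightarrow> y"
      proof -
        have "\<exists>q\<in>\<rat>. y < q \<and> q < y + 1 / Suc n" for n by (rule Rats_dense_in_real) simp
        then obtain r where r: "\<And>n::nat. r n \<in> \<rat>" "\<And>n. y < r n" "\<And>n. r n < y + 1 / Suc n" by metis
        have "(\<lambda>n. y + 1 / Suc n) \<longlonglongrightarrow> y + 0"
          by (intro tendsto_intros LIMSEQ_inverse_real_of_nat[unfolded inverse_eq_divide])
        then have "r \<longlonglongrightarrow> y"
          by (intro tendsto_sandwich[of "\<lambda>_. y" r sequentially "\<lambda>n. y + 1 / Suc n"])
             (use r in \<open>auto simp: less_imp_le\<close>)
        with r that show ?thesis by blast
      qed
      \<comment> \<open>The optimal tangent point is \<open>y\<close> itself, which may be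
        irrational; it is reached as a limit of rational ones.\<close>
      have "p * y powr (p - 1) * y \<le> z + (p - 1) * y powr p"
      proof (rule LIMSEQ_le)
        show "(\<lambda>n. p * r n powr (p - 1) * y) \<longlonglongrightarrow> p * y powr (p - 1) * y"
          using y0 r(3) by (intro tendsto_intros) auto
        show "(\<lambda>n. z + (p - 1) * r n powr p) \<longlonglongrightarrow> z + (p - 1) * y powr p"
          using y0 r(3) by (intro tendsto_intros) auto
        show "\<exists>N. \<forall>n\<ge>N. p * r n powr (p - 1) * y \<le> z + (p - 1) * r n powr p"
          using rat r y0 by (meson less_trans)
      qed
      moreover have "y powr (p - 1) * y = y powr p" using y0 by (simp add: powr_diff)
      ultimately show ?thesis by (simp add: algebra_simps)
    qed (use z in auto)
    then show ?case using y z by (auto intro: ennreal_leI)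
  qed
qed

lemma nn_integral_powr_le:
  assumes [measurable]: "u \<in> borel_measurable M" and u0: "\<And>x. 0 \<le> u x" and p: "1 \<le> p"
    and fin: "(\<integral>\<^sup>+x. ennreal (u x powr p) \<partial>M) < \<infinity>"
  shows "(\<integral>\<^sup>+x. ennreal (enn2real (P (\<lambda>x. ennreal (u x)) x) powr p) \<partial>M)
      \<le> (\<integral>\<^sup>+x. ennreal (u x powr p) \<partial>M)"
proof -
  have "(\<integral>\<^sup>+x. ennreal (enn2real (P (\<lambda>x. ennreal (u x)) x) powr p) \<partial>M)
      \<le> (\<integral>\<^sup>+x. P (\<lambda>x. ennreal (u x powr p)) x \<partial>M)"
    by (rule nn_integral_mono_AE) (use powr_le[OF assms] in \<open>auto\<close>)
  also have "\<dots> \<le> (\<integral>\<^sup>+x. ennreal (u x powr p) \<partial>M)" by (rule nn_integral_le) measurable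
  finally show ?thesis .
qed

text \<open>With \<open>g n\<close> the supremum of the tail, \<open>F - g n\<close> increases to
  \<open>F\<close>, so its image increases to \<open>P F\<close>. Where \<open>P F\<close> is
  finite, subtraction gives that \<open>P (g n)\<close> tends to 0. Integrability of
  \<open>F\<close> is replaced by finiteness of \<open>P F\<close>, which holds for the moduli of
  all \<open>L^p\<close> functions.\<close>

lemma dominated_convergence:
  assumes f [measurable]: "\<And>n::nat. f n \<in> borel_measurable M" and F [measurable]: "F \<in> borel_measurable M"
    and le: "\<And>n. AE x in M. f n x \<le> F x"
    and fin: "AE x in M. F x < \<infinity>" "AE x in M. P F x < \<infinity>"
    and lim: "AE x in M. (\<lambda>n. f n x) \<longlonglongrightarrow> 0"
  shows "AE x in M. (\<lambda>n. P (f n) x) \<longlonglongrightarrow> 0"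
proof -
  define g where "g n x = (SUP k\<in>{n..}. f k x)" for n x
  have [measurable]: "g n \<in> borel_measurable M" for n unfolding g_def by measurable
  have decg: "g m x \<le> g n x" if "n \<le> m" for n m x
    unfolding g_def by (rule SUP_subset_mono) (use that in auto)
  have "AE x in M. \<forall>n. f n x \<le> F x" using le by (simp add: AE_all_countable)
  then have gle: "AE x in M. \<forall>n. g n x \<le> F x"
    by eventually_elim (auto simp: g_def intro: SUP_least)
  have glim: "AE x in M. (\<lambda>n. g n x) \<longlonglongrightarrow> 0"
    using lim
  proof eventually_elim
    case (elim x)
    have "limsup (\<lambda>n. f n x) = 0" using lim_imp_Limsup[OF _ elim] by simp
    then have "(INF n. g n x) = 0" unfolding g_def limsup_INF_SUP by simp
    moreover have "(\<lambda>n. g n x) \<longlonglongrightarrow> (INF n. g n x)"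
      by (rule LIMSEQ_INF) (auto simp: decseq_def decg)
    ultimately show ?case by simp
  qed
  let ?G = "\<lambda>n x. F x - g n x"
  have sup: "AE x in M. P (\<lambda>x. SUP n. ?G n x) x = (SUP n. P (?G n) x)"
    by (rule SUP_eq) (auto simp: incseq_def le_fun_def intro!: ennreal_minus_mono decg)
  have inc: "AE x in M. incseq (\<lambda>n. P (?G n) x)"
    by (rule incseq_AE) (auto simp: incseq_def le_fun_def intro!: ennreal_minus_mono decg)
  have eqF: "AE x in M. P (\<lambda>x. SUP n. ?G n x) x = P F x"
  proof (rule AE_cong)
    show "AE x in M. (SUP n. ?G n x) = F x"
      using glim fin(1)
    proof eventually_elim
      case (elim x)
      have "(\<lambda>n. ?G n x) \<longlonglongrightarrow> F x - 0"
        by (intro tendsto_diff_ennreal tendsto_const elim(1)) (use elim in auto)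
      moreover have "(\<lambda>n. ?G n x) \<longlonglongrightarrow> (SUP n. ?G n x)"
        by (rule LIMSEQ_SUP) (auto simp: incseq_def intro!: ennreal_minus_mono decg)
      ultimately show ?case using LIMSEQ_unique by fastforce
    qed
  qed measurable
  have "AE x in M. \<forall>n. P (\<lambda>x. ?G n x + g n x) x = P (?G n) x + P (g n) x"
    unfolding AE_all_countable by (intro allI add) measurable
  moreover have "AE x in M. \<forall>n. P (\<lambda>x. ?G n x + g n x) x = P F x"
    unfolding AE_all_countable
    by (intro allI AE_cong) (use gle in \<open>auto simp: diff_add_cancel_ennreal\<close>)
  moreover have "AE x in M. \<forall>n. P (f n) x \<le> P (g n) x"
    unfolding AE_all_countable by (intro allI mono AE_I2) (auto simp: g_def intro: SUP_upper)
  ultimately show ?thesis using sup eqF inc fin(2)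
  proof eventually_elim
    case (elim x)
    have lim: "(\<lambda>n. P (?G n) x) \<longlonglongrightarrow> P F x" using LIMSEQ_SUP[OF elim(6)] elim(4,5) by simp
    have le: "P (?G n) x \<le> P F x" for n using elim(1,2) by (metis le_iff_add)
    have "P (g n) x = P F x - P (?G n) x" for n
      using elim(1,2,7) le[of n]
      by (metis ennreal_add_diff_cancel_left infinity_ennreal_def leD)
    moreover have "(\<lambda>n. P F x - P (?G n) x) \<longlonglongrightarrow> P F x - P F x"
      using elim(7) by (intro tendsto_diff_ennreal tendsto_const lim) simp_all
    ultimately have "(\<lambda>n. P (g n) x) \<longlonglongrightarrow> 0" using elim(7) by simp
    then show ?case
      by (rule tendsto_sandwich[OF _ _ tendsto_const, rotated -1]) (use elim(3) in auto)
  qed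
qed

end

section \<open>Compositions and directed suprema of positive contractions\<close>

lemma positive_contraction_id:
  assumes "sigma_finite_measure M"
  shows "positive_contraction M (\<lambda>f. f)"
proof -
  interpret sigma_finite_measure M by fact
  show ?thesis by unfold_locales auto
qed

lemma positive_contraction_comp:
  assumes "positive_contraction M P" "positive_contraction M Q"
  shows "positive_contraction M (\<lambda>f. P (Q f))"
proof -
  interpret P: positive_contraction M P by fact
  interpret Q: positive_contraction M Q by fact
  note [measurable] = P.measurable_op Q.measurable_op
  show ?thesis
  proof unfold_locales
    fix f g :: "'a \<Rightarrow> ennreal" and c :: real assume [measurable]: "f \<in> borel_measurable M"
    show "P (Q f) \<in> borel_measurable M" by measurable
    show "(\<integral>\<^sup>+x. P (Q f) x \<partial>M) \<le> (\<integral>\<^sup>+x. f x \<partial>M)"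
      by (rule order_trans[OF P.nn_integral_le Q.nn_integral_le]) measurable
    {
      assume "0 \<le> c"
      then have "AE x in M. P (Q (\<lambda>x. ennreal c * f x)) x = P (\<lambda>x. ennreal c * Q f x) x"
        by (intro P.AE_cong Q.cmult) measurable
      moreover have "AE x in M. P (\<lambda>x. ennreal c * Q f x) x = ennreal c * P (Q f) x"
        by (rule P.cmult) (use \<open>0 \<le> c\<close> in measurable)
      ultimately show "AE x in M. P (Q (\<lambda>x. ennreal c * f x)) x = ennreal c * P (Q f) x"
        by eventually_elim simp
    }
    assume [measurable]: "g \<in> borel_measurable M"
    show "AE x in M. P (Q f) x \<le> P (Q g) x" if "AE x in M. f x \<le> g x"
      by (intro P.mono Q.mono that) measurable
    have "AE x in M. P (Q (\<lambda>x. f x + g x)) x = P (\<lambda>x. Q f x + Q g x) x"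
      by (intro P.AE_cong Q.add) measurable
    moreover have "AE x in M. P (\<lambda>x. Q f x + Q g x) x = P (Q f) x + P (Q g) x"
      by (rule P.add) measurable
    ultimately show "AE x in M. P (Q (\<lambda>x. f x + g x)) x = P (Q f) x + P (Q g) x"
      by eventually_elim simp
  next
    fix F :: "nat \<Rightarrow> 'a \<Rightarrow> ennreal"
    assume F [measurable]: "\<And>n. F n \<in> borel_measurable M" and inc: "incseq F"
    have "AE x in M. P (Q (\<lambda>x. SUP n. F n x)) x = P (\<lambda>x. SUP n. Q (F n) x) x"
      by (intro P.AE_cong Q.SUP_eq inc) measurable
    moreover have "AE x in M. P (\<lambda>x. SUP n. Q (F n) x) x = (SUP n. P (Q (F n)) x)"
      by (rule P.SUP_eq_AE[OF _ Q.incseq_AE]) (use inc in auto)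
    ultimately show "AE x in M. P (Q (\<lambda>x. SUP n. F n x)) x \<le> (SUP n. P (Q (F n)) x)"
      by eventually_elim simp
  next
    show "AE x in M. P (Q (\<lambda>_. 1)) x \<le> 1"
      using P.Linf[of "Q (\<lambda>_. 1)" 1] Q.one_le by simp
  qed
qed

text \<open>The essential supremum is chosen for each \<open>f\<close> separately, so even
  additivity has to be recovered: one half is an upper bound, the other needs a single member of the
  family that dominates two given ones. The integral bound is monotone convergence along an
  increasing sequence.\<close>

lemma positive_contraction_ess_Sup:
  assumes M: "sigma_finite_measure M"
    and op: "\<And>P. P \<in> \<P> \<Longrightarrow> positive_contraction M P" and ne: "\<P> \<noteq> {}"
    and dir: "\<And>P Q. P \<in> \<P> \<Longrightarrow> Q \<in> \<P> \<Longrightarrow> \<exists>R\<in>\<P>. \<forall>f\<in>borel_measurable M.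
      (AE x in M. P f x \<le> R f x) \<and> (AE x in M. Q f x \<le> R f x)"
  shows "positive_contraction M (\<lambda>f. ess_Sup M ((\<lambda>P. P f) ` \<P>))"
proof -
  interpret sigma_finite_measure M by fact
  let ?S = "\<lambda>f. ess_Sup M ((\<lambda>P. P f) ` \<P>)"
  have sub: "(\<lambda>P. P f) ` \<P> \<subseteq> borel_measurable M" and ne': "(\<lambda>P. P f) ` \<P> \<noteq> {}" 
    if "f \<in> borel_measurable M" for f
    using that op ne by (auto intro: positive_contraction.measurable_op)
  have upper: "AE x in M. P f x \<le> ?S f x" if "f \<in> borel_measurable M" "P \<in> \<P>" for f P
    by (rule ess_Sup_upper[OF sub ne']) (use that in auto)
  have least: "AE x in M. ?S f x \<le> g x" 
    if "f \<in> borel_measurable M" "\<And>P. P \<in> \<P> \<Longrightarrow> AE x in M. P f x \<le> g x" for f g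
    by (rule ess_Sup_least[OF sub ne']) (use that in auto)
  have [measurable]: "?S f \<in> borel_measurable M" if "f \<in> borel_measurable M" for f
    by (rule ess_Sup_measurable[OF sub ne']) (use that in auto)
  have seq: "\<exists>b. range b \<subseteq> \<P> \<and> (AE x in M. incseq (\<lambda>n::nat. b n f x)) \<and> 
      (AE x in M. ?S f x = (SUP n. b n f x))" if f: "f \<in> borel_measurable M" for f
  proof -
    obtain b :: "nat \<Rightarrow> 'a \<Rightarrow> ennreal" where b: "range b \<subseteq> (\<lambda>P. P f) ` \<P>" "AE x in M. incseq (\<lambda>n. b n x)"
      "AE x in M. ?S f x = (SUP n. b n x)"
    proof (rule ess_Sup_directed[OF sub[OF f] ne'[OF f]])
      fix g h assume "g \<in> (\<lambda>P. P f) ` \<P>" "h \<in> (\<lambda>P. P f) ` \<P>"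
      then show "\<exists>k\<in>(\<lambda>P. P f) ` \<P>. (AE x in M. g x \<le> k x) \<and> (AE x in M. h x \<le> k x)"
        using dir f by (simp add: image_iff) blast
    qed blast
    have "\<forall>n. \<exists>P\<in>\<P>. b n = P f" using b(1) by auto
    then obtain c where "\<And>n. c n \<in> \<P>" "\<And>n. b n = c n f" by metis
    with b show ?thesis by (intro exI[of _ c]) auto
  qed
  show ?thesis
  proof unfold_locales
    fix f g :: "'a \<Rightarrow> ennreal" and c :: real assume f [measurable]: "f \<in> borel_measurable M"
    show "?S f \<in> borel_measurable M" by measurable
    from seq[OF f] obtain b :: "nat \<Rightarrow> ('a \<Rightarrow> ennreal) \<Rightarrow> 'a \<Rightarrow> ennreal" where b: "range b \<subseteq> \<P>" 
      "AE x in M. incseq (\<lambda>n. b n f x)" "AE x in M. ?S f x = (SUP n. b n f x)" by blast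
    have bop: "positive_contraction M (b n)" for n using b(1) op by auto
    note [measurable] = positive_contraction.measurable_op[OF bop]
    show "(\<integral>\<^sup>+x. ?S f x \<partial>M) \<le> (\<integral>\<^sup>+x. f x \<partial>M)"
    proof -
      have "(\<integral>\<^sup>+x. ?S f x \<partial>M) = (\<integral>\<^sup>+x. (SUP n. b n f x) \<partial>M)"
        using b(3) by (rule nn_integral_cong_AE)
      also have "\<dots> = (SUP n. \<integral>\<^sup>+x. b n f x \<partial>M)"
        by (rule nn_integral_monotone_convergence_SUP_AE) (use b(2) in \<open>auto simp: incseq_Suc_iff\<close>)
      also have "\<dots> \<le> (\<integral>\<^sup>+x. f x \<partial>M)"
        by (intro SUP_least positive_contraction.nn_integral_le[OF bop]) measurable
      finally show ?thesis .
    qed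
    {
      assume c: "0 \<le> c"
      have "AE x in M. \<forall>n. b n (\<lambda>x. ennreal c * f x) x = ennreal c * b n f x"
        unfolding AE_all_countable using c by (intro allI positive_contraction.cmult[OF bop]) auto
      moreover have "AE x in M. \<forall>n. b n (\<lambda>x. ennreal c * f x) x \<le> ?S (\<lambda>x. ennreal c * f x) x"
        unfolding AE_all_countable using b by (intro allI upper) auto
      ultimately have "AE x in M. ennreal c * ?S f x \<le> ?S (\<lambda>x. ennreal c * f x) x"
        using b(3) by eventually_elim (auto simp: SUP_mult_left_ennreal intro: SUP_least)
      moreover have "AE x in M. ?S (\<lambda>x. ennreal c * f x) x \<le> ennreal c * ?S f x"
      proof (rule least)
        fix P assume P: "P \<in> \<P>"
        have "AE x in M. P (\<lambda>x. ennreal c * f x) x = ennreal c * P f x"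
          using c by (intro positive_contraction.cmult[OF op[OF P]]) auto
        then show "AE x in M. P (\<lambda>x. ennreal c * f x) x \<le> ennreal c * ?S f x"
          using upper[OF f P] by eventually_elim (auto intro: mult_left_mono)
      qed measurable
      ultimately show "AE x in M. ?S (\<lambda>x. ennreal c * f x) x = ennreal c * ?S f x"
        by eventually_elim auto
    }
    assume g [measurable]: "g \<in> borel_measurable M"
    show "AE x in M. ?S f x \<le> ?S g x" if "AE x in M. f x \<le> g x"
    proof (rule least)
      fix P assume P: "P \<in> \<P>"
      have "AE x in M. P f x \<le> P g x" by (rule positive_contraction.mono[OF op[OF P]]) (use that in auto)
      then show "AE x in M. P f x \<le> ?S g x" using upper[OF g P] by eventually_elim auto
    qed measurable
    from seq[OF g] obtain d :: "nat \<Rightarrow> ('a \<Rightarrow> ennreal) \<Rightarrow> 'a \<Rightarrow> ennreal" where d: "range d \<subseteq> \<P>" 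
      "AE x in M. incseq (\<lambda>n. d n g x)" "AE x in M. ?S g x = (SUP n. d n g x)" by blast
    have "AE x in M. b n f x + d n g x \<le> ?S (\<lambda>x. f x + g x) x" for n
    proof -
      \<comment> \<open>The approximations for \<open>f\<close> and for \<open>g\<close> use
        different members; one \<open>R\<close> above both is additive and bounds their sum.\<close>
      obtain R where R: "R \<in> \<P>" "AE x in M. b n f x \<le> R f x" "AE x in M. d n g x \<le> R g x"
        using dir[of "b n" "d n"] b(1) d(1) by (meson f g range_subsetD)
      have "AE x in M. R (\<lambda>x. f x + g x) x = R f x + R g x"
        by (rule positive_contraction.add[OF op[OF R(1)]]) measurable
      moreover have "AE x in M. R (\<lambda>x. f x + g x) x \<le> ?S (\<lambda>x. f x + g x) x"
        by (rule upper) (use R in auto)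
      ultimately show ?thesis using R(2,3)
        by eventually_elim (rule order_trans[OF add_mono], assumption, assumption, simp)
    qed
    then have "AE x in M. \<forall>n. b n f x + d n g x \<le> ?S (\<lambda>x. f x + g x) x"
      by (simp add: AE_all_countable)
    then have "AE x in M. ?S f x + ?S g x \<le> ?S (\<lambda>x. f x + g x) x"
      using b(2,3) d(2,3)
      by eventually_elim (auto simp: ennreal_SUP_add[symmetric] intro: SUP_least)
    moreover have "AE x in M. ?S (\<lambda>x. f x + g x) x \<le> ?S f x + ?S g x"
    proof (rule least)
      fix P assume P: "P \<in> \<P>"
      have "AE x in M. P (\<lambda>x. f x + g x) x = P f x + P g x"
        by (intro positive_contraction.add[OF op[OF P]]) auto
      then show "AE x in M. P (\<lambda>x. f x + g x) x \<le> ?S f x + ?S g x"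
        using upper[OF f P] upper[OF g P] by eventually_elim (auto intro: add_mono)
    qed measurable
    ultimately show "AE x in M. ?S (\<lambda>x. f x + g x) x = ?S f x + ?S g x"
      by eventually_elim auto
  next
    fix F :: "nat \<Rightarrow> 'a \<Rightarrow> ennreal"
    assume F [measurable]: "\<And>n. F n \<in> borel_measurable M" and inc: "incseq F"
    show "AE x in M. ?S (\<lambda>x. SUP n. F n x) x \<le> (SUP n. ?S (F n) x)"
    proof (rule least)
      fix P assume P: "P \<in> \<P>"
      have "AE x in M. \<forall>n. P (F n) x \<le> ?S (F n) x"
        unfolding AE_all_countable by (intro allI upper P) measurable
      moreover have "AE x in M. P (\<lambda>x. SUP n. F n x) x \<le> (SUP n. P (F n) x)"
        by (rule positive_contraction.SUP[OF op[OF P]]) (use inc in auto)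
      ultimately show "AE x in M. P (\<lambda>x. SUP n. F n x) x \<le> (SUP n. ?S (F n) x)"
        by eventually_elim (rule order_trans, assumption, rule SUP_mono', simp)
    qed measurable
  next
    show "AE x in M. ?S (\<lambda>_. 1) x \<le> 1"
      by (rule least) (auto intro: positive_contraction.one_le op)
  qed
qed

lemma (in positive_contraction) zero: "AE x in M. P (\<lambda>_. 0) x = 0"
  using cmult[of "\<lambda>_. 0" 0] by simp

lemma (in positive_contraction) sum_list:
  assumes "set fs \<subseteq> borel_measurable M"
  shows "AE x in M. P (\<lambda>x. \<Sum>f\<leftarrow>fs. f x) x = (\<Sum>f\<leftarrow>fs. P f x)"
  using assms
proof (induction fs)
  case (Cons f fs)
  then have [measurable]: "f \<in> borel_measurable M" "set fs \<subseteq> borel_measurable M" by auto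
  have "(\<lambda>x. \<Sum>f\<leftarrow>fs. f x) \<in> borel_measurable M"
    using \<open>set fs \<subseteq> _\<close> by (induction fs) auto
  then have "AE x in M. P (\<lambda>x. f x + (\<Sum>f\<leftarrow>fs. f x)) x = P f x + P (\<lambda>x. \<Sum>f\<leftarrow>fs. f x) x"
    by (intro add) auto
  with Cons.IH[OF \<open>set fs \<subseteq> _\<close>] show ?case by (auto elim: eventually_elim2)
qed (simp add: zero)

section \<open>The modulus of an operator\<close>

definition L1_Linf :: "'a measure \<Rightarrow> ('a \<Rightarrow> complex) set" where
  "L1_Linf M = {f. integrable M f \<and> (\<exists>c. AE x in M. norm (f x) \<le> c)}"

text \<open>Nonnegativity is required at every point, not almost everywhere, so that pointwise sums
  and quotients of decompositions need no exceptional sets.\<close>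

definition pos_L1_Linf :: "'a measure \<Rightarrow> ('a \<Rightarrow> real) set" where
  "pos_L1_Linf M = {u. integrable M u \<and> (\<forall>x. 0 \<le> u x) \<and> (\<exists>c. AE x in M. u x \<le> c)}"

lemma L1_LinfD:
  assumes "f \<in> L1_Linf M"
  shows "f \<in> borel_measurable M" "integrable M f"
  using assms by (auto simp: L1_Linf_def)

lemma pos_L1_LinfD:
  assumes "u \<in> pos_L1_Linf M"
  shows "u \<in> borel_measurable M" "integrable M u" "0 \<le> u x"
  using assms by (auto simp: pos_L1_Linf_def)

lemma L1_Linf_add:
  assumes "f \<in> L1_Linf M" "g \<in> L1_Linf M"
  shows "(\<lambda>x. f x + g x) \<in> L1_Linf M"
proof -
  obtain c d where "AE x in M. norm (f x) \<le> c" "AE x in M. norm (g x) \<le> d"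
    using assms by (auto simp: L1_Linf_def)
  then have "AE x in M. norm (f x + g x) \<le> c + d"
    by eventually_elim (meson add_mono norm_triangle_le)
  then show ?thesis using assms by (auto simp: L1_Linf_def)
qed

lemma L1_Linf_scale:
  assumes "f \<in> L1_Linf M"
  shows "(\<lambda>x. c * f x) \<in> L1_Linf M"
proof -
  obtain d where "AE x in M. norm (f x) \<le> d"
    using assms by (auto simp: L1_Linf_def)
  then have "AE x in M. norm (c * f x) \<le> norm c * d"
    by eventually_elim (simp add: norm_mult mult_left_mono)
  then show ?thesis using assms by (auto simp: L1_Linf_def)
qed

lemma L1_Linf_diff:
  assumes "f \<in> L1_Linf M" "g \<in> L1_Linf M"
  shows "(\<lambda>x. f x - g x) \<in> L1_Linf M"
  using L1_Linf_add[OF assms(1) L1_Linf_scale[OF assms(2), of "-1"]] by simp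

lemma L1_Linf_dominated:
  assumes "g \<in> L1_Linf M" "f \<in> borel_measurable M" "AE x in M. norm (f x) \<le> norm (g x)"
  shows "f \<in> L1_Linf M"
proof -
  obtain d where "AE x in M. norm (g x) \<le> d"
    using assms by (auto simp: L1_Linf_def)
  with assms(3) have "AE x in M. norm (f x) \<le> d" by eventually_elim simp
  moreover have "integrable M f"
    by (rule Bochner_Integration.integrable_bound[of M g]) (use assms in \<open>auto simp: L1_Linf_def\<close>)
  ultimately show ?thesis by (auto simp: L1_Linf_def)
qed

lemma of_real_L1_Linf:
  assumes "u \<in> pos_L1_Linf M"
  shows "(\<lambda>x. complex_of_real (u x)) \<in> L1_Linf M"
  using assms by (auto simp: pos_L1_Linf_def L1_Linf_def)

lemma norm_pos_L1_Linf:
  assumes "f \<in> L1_Linf M"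
  shows "(\<lambda>x. norm (f x)) \<in> pos_L1_Linf M"
  using assms by (auto simp: pos_L1_Linf_def L1_Linf_def)

lemma pos_L1_Linf_dominated:
  assumes "v \<in> pos_L1_Linf M" "u \<in> borel_measurable M" "\<And>x. 0 \<le> u x" "AE x in M. u x \<le> v x"
  shows "u \<in> pos_L1_Linf M"
proof -
  obtain d where "AE x in M. v x \<le> d"
    using assms by (auto simp: pos_L1_Linf_def)
  with assms(4) have "AE x in M. u x \<le> d" by eventually_elim simp
  moreover have "integrable M u"
    by (rule Bochner_Integration.integrable_bound[of M v]) (use assms in \<open>auto simp: pos_L1_Linf_def\<close>)
  ultimately show ?thesis using assms by (auto simp: pos_L1_Linf_def)
qed

lemma pos_L1_Linf_zero: "(\<lambda>_. 0) \<in> pos_L1_Linf M"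
  by (auto simp: pos_L1_Linf_def intro: exI[of _ 0])

lemma pos_L1_Linf_add:
  assumes "u \<in> pos_L1_Linf M" "v \<in> pos_L1_Linf M"
  shows "(\<lambda>x. u x + v x) \<in> pos_L1_Linf M"
proof -
  obtain c d where "AE x in M. u x \<le> c" "AE x in M. v x \<le> d"
    using assms by (auto simp: pos_L1_Linf_def)
  then have "AE x in M. u x + v x \<le> c + d" by eventually_elim simp
  then show ?thesis using assms by (auto simp: pos_L1_Linf_def)
qed

lemma pos_L1_Linf_scale:
  assumes "u \<in> pos_L1_Linf M" "0 \<le> c"
  shows "(\<lambda>x. c * u x) \<in> pos_L1_Linf M"
proof -
  obtain d where "AE x in M. u x \<le> d" using assms by (auto simp: pos_L1_Linf_def)
  then have "AE x in M. c * u x \<le> c * d" by eventually_elim (use assms in \<open>simp add: mult_left_mono\<close>)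
  then show ?thesis using assms by (auto simp: pos_L1_Linf_def)
qed

lemma pos_L1_Linf_sum_list:
  "set us \<subseteq> pos_L1_Linf M \<Longrightarrow> (\<lambda>x. \<Sum>u\<leftarrow>us. u x) \<in> pos_L1_Linf M"
  by (induction us) (auto intro: pos_L1_Linf_zero pos_L1_Linf_add)

lemma pos_L1_Linf_weight:
  assumes "u \<in> pos_L1_Linf M" "w \<in> borel_measurable M" "\<And>x. 0 \<le> w x" "\<And>x. w x \<le> 1"
  shows "(\<lambda>x. u x * w x) \<in> pos_L1_Linf M"
  using assms pos_L1_LinfD[OF assms(1)]
  by (intro pos_L1_Linf_dominated[OF assms(1)]) (auto intro!: AE_I2 mult_left_le)

lemma sum_list_ennreal:
  assumes "\<And>x. x \<in> set xs \<Longrightarrow> 0 \<le> f x"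
  shows "(\<Sum>x\<leftarrow>xs. ennreal (f x)) = ennreal (\<Sum>x\<leftarrow>xs. f x)"
proof -
  have "0 \<le> (\<Sum>x\<leftarrow>xs. f x) \<and> ?thesis"
    using assms by (induction xs) auto
  then show ?thesis ..
qed

lemma sum_list_swap:
  fixes g :: "'b \<Rightarrow> 'c \<Rightarrow> 'd::comm_monoid_add"
  shows "(\<Sum>u\<leftarrow>us. \<Sum>v\<leftarrow>vs. g u v) = (\<Sum>v\<leftarrow>vs. \<Sum>u\<leftarrow>us. g u v)"
  by (induction us) (auto simp: sum_list_addf)

lemma sum_list_map_concat:
  fixes g :: "'b \<Rightarrow> 'd::comm_monoid_add"
  shows "(\<Sum>z\<leftarrow>concat xss. g z) = (\<Sum>xs\<leftarrow>xss. \<Sum>z\<leftarrow>xs. g z)"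
  by (induction xss) auto

text \<open>Applied to a truncated difference \<open>d\<close>: an inequality between functions that
  holds up to errors with vanishing integrals holds almost everywhere.\<close>

lemma nn_integral_eq_0_of_le_null_sequence:
  assumes [measurable]: "d \<in> borel_measurable M"
    and le: "\<And>n::nat. AE x in M. d x \<le> r n x" and lim: "(\<lambda>n. \<integral>\<^sup>+x. r n x \<partial>M) \<longlonglongrightarrow> 0"
  shows "AE x in M. d x = (0::ennreal)"
proof -
  have "(\<integral>\<^sup>+x. d x \<partial>M) \<le> (\<integral>\<^sup>+x. r n x \<partial>M)" for n
    by (rule nn_integral_mono_AE[OF le])
  then have "(\<integral>\<^sup>+x. d x \<partial>M) \<le> 0"
    by (intro LIMSEQ_le_const[OF lim]) auto
  then show ?thesis by (simp add: nn_integral_0_iff_AE)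
qed

lemma ennreal_le_of_diff_eq_0:
  fixes a b :: ennreal
  assumes "a - b = 0" "a < top"
  shows "a \<le> b"
  using ennreal_minus_le_iff[of a b 0] assms by auto

text \<open>Multiplying \<open>z\<close> by the conjugate of \<open>sgn z\<close> gives its modulus,
  and elements of \<open>D\<close> approximate these phases. The point is that \<open>D\<close> may
  be countable, so that an inequality known almost everywhere for each choice of phases holds for
  all choices at once.\<close>

lemma sum_list_norm_dual:
  fixes D :: "complex set"
  assumes D: "\<And>z e. norm z \<le> 1 \<Longrightarrow> 0 < e \<Longrightarrow> \<exists>d\<in>D. norm (d - z) < e" and "0 < e"
  shows "\<exists>cs\<in>lists D. length cs = length zs \<and> (\<Sum>z\<leftarrow>zs. norm z) \<le> Re (\<Sum>p\<leftarrow>zip cs zs. fst p * snd p) + e"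
  using \<open>0 < e\<close>
proof (induction zs arbitrary: e)
  case Nil then show ?case by auto
next
  case (Cons z zs)
  obtain cs where cs: "cs \<in> lists D" "length cs = length zs"
    "(\<Sum>z\<leftarrow>zs. norm z) \<le> Re (\<Sum>p\<leftarrow>zip cs zs. fst p * snd p) + e / 2"
    using Cons.IH[of "e / 2"] Cons.prems by auto
  have "norm (cnj (sgn z)) \<le> 1" by (simp add: norm_sgn)
  \<comment> \<open>With this accuracy the error \<open>(d - cnj (sgn z)) * z\<close> costs at most
    \<open>e / 2\<close>; the added 1 avoids dividing by 0.\<close>
  moreover have "0 < e / 2 / (norm z + 1)" using Cons.prems by (auto intro!: divide_pos_pos add_nonneg_pos)
  ultimately obtain d where d: "d \<in> D" "norm (d - cnj (sgn z)) < e / 2 / (norm z + 1)"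
    using D by blast
  have "norm ((d - cnj (sgn z)) * z) \<le> e / 2 / (norm z + 1) * (norm z + 1)"
    unfolding norm_mult using d Cons.prems by (intro mult_mono) auto
  also have "\<dots> = e / 2" 
  proof -
    have "norm z + 1 \<noteq> 0" using norm_ge_zero[of z] by linarith
    from iffD1[OF nonzero_eq_divide_eq[OF this] refl] show ?thesis .
  qed
  finally have "\<bar>Re ((d - cnj (sgn z)) * z)\<bar> \<le> e / 2" using abs_Re_le_cmod order_trans by blast
  moreover have "Re (cnj (sgn z) * z) = norm z"
  proof (cases "z = 0")
    case False
    have "cnj (sgn z) * z = (cnj z * z) / complex_of_real (norm z)" by (simp add: sgn_div_norm scaleR_conv_of_real field_simps)
    also have "\<dots> = complex_of_real ((norm z)\<^sup>2) / complex_of_real (norm z)" 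
      by (simp only: complex_norm_square mult.commute[of "cnj z"])
    also have "\<dots> = complex_of_real (norm z)" using False by (simp add: power2_eq_square)
    finally show ?thesis by simp
  qed auto
  moreover have "Re ((d - cnj (sgn z)) * z) = Re (d * z) - Re (cnj (sgn z) * z)"
    by (simp only: left_diff_distrib minus_complex.sel)
  ultimately have "norm z \<le> Re (d * z) + e / 2" by linarith
  moreover have "Re (\<Sum>p\<leftarrow>zip (d # cs) (z # zs). fst p * snd p)
      = Re (d * z) + Re (\<Sum>p\<leftarrow>zip cs zs. fst p * snd p)"
    by (simp only: zip_Cons_Cons list.map sum_list.Cons plus_complex.sel fst_conv snd_conv)
  ultimately have "(\<Sum>z\<leftarrow>z # zs. norm z) \<le> Re (\<Sum>p\<leftarrow>zip (d # cs) (z # zs). fst p * snd p) + e"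
    using cs(3) by (simp only: list.map sum_list.Cons)
  with cs(1,2) d(1) show ?case by (intro bexI[of _ "d # cs"] conjI) simp_all
qed

text \<open>Linear contractions of \<open>L\<^sup>1\<close> and of \<open>L\<^sup>\<infinity>\<close>, recorded through their action on the core
  \<open>L\<^sup>1 \<inter> L\<^sup>\<infinity>\<close>.\<close>

locale L1_Linf_contraction = sigma_finite_measure M for M :: "'a measure" +
  fixes A :: "('a \<Rightarrow> complex) \<Rightarrow> ('a \<Rightarrow> complex)"
  assumes closed: "f \<in> L1_Linf M \<Longrightarrow> A f \<in> L1_Linf M"
    and cong: "\<lbrakk>f \<in> L1_Linf M; g \<in> L1_Linf M; AE x in M. f x = g x\<rbrakk> \<Longrightarrow> AE x in M. A f x = A g x"
    and add: "\<lbrakk>f \<in> L1_Linf M; g \<in> L1_Linf M\<rbrakk> \<Longrightarrow> AE x in M. A (\<lambda>y. f y + g y) x = A f x + A g x"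
    and scale: "f \<in> L1_Linf M \<Longrightarrow> AE x in M. A (\<lambda>y. c * f y) x = c * A f x"
    and L1: "f \<in> L1_Linf M \<Longrightarrow> (\<integral>\<^sup>+x. norm (A f x) \<partial>M) \<le> (\<integral>\<^sup>+x. norm (f x) \<partial>M)"
    and Linf: "\<lbrakk>f \<in> L1_Linf M; AE x in M. norm (f x) \<le> b\<rbrakk> \<Longrightarrow> AE x in M. norm (A f x) \<le> b"
begin

section \<open>The variation of a decomposition and the modulus\<close>

definition variation :: "('a \<Rightarrow> real) list \<Rightarrow> 'a \<Rightarrow> ennreal" where
  "variation us x = (\<Sum>u\<leftarrow>us. ennreal (norm (A (\<lambda>y. complex_of_real (u y)) x)))"

text \<open>Only \<open>\<le> f\<close> is demanded of the sum: \<open>f\<close> may be infinite or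
  far from integrable, in which case no finite sum of core functions equals it. Monotonicity in
  \<open>f\<close> is then immediate.\<close>

definition variations :: "('a \<Rightarrow> ennreal) \<Rightarrow> ('a \<Rightarrow> ennreal) set" where
  "variations f = {variation us | us. set us \<subseteq> pos_L1_Linf M \<and> (AE x in M. ennreal (\<Sum>u\<leftarrow>us. u x) \<le> f x)}"

definition modulus :: "('a \<Rightarrow> ennreal) \<Rightarrow> 'a \<Rightarrow> ennreal" where
  "modulus f = ess_Sup M (variations f)"

lemma variation_append: "variation (us @ vs) x = variation us x + variation vs x"
  by (simp add: variation_def)

lemma variation_Cons: "variation (u # us) x = ennreal (norm (A (\<lambda>y. complex_of_real (u y)) x)) + variation us x"
  by (simp add: variation_def)

lemma variation_finite: "variation us x < top"
  by (induction us) (auto simp: variation_def)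

lemma A_measurable: "f \<in> L1_Linf M \<Longrightarrow> A f \<in> borel_measurable M"
  by (intro L1_LinfD(1)[of _ M] closed)

lemma A_real_measurable: "u \<in> pos_L1_Linf M \<Longrightarrow> A (\<lambda>y. complex_of_real (u y)) \<in> borel_measurable M"
  by (intro A_measurable of_real_L1_Linf)

lemma variation_measurable:
  assumes "set us \<subseteq> pos_L1_Linf M"
  shows "variation us \<in> borel_measurable M"
  using assms
proof (induction us)
  case (Cons u us)
  then have [measurable]: "variation us \<in> borel_measurable M"
    "A (\<lambda>y. complex_of_real (u y)) \<in> borel_measurable M" using A_real_measurable by auto
  show ?case unfolding variation_Cons[abs_def] by measurable
qed (simp add: variation_def[abs_def])

lemma variations_measurable: "variations f \<subseteq> borel_measurable M" "variations f \<noteq> {}"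
proof -
  show "variations f \<subseteq> borel_measurable M" unfolding variations_def using variation_measurable by auto
  have "variation [] \<in> variations f" unfolding variations_def by (auto intro!: exI[of _ "[]"])
  then show "variations f \<noteq> {}" by auto
qed

lemma variation_le_modulus:
  assumes "set us \<subseteq> pos_L1_Linf M" "AE x in M. ennreal (\<Sum>u\<leftarrow>us. u x) \<le> f x"
  shows "AE x in M. variation us x \<le> modulus f x"
  unfolding modulus_def using assms
  by (intro ess_Sup_upper variations_measurable) (auto simp: variations_def)

lemma modulus_least:
  assumes "\<And>us. set us \<subseteq> pos_L1_Linf M \<Longrightarrow> AE x in M. ennreal (\<Sum>u\<leftarrow>us. u x) \<le> f x
     \<Longrightarrow> AE x in M. variation us x \<le> g x"
  shows "AE x in M. modulus f x \<le> g x"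
  unfolding modulus_def
proof (rule ess_Sup_least[OF variations_measurable])
  fix h assume "h \<in> variations f"
  then show "AE x in M. h x \<le> g x" using assms unfolding variations_def by blast
qed

lemma modulus_measurable [measurable]: "modulus f \<in> borel_measurable M"
  unfolding modulus_def by (intro ess_Sup_measurable variations_measurable)

lemma norm_sum_list_le_variation:
  assumes "set us \<subseteq> pos_L1_Linf M"
  shows "AE x in M. ennreal (norm (A (\<lambda>y. complex_of_real (\<Sum>u\<leftarrow>us. u y)) x)) \<le> variation us x"
  using assms
proof (induction us)
  case Nil
  have "AE x in M. A (\<lambda>y. 0 * complex_of_real 0) x = 0 * A (\<lambda>_. complex_of_real 0) x"
    using scale[OF of_real_L1_Linf[OF pos_L1_Linf_zero], of 0] by simp
  then show ?case by eventually_elim (simp add: variation_def)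
next
  case (Cons u us)
  then have "AE x in M. A (\<lambda>y. complex_of_real (u y) + complex_of_real (\<Sum>u\<leftarrow>us. u y)) x
     = A (\<lambda>y. complex_of_real (u y)) x + A (\<lambda>y. complex_of_real (\<Sum>u\<leftarrow>us. u y)) x"
    by (intro add of_real_L1_Linf pos_L1_Linf_sum_list) auto
  moreover have "AE x in M. ennreal (norm (A (\<lambda>y. complex_of_real (\<Sum>u\<leftarrow>us. u y)) x)) \<le> variation us x"
    using Cons by auto
  ultimately show ?case
  proof eventually_elim
    case (elim x)
    let ?a = "A (\<lambda>y. complex_of_real (u y)) x" and ?b = "A (\<lambda>y. complex_of_real (\<Sum>u\<leftarrow>us. u y)) x"
    have "ennreal (norm (?a + ?b)) \<le> ennreal (norm ?a + norm ?b)" by (intro ennreal_leI norm_triangle_ineq)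
    also have "\<dots> \<le> ennreal (norm ?a) + variation us x" using elim(2) by (simp add: add_left_mono)
    finally show ?case using elim(1) by (simp add: variation_Cons)
  qed
qed

text \<open>Two decompositions of the same function \<open>m\<close> have the product refinement
  with entries \<open>u * v / m\<close>. Each row sums to \<open>u\<close>, so the triangle
  inequality shows that refining does not decrease the variation.\<close>

lemma variation_refine:
  assumes us: "set us \<subseteq> pos_L1_Linf M" and vs: "set vs \<subseteq> pos_L1_Linf M"
    and eq: "\<And>x. (\<Sum>u\<leftarrow>us. u x) = m x" "\<And>x. (\<Sum>v\<leftarrow>vs. v x) = m x"
  shows "AE x in M. variation us x \<le> variation (concat (map (\<lambda>u. map (\<lambda>v x. u x * (v x / m x)) vs) us)) x"
    and "set (concat (map (\<lambda>u. map (\<lambda>v x. u x * (v x / m x)) vs) us)) \<subseteq> pos_L1_Linf M"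
    and "(\<Sum>w\<leftarrow>concat (map (\<lambda>u. map (\<lambda>v x. u x * (v x / m x)) vs) us). w x) = m x"
proof -
  have m0: "0 \<le> m x" for x
    unfolding eq(1)[symmetric] using us by (intro sum_list_nonneg) (auto simp: pos_L1_Linf_def)
  have [measurable]: "m \<in> borel_measurable M"
    using pos_L1_Linf_sum_list[OF vs] unfolding eq(2) by (rule pos_L1_LinfD)
  have vle: "0 \<le> v x" "v x \<le> m x" if "v \<in> set vs" for v x
    using vs that by (auto simp: eq(2)[symmetric] pos_L1_Linf_def subset_iff intro!: member_le_sum_list)
  have ule: "0 \<le> u x" "u x \<le> m x" if "u \<in> set us" for u x
    using us that by (auto simp: eq(1)[symmetric] pos_L1_Linf_def subset_iff intro!: member_le_sum_list)
  have mem: "(\<lambda>x. u x * (v x / m x)) \<in> pos_L1_Linf M" if "u \<in> set us" "v \<in> set vs" for u v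
  proof (rule pos_L1_Linf_weight)
    have [measurable]: "v \<in> borel_measurable M" using vs that pos_L1_LinfD(1) by auto
    show "(\<lambda>x. v x / m x) \<in> borel_measurable M" by measurable
    show "0 \<le> v x / m x" "v x / m x \<le> 1" for x
      using vle[OF that(2), of x] by (auto simp: divide_le_eq_1)
  qed (use us that in auto)
  have row: "(\<Sum>v\<leftarrow>vs. u x * (v x / m x)) = u x" if "u \<in> set us" for u x
  proof -
    have "(\<Sum>v\<leftarrow>vs. u x * (v x / m x)) = (\<Sum>v\<leftarrow>vs. (u x / m x) * v x)" by (simp add: mult_ac)
    also have "\<dots> = (u x / m x) * m x" by (simp only: sum_list_const_mult eq(2))
    \<comment> \<open>Where \<open>m x = 0\<close>, the bounds \<open>0 \<le> u x \<le> m x\<close>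
      force \<open>u x = 0\<close>, which agrees with the value 0 of division by 0.\<close>
    also have "\<dots> = u x" using ule[OF that, of x] by auto
    finally show ?thesis .
  qed
  show "set (concat (map (\<lambda>u. map (\<lambda>v x. u x * (v x / m x)) vs) us)) \<subseteq> pos_L1_Linf M"
    using mem by auto
  show "(\<Sum>w\<leftarrow>concat (map (\<lambda>u. map (\<lambda>v x. u x * (v x / m x)) vs) us). w x) = m x"

  proof -
    have "(\<Sum>w\<leftarrow>concat (map (\<lambda>u. map (\<lambda>v x. u x * (v x / m x)) vs) us). w x)
        = (\<Sum>u\<leftarrow>us. \<Sum>v\<leftarrow>vs. u x * (v x / m x))"
      by (simp only: sum_list_map_concat map_map o_def)
    also have "\<dots> = (\<Sum>u\<leftarrow>us. u x)" by (intro arg_cong[where f = sum_list] map_cong refl row)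
    finally show ?thesis by (simp add: eq)
  qed
  have "AE x in M. \<forall>u\<in>set us. ennreal (norm (A (\<lambda>y. complex_of_real (u y)) x))
      \<le> variation (map (\<lambda>v x. u x * (v x / m x)) vs) x"
  proof (subst AE_ball_countable, simp add: countable_finite, intro ballI)
    fix u assume u: "u \<in> set us"
    have "AE x in M. ennreal (norm (A (\<lambda>y. complex_of_real (\<Sum>w\<leftarrow>map (\<lambda>v x. u x * (v x / m x)) vs. w y)) x))
        \<le> variation (map (\<lambda>v x. u x * (v x / m x)) vs) x"
      by (rule norm_sum_list_le_variation) (use mem[OF u] in auto)
    then show "AE x in M. ennreal (norm (A (\<lambda>y. complex_of_real (u y)) x))
      \<le> variation (map (\<lambda>v x. u x * (v x / m x)) vs) x"
      by (simp only: map_map o_def row[OF u])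
  qed
  then show "AE x in M. variation us x \<le> variation (concat (map (\<lambda>u. map (\<lambda>v x. u x * (v x / m x)) vs) us)) x"
  proof eventually_elim
    case (elim x)
    have "variation us x \<le> (\<Sum>u\<leftarrow>us. variation (map (\<lambda>v x. u x * (v x / m x)) vs) x)"
      unfolding variation_def[of us] by (rule sum_list_mono) (use elim in auto)
    also have "\<dots> = variation (concat (map (\<lambda>u. map (\<lambda>v x. u x * (v x / m x)) vs) us)) x"
      by (simp add: variation_def sum_list_map_concat o_def)
    finally show ?case .
  qed
qed

text \<open>Two decompositions below \<open>f\<close> are first padded to have the same sum, the
  maximum \<open>m\<close> of their sums, which is still below \<open>f\<close>; then their product
  refinement dominates both.\<close>

lemma variations_directed:
  assumes "a \<in> variations f" "b \<in> variations f"
  shows "\<exists>c\<in>variations f. (AE x in M. a x \<le> c x) \<and> (AE x in M. b x \<le> c x)"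
proof -
  obtain us where us: "a = variation us" "set us \<subseteq> pos_L1_Linf M" "AE x in M. ennreal (\<Sum>u\<leftarrow>us. u x) \<le> f x"
    using assms(1) by (auto simp: variations_def)
  obtain vs where vs: "b = variation vs" "set vs \<subseteq> pos_L1_Linf M" "AE x in M. ennreal (\<Sum>v\<leftarrow>vs. v x) \<le> f x"
    using assms(2) by (auto simp: variations_def)
  define m where "m x = max (\<Sum>u\<leftarrow>us. u x) (\<Sum>v\<leftarrow>vs. v x)" for x
  note sums = pos_L1_Linf_sum_list[OF us(2)] pos_L1_Linf_sum_list[OF vs(2)]
  note [measurable] = sums[THEN pos_L1_LinfD(1)]
  have mV: "m \<in> pos_L1_Linf M"
  proof (rule pos_L1_Linf_dominated[OF pos_L1_Linf_add[OF sums]])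
    show "m \<in> borel_measurable M" unfolding m_def by measurable
  qed (use sums in \<open>auto simp: m_def max_def pos_L1_Linf_def\<close>)
  note [measurable] = pos_L1_LinfD(1)[OF mV]
  have d1: "(\<lambda>x. m x - (\<Sum>u\<leftarrow>us. u x)) \<in> pos_L1_Linf M"
    by (rule pos_L1_Linf_dominated[OF mV]) (use sums in \<open>auto simp: m_def pos_L1_Linf_def\<close>)
  have d2: "(\<lambda>x. m x - (\<Sum>u\<leftarrow>vs. u x)) \<in> pos_L1_Linf M"
    by (rule pos_L1_Linf_dominated[OF mV]) (use sums in \<open>auto simp: m_def pos_L1_Linf_def\<close>)
  define us' where "us' = (\<lambda>x. m x - (\<Sum>u\<leftarrow>us. u x)) # us"
  define vs' where "vs' = (\<lambda>x. m x - (\<Sum>u\<leftarrow>vs. u x)) # vs"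
  have us': "set us' \<subseteq> pos_L1_Linf M" "\<And>x. (\<Sum>u\<leftarrow>us'. u x) = m x" using us d1 by (auto simp: us'_def)
  have vs': "set vs' \<subseteq> pos_L1_Linf M" "\<And>x. (\<Sum>u\<leftarrow>vs'. u x) = m x" using vs d2 by (auto simp: vs'_def)
  define c where "c = concat (map (\<lambda>u. map (\<lambda>v x. u x * (v x / m x)) vs') us')"
  \<comment> \<open>The transpose of \<open>c\<close>: refining \<open>vs'\<close> by
    \<open>us'\<close> produces the same functions in another order, hence the same
    variation.\<close>
  define d where "d = concat (map (\<lambda>u. map (\<lambda>v x. u x * (v x / m x)) us') vs')"
  have "variation d x = variation c x" for x
  proof -
    have "variation d x = (\<Sum>v\<leftarrow>vs'. \<Sum>u\<leftarrow>us'. ennreal (norm (A (\<lambda>y. complex_of_real (v y * (u y / m y))) x)))"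
      by (simp add: d_def variation_def sum_list_map_concat o_def)
    also have "\<dots> = (\<Sum>u\<leftarrow>us'. \<Sum>v\<leftarrow>vs'. ennreal (norm (A (\<lambda>y. complex_of_real (v y * (u y / m y))) x)))"
      by (rule sum_list_swap)
    also have "\<dots> = variation c x"
      by (simp add: c_def variation_def sum_list_map_concat o_def mult.commute)
    finally show ?thesis .
  qed
  moreover have "AE x in M. variation us x \<le> variation c x"
    using variation_refine(1)[OF us'(1) vs'(1) us'(2) vs'(2), folded c_def]
    by eventually_elim (auto simp: us'_def variation_Cons elim: order_trans[rotated] intro: add_increasing)
  moreover have "AE x in M. variation vs x \<le> variation d x"
    using variation_refine(1)[OF vs'(1) us'(1) vs'(2) us'(2), folded d_def]
    by eventually_elim (auto simp: vs'_def variation_Cons elim: order_trans[rotated] intro: add_increasing)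
  moreover have "variation c \<in> variations f"
  proof -
    have "AE x in M. ennreal (m x) \<le> f x" using us(3) vs(3) by eventually_elim (auto simp: m_def max_def)
    then show ?thesis unfolding variations_def
      using variation_refine(2,3)[OF us'(1) vs'(1) us'(2) vs'(2), folded c_def] by auto
  qed
  ultimately show ?thesis using us(1) vs(1) by auto
qed

lemma modulus_sequence:
  obtains U :: "nat \<Rightarrow> ('a \<Rightarrow> real) list" where "\<And>n. set (U n) \<subseteq> pos_L1_Linf M"
    "\<And>n. AE x in M. ennreal (\<Sum>u\<leftarrow>U n. u x) \<le> f x"
    "AE x in M. incseq (\<lambda>n. variation (U n) x)" "AE x in M. modulus f x = (SUP n. variation (U n) x)"
proof -
  obtain b :: "nat \<Rightarrow> 'a \<Rightarrow> ennreal" where b: "range b \<subseteq> variations f" "AE x in M. incseq (\<lambda>n. b n x)"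
    "AE x in M. modulus f x = (SUP n. b n x)"
    unfolding modulus_def
  proof (rule ess_Sup_directed[OF variations_measurable[of f]])
    show "\<exists>c\<in>variations f. (AE x in M. a x \<le> c x) \<and> (AE x in M. b x \<le> c x)"
      if "a \<in> variations f" "b \<in> variations f" for a b
      using that by (rule variations_directed)
  qed blast
  have "\<forall>n. \<exists>us. b n = variation us \<and> set us \<subseteq> pos_L1_Linf M \<and> (AE x in M. ennreal (\<Sum>u\<leftarrow>us. u x) \<le> f x)"
    using b(1) by (auto simp: variations_def image_subset_iff)
  from choice[OF this] obtain U where U: "\<forall>n. b n = variation (U n) \<and> set (U n) \<subseteq> pos_L1_Linf M
      \<and> (AE x in M. ennreal (\<Sum>u\<leftarrow>U n. u x) \<le> f x)" ..
  then have "b = (\<lambda>n. variation (U n))" by auto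
  with U b show ?thesis by (intro that[of U]) simp_all
qed

lemma nn_integral_variation:
  assumes "set us \<subseteq> pos_L1_Linf M"
  shows "(\<integral>\<^sup>+x. variation us x \<partial>M) \<le> (\<integral>\<^sup>+x. ennreal (\<Sum>u\<leftarrow>us. u x) \<partial>M)"
  using assms
proof (induction us)
  case (Cons u us)
  then have u: "u \<in> pos_L1_Linf M" and us: "set us \<subseteq> pos_L1_Linf M" by auto
  note [measurable] = variation_measurable[OF us] A_real_measurable[OF u] pos_L1_LinfD(1)[OF u]
    pos_L1_LinfD(1)[OF pos_L1_Linf_sum_list[OF us]]
  have s0: "0 \<le> (\<Sum>u\<leftarrow>us. u x)" for x using pos_L1_LinfD(3)[OF pos_L1_Linf_sum_list[OF us]] .
  have "(\<integral>\<^sup>+x. variation (u # us) x \<partial>M)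
      = (\<integral>\<^sup>+x. ennreal (norm (A (\<lambda>y. complex_of_real (u y)) x)) \<partial>M) + (\<integral>\<^sup>+x. variation us x \<partial>M)"
    unfolding variation_Cons by (rule nn_integral_add) measurable
  also have "\<dots> \<le> (\<integral>\<^sup>+x. norm (complex_of_real (u x)) \<partial>M) + (\<integral>\<^sup>+x. ennreal (\<Sum>u\<leftarrow>us. u x) \<partial>M)"
    by (intro add_mono L1 of_real_L1_Linf u Cons.IH us)
  also have "\<dots> = (\<integral>\<^sup>+x. ennreal (u x) \<partial>M) + (\<integral>\<^sup>+x. ennreal (\<Sum>u\<leftarrow>us. u x) \<partial>M)"
    using pos_L1_LinfD(3)[OF u] by simp
  also have "\<dots> = (\<integral>\<^sup>+x. ennreal (u x) + ennreal (\<Sum>u\<leftarrow>us. u x) \<partial>M)"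
    by (rule nn_integral_add[symmetric]) measurable
  also have "\<dots> = (\<integral>\<^sup>+x. ennreal (\<Sum>u\<leftarrow>u # us. u x) \<partial>M)"
    using pos_L1_LinfD(3)[OF u] s0 by simp
  finally show ?case .
qed (simp add: variation_def[abs_def])

text \<open>Each entry is split as \<open>u = u w + u (1 - w)\<close>; this is the tool for cutting
  a whole decomposition along a prescribed part of its sum.\<close>

lemma variation_weight:
  assumes us: "set us \<subseteq> pos_L1_Linf M" and w: "w \<in> borel_measurable M" "\<And>x. 0 \<le> w x" "\<And>x. w x \<le> 1"
  defines "us1 \<equiv> map (\<lambda>u x. u x * w x) us" and "us2 \<equiv> map (\<lambda>u x. u x * (1 - w x)) us"
  shows "set us1 \<subseteq> pos_L1_Linf M" "set us2 \<subseteq> pos_L1_Linf M"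
    "(\<Sum>u\<leftarrow>us1. u x) = (\<Sum>u\<leftarrow>us. u x) * w x" "(\<Sum>u\<leftarrow>us2. u x) = (\<Sum>u\<leftarrow>us. u x) * (1 - w x)"
    "AE x in M. variation us x \<le> variation us1 x + variation us2 x"
proof -
  note [measurable] = w(1)
  show 1: "set us1 \<subseteq> pos_L1_Linf M" "set us2 \<subseteq> pos_L1_Linf M"
    unfolding us1_def us2_def using us w by (auto intro!: pos_L1_Linf_weight)
  show "(\<Sum>u\<leftarrow>us1. u x) = (\<Sum>u\<leftarrow>us. u x) * w x" "(\<Sum>u\<leftarrow>us2. u x) = (\<Sum>u\<leftarrow>us. u x) * (1 - w x)"
    by (simp_all add: us1_def us2_def o_def sum_list_mult_const)
  show "AE x in M. variation us x \<le> variation us1 x + variation us2 x"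
    using 1 us unfolding us1_def us2_def
  proof (induction us)
    case (Cons u us)
    have eq: "(\<Sum>v\<leftarrow>[\<lambda>x. u x * w x, \<lambda>x. u x * (1 - w x)]. v y) = u y" for y
      by (simp add: algebra_simps)
    have "AE x in M. ennreal (norm (A (\<lambda>y. complex_of_real (\<Sum>v\<leftarrow>[\<lambda>x. u x * w x, \<lambda>x. u x * (1 - w x)]. v y)) x))
        \<le> variation [\<lambda>x. u x * w x, \<lambda>x. u x * (1 - w x)] x"
      using Cons.prems by (intro norm_sum_list_le_variation) auto
    then have "AE x in M. ennreal (norm (A (\<lambda>y. complex_of_real (u y)) x))
        \<le> variation [\<lambda>x. u x * w x, \<lambda>x. u x * (1 - w x)] x"
      unfolding eq .
    moreover have "AE x in M. variation us x \<le> variation (map (\<lambda>u x. u x * w x) us) x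
        + variation (map (\<lambda>u x. u x * (1 - w x)) us) x"
      using Cons by auto
    ultimately show ?case
      by eventually_elim (drule (1) add_mono, simp add: variation_def add_ac)
  qed (simp add: variation_def)
qed

end

text \<open>The approximants must not leave the disc, since the bound \<open>norm d \<le> 1\<close>
  is what keeps combinations with phases under control.\<close>

lemma countable_dense_unit_disc:
  "\<exists>D :: complex set. countable D \<and> (\<forall>d\<in>D. norm d \<le> 1) \<and>
    (\<forall>z e. norm z \<le> 1 \<longrightarrow> 0 < e \<longrightarrow> (\<exists>d\<in>D. norm (d - z) < e))"
proof -
  obtain D0 :: "complex set" where D0: "countable D0" "\<And>X. open X \<Longrightarrow> X \<noteq> {} \<Longrightarrow> \<exists>d\<in>D0. d \<in> X"
    using countable_dense_exists by blast
  define D where "D = D0 \<inter> ball 0 1"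
  have D: "\<exists>d\<in>D. norm (d - z) < e" if z: "norm z \<le> 1" and e: "0 < e" for z e
  proof -
    \<comment> \<open>Shrinking \<open>z\<close> by the factor \<open>1 - r\<close> moves it into
      the open disc at a cost below \<open>e\<close>, so the dense set meets the open disc near
      \<open>z\<close>.\<close>
    define r where "r = min e 1 / 2"
    have r: "0 < r" "r < 1" "r < e" using e by (auto simp: r_def min_def)
    have "norm (of_real (1 - r) * z) < 1"

    proof -
      have "norm (of_real (1 - r) * z) = (1 - r) * norm z"
        using r by (simp only: norm_mult norm_of_real abs_of_pos)
      also have "\<dots> \<le> 1 - r" using z r by (simp add: mult_left_le)
      finally show ?thesis using r by simp
    qed
    moreover have "dist z (of_real (1 - r) * z) < e"
    proof -
      have "z - of_real (1 - r) * z = of_real r * z" by (simp add: algebra_simps)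
      then have "dist z (of_real (1 - r) * z) = r * norm z" using r by (simp add: dist_norm norm_mult)
      also have "\<dots> \<le> r" using z r by (simp add: mult_left_le)
      finally show ?thesis using r by simp
    qed
    ultimately have "of_real (1 - r) * z \<in> ball 0 1 \<inter> ball z e" by (simp add: dist_norm)
    then obtain d where "d \<in> D0" "d \<in> ball 0 1 \<inter> ball z e" using D0(2)[of "ball 0 1 \<inter> ball z e"] by blast
    then show ?thesis by (intro bexI[of _ d]) (auto simp: D_def dist_norm norm_minus_commute)
  qed
  have "countable D" "\<forall>d\<in>D. norm d \<le> 1" using D0(1) by (auto simp: D_def)
  with D show ?thesis by blast
qed

section \<open>The modulus is a positive contraction\<close>

context L1_Linf_contraction
begin

lemma modulus_mono:
  assumes "AE x in M. f x \<le> g x"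
  shows "AE x in M. modulus f x \<le> modulus g x"
proof (rule modulus_least)
  fix us assume "set us \<subseteq> pos_L1_Linf M" "AE x in M. ennreal (\<Sum>u\<leftarrow>us. u x) \<le> f x"
  then show "AE x in M. variation us x \<le> modulus g x"
    by (intro variation_le_modulus) (use assms in \<open>auto elim: eventually_elim2 order_trans\<close>)
qed

text \<open>A Riesz decomposition: multiplying every entry by the weight
  \<open>w = min s g / s\<close>, with \<open>s\<close> the total sum, leaves a decomposition of
  \<open>min s g\<close>, and the complementary weight gives the remainder.\<close>

lemma variation_truncate:
  assumes us: "set us \<subseteq> pos_L1_Linf M" and g [measurable]: "g \<in> borel_measurable M"
  shows "\<exists>vs ws. set vs \<subseteq> pos_L1_Linf M \<and> set ws \<subseteq> pos_L1_Linf M \<and>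
    (\<forall>x. ennreal (\<Sum>u\<leftarrow>vs. u x) = min (ennreal (\<Sum>u\<leftarrow>us. u x)) (g x)) \<and>
    (\<forall>x. (\<Sum>u\<leftarrow>ws. u x) = (\<Sum>u\<leftarrow>us. u x) - (\<Sum>u\<leftarrow>vs. u x)) \<and>
    (AE x in M. variation us x \<le> variation vs x + variation ws x)"
proof -
  define s where "s x = (\<Sum>u\<leftarrow>us. u x)" for x
  define m where "m x = enn2real (min (ennreal (s x)) (g x))" for x
  define w where "w x = m x / s x" for x
  have s0: "0 \<le> s x" for x using pos_L1_LinfD(3)[OF pos_L1_Linf_sum_list[OF us]] by (simp add: s_def)
  have m: "ennreal (m x) = min (ennreal (s x)) (g x)" for x
    unfolding m_def by (rule ennreal_enn2real) (simp add: min_less_iff_disj)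
  have mle: "0 \<le> m x" "m x \<le> s x" for x
    using m[of x] s0[of x] by (simp add: m_def, metis ennreal_le_iff min.cobounded1)
  have sw: "s x * w x = m x" for x using mle[of x] by (auto simp: w_def)
  have [measurable]: "s \<in> borel_measurable M"
    using pos_L1_LinfD(1)[OF pos_L1_Linf_sum_list[OF us]] by (simp add: s_def[abs_def])
  have [measurable]: "m \<in> borel_measurable M" unfolding m_def[abs_def] by measurable
  have w: "w \<in> borel_measurable M" "\<And>x. 0 \<le> w x" "\<And>x. w x \<le> 1"
  proof -
    show "w \<in> borel_measurable M" unfolding w_def[abs_def] by measurable
    show "0 \<le> w x" "w x \<le> 1" for x
      using mle[of x] s0[of x] by (auto simp: w_def divide_le_eq_1)
  qed
  note W = variation_weight[OF us w]
  show ?thesis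
  proof (intro exI conjI allI)
    show "ennreal (\<Sum>u\<leftarrow>map (\<lambda>u x. u x * w x) us. u x) = min (ennreal (\<Sum>u\<leftarrow>us. u x)) (g x)" for x
      unfolding W(3) using m[of x] by (simp add: s_def[symmetric] sw)
    show "(\<Sum>u\<leftarrow>map (\<lambda>u x. u x * (1 - w x)) us. u x)
        = (\<Sum>u\<leftarrow>us. u x) - (\<Sum>u\<leftarrow>map (\<lambda>u x. u x * w x) us. u x)" for x
      unfolding W(3,4) by (simp add: algebra_simps)
  qed (rule W)+
qed

text \<open>A decomposition below \<open>f + g\<close> is cut at \<open>f\<close>; what remains is
  below \<open>g\<close>.\<close>

lemma modulus_add_le:
  assumes [measurable]: "f \<in> borel_measurable M" "g \<in> borel_measurable M"
  shows "AE x in M. modulus (\<lambda>x. f x + g x) x \<le> modulus f x + modulus g x"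
proof (rule modulus_least)
  fix us assume us: "set us \<subseteq> pos_L1_Linf M" "AE x in M. ennreal (\<Sum>u\<leftarrow>us. u x) \<le> f x + g x"
  obtain vs ws where vw: "set vs \<subseteq> pos_L1_Linf M" "set ws \<subseteq> pos_L1_Linf M"
    "\<And>x. ennreal (\<Sum>u\<leftarrow>vs. u x) = min (ennreal (\<Sum>u\<leftarrow>us. u x)) (f x)"
    "\<And>x. (\<Sum>u\<leftarrow>ws. u x) = (\<Sum>u\<leftarrow>us. u x) - (\<Sum>u\<leftarrow>vs. u x)"
    "AE x in M. variation us x \<le> variation vs x + variation ws x"
    using variation_truncate[OF us(1), of f] by auto
  have "AE x in M. variation vs x \<le> modulus f x"
    by (rule variation_le_modulus[OF vw(1)]) (simp add: vw(3))
  moreover have "AE x in M. variation ws x \<le> modulus g x"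
  proof (rule variation_le_modulus[OF vw(2)])
    show "AE x in M. ennreal (\<Sum>u\<leftarrow>ws. u x) \<le> g x"
      using us(2)
    proof eventually_elim
      case (elim x)
      let ?s = "\<Sum>u\<leftarrow>us. u x" and ?m = "\<Sum>u\<leftarrow>vs. u x"
      have "ennreal (?s - ?m) = ennreal ?s - ennreal ?m"
        using pos_L1_LinfD(3)[OF pos_L1_Linf_sum_list[OF vw(1)]] by (simp add: ennreal_minus)
      also have "\<dots> \<le> g x"
      proof (cases "ennreal ?s \<le> f x")
        case True
        then show ?thesis by (simp add: vw(3) min_absorb1 diff_eq_0_ennreal)
      next
        case False
        with elim show ?thesis by (auto simp: vw(3) min_absorb2 ennreal_minus_le_iff)
      qed
      finally show ?case by (simp add: vw(4))
    qed
  qed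
  ultimately show "AE x in M. variation us x \<le> modulus f x + modulus g x"
    using vw(5) by eventually_elim (drule (1) add_mono, erule (1) order_trans)
qed

text \<open>Concatenating a decomposition below \<open>f\<close> and one below \<open>g\<close> adds
  their variations; increasing sequences let the sum pass through both suprema.\<close>

lemma modulus_add_ge:
  assumes [measurable]: "f \<in> borel_measurable M" "g \<in> borel_measurable M"
  shows "AE x in M. modulus f x + modulus g x \<le> modulus (\<lambda>x. f x + g x) x"
proof -
  obtain U where U: "\<And>n. set (U n) \<subseteq> pos_L1_Linf M"
    "\<And>n. AE x in M. ennreal (\<Sum>u\<leftarrow>U n. u x) \<le> f x"
    "AE x in M. incseq (\<lambda>n. variation (U n) x)" "AE x in M. modulus f x = (SUP n. variation (U n) x)"
    using modulus_sequence[of f] by blast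
  obtain V where V: "\<And>n. set (V n) \<subseteq> pos_L1_Linf M"
    "\<And>n. AE x in M. ennreal (\<Sum>u\<leftarrow>V n. u x) \<le> g x"
    "AE x in M. incseq (\<lambda>n. variation (V n) x)" "AE x in M. modulus g x = (SUP n. variation (V n) x)"
    using modulus_sequence[of g] by blast
  have "AE x in M. variation (U n @ V n) x \<le> modulus (\<lambda>x. f x + g x) x" for n
  proof (rule variation_le_modulus)
    show "set (U n @ V n) \<subseteq> pos_L1_Linf M" using U(1) V(1) by auto
    have "0 \<le> (\<Sum>u\<leftarrow>U n. u x)" "0 \<le> (\<Sum>u\<leftarrow>V n. u x)" for x
      using pos_L1_LinfD(3)[OF pos_L1_Linf_sum_list[OF U(1)]] pos_L1_LinfD(3)[OF pos_L1_Linf_sum_list[OF V(1)]] by auto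
    then have eq: "ennreal (\<Sum>u\<leftarrow>U n @ V n. u x) = ennreal (\<Sum>u\<leftarrow>U n. u x) + ennreal (\<Sum>u\<leftarrow>V n. u x)" for x
      by simp
    from U(2)[of n] V(2)[of n] show "AE x in M. ennreal (\<Sum>u\<leftarrow>U n @ V n. u x) \<le> f x + g x"
      unfolding eq by eventually_elim (rule add_mono)
  qed
  then have "AE x in M. \<forall>n. variation (U n @ V n) x \<le> modulus (\<lambda>x. f x + g x) x"
    by (simp add: AE_all_countable)
  then show ?thesis using U(3,4) V(3,4)
    by eventually_elim (simp add: ennreal_SUP_add[symmetric] variation_append SUP_least)
qed

lemma variation_scale:
  assumes "set us \<subseteq> pos_L1_Linf M" "0 \<le> c"
  shows "AE x in M. variation (map (\<lambda>u x. c * u x) us) x = ennreal c * variation us x"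
  using assms(1)
proof (induction us)
  case (Cons u us)
  have "AE x in M. A (\<lambda>y. of_real c * complex_of_real (u y)) x = of_real c * A (\<lambda>y. complex_of_real (u y)) x"
    using Cons.prems by (intro scale of_real_L1_Linf) auto
  moreover have "AE x in M. variation (map (\<lambda>u x. c * u x) us) x = ennreal c * variation us x"
    using Cons by auto
  ultimately show ?case
    by eventually_elim (use assms(2) in \<open>simp add: variation_Cons norm_mult ennreal_mult distrib_left\<close>)
qed (simp add: variation_def)

lemma modulus_cmult_ge:
  assumes "0 < c"
  shows "AE x in M. ennreal c * modulus f x \<le> modulus (\<lambda>x. ennreal c * f x) x"
proof -
  obtain U where U: "\<And>n. set (U n) \<subseteq> pos_L1_Linf M"
    "\<And>n. AE x in M. ennreal (\<Sum>u\<leftarrow>U n. u x) \<le> f x"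
    "AE x in M. incseq (\<lambda>n. variation (U n) x)" "AE x in M. modulus f x = (SUP n. variation (U n) x)"
    using modulus_sequence[of f] by blast
  have "AE x in M. variation (map (\<lambda>u x. c * u x) (U n)) x \<le> modulus (\<lambda>x. ennreal c * f x) x" for n
  proof (rule variation_le_modulus)
    show "set (map (\<lambda>u x. c * u x) (U n)) \<subseteq> pos_L1_Linf M" 
      using U(1)[of n] assms by (auto intro!: pos_L1_Linf_scale)
    show "AE x in M. ennreal (\<Sum>u\<leftarrow>map (\<lambda>u x. c * u x) (U n). u x) \<le> ennreal c * f x"
      using U(2)[of n] by eventually_elim
        (use assms in \<open>simp add: o_def sum_list_const_mult ennreal_mult' mult_left_mono\<close>)
  qed
  then have 1: "AE x in M. \<forall>n. variation (map (\<lambda>u x. c * u x) (U n)) x \<le> modulus (\<lambda>x. ennreal c * f x) x"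
    by (simp add: AE_all_countable)
  have "AE x in M. \<forall>n. variation (map (\<lambda>u x. c * u x) (U n)) x = ennreal c * variation (U n) x"
    using variation_scale[OF U(1)] assms by (simp add: AE_all_countable)
  with 1 show ?thesis using U(4)
    by eventually_elim (simp add: SUP_mult_left_ennreal SUP_least)
qed

text \<open>The reverse inequality is the first one applied to the factor
  \<open>1 / c\<close>.\<close>

lemma modulus_cmult:
  assumes "0 < c"
  shows "AE x in M. modulus (\<lambda>x. ennreal c * f x) x = ennreal c * modulus f x"
proof -
  have eq: "ennreal c * (ennreal (1 / c) * y) = y" "ennreal (1 / c) * (ennreal c * y) = y" for y
    using assms by (simp_all add: mult.assoc[symmetric] ennreal_mult[symmetric])
  have "AE x in M. ennreal (1 / c) * modulus (\<lambda>x. ennreal c * f x) x \<le> modulus (\<lambda>x. ennreal (1 / c) * (ennreal c * f x)) x"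
    by (rule modulus_cmult_ge) (use assms in simp)
  then have "AE x in M. modulus (\<lambda>x. ennreal c * f x) x \<le> ennreal c * modulus f x"
    unfolding eq
  proof eventually_elim
    case (elim x)
    have "ennreal c * (ennreal (1 / c) * modulus (\<lambda>x. ennreal c * f x) x) \<le> ennreal c * modulus f x"
      by (rule mult_left_mono[OF elim]) simp
    then show ?case by (simp only: eq)
  qed
  with modulus_cmult_ge[OF assms, of f] show ?thesis by eventually_elim auto
qed

lemma nn_integral_modulus:
  assumes [measurable]: "f \<in> borel_measurable M"
  shows "(\<integral>\<^sup>+x. modulus f x \<partial>M) \<le> (\<integral>\<^sup>+x. f x \<partial>M)"
proof -
  obtain U where U: "\<And>n. set (U n) \<subseteq> pos_L1_Linf M"
    "\<And>n. AE x in M. ennreal (\<Sum>u\<leftarrow>U n. u x) \<le> f x"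
    "AE x in M. incseq (\<lambda>n. variation (U n) x)" "AE x in M. modulus f x = (SUP n. variation (U n) x)"
    using modulus_sequence[of f] by blast
  note [measurable] = variation_measurable[OF U(1)]
  have "(\<integral>\<^sup>+x. modulus f x \<partial>M) = (\<integral>\<^sup>+x. (SUP n. variation (U n) x) \<partial>M)"
    by (rule nn_integral_cong_AE) (use U(4) in auto)
  also have "\<dots> = (SUP n. \<integral>\<^sup>+x. variation (U n) x \<partial>M)"
    by (rule nn_integral_monotone_convergence_SUP_AE) (use U(3) in \<open>auto simp: incseq_Suc_iff\<close>)
  also have "\<dots> \<le> (\<integral>\<^sup>+x. f x \<partial>M)"
    by (intro SUP_least order_trans[OF nn_integral_variation[OF U(1)]] nn_integral_mono_AE U(2))
  finally show ?thesis .
qed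

text \<open>Cutting a decomposition below the supremum at \<open>F n\<close> leaves remainders whose
  integrals tend to 0 by dominated convergence. By contractivity in \<open>L^1\<close> their
  variations tend to 0 in integral as well, so nothing is lost in the limit.\<close>

lemma modulus_SUP:
  assumes F [measurable]: "\<And>n::nat. F n \<in> borel_measurable M" and inc: "incseq F"
  shows "AE x in M. modulus (\<lambda>x. SUP n. F n x) x \<le> (SUP n. modulus (F n) x)"
proof (rule modulus_least)
  fix us assume us: "set us \<subseteq> pos_L1_Linf M" "AE x in M. ennreal (\<Sum>u\<leftarrow>us. u x) \<le> (SUP n. F n x)"
  define s where "s x = (\<Sum>u\<leftarrow>us. u x)" for x
  have "\<forall>n. \<exists>vs ws. set vs \<subseteq> pos_L1_Linf M \<and> set ws \<subseteq> pos_L1_Linf M \<and>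
    (\<forall>x. ennreal (\<Sum>u\<leftarrow>vs. u x) = min (ennreal (s x)) (F n x)) \<and>
    (\<forall>x. (\<Sum>u\<leftarrow>ws. u x) = s x - (\<Sum>u\<leftarrow>vs. u x)) \<and>
    (AE x in M. variation us x \<le> variation vs x + variation ws x)"
    unfolding s_def by (intro allI variation_truncate us F)
  from choice[OF this] obtain V where "\<forall>n. \<exists>ws. set (V n) \<subseteq> pos_L1_Linf M \<and> set ws \<subseteq> pos_L1_Linf M \<and>
    (\<forall>x. ennreal (\<Sum>u\<leftarrow>V n. u x) = min (ennreal (s x)) (F n x)) \<and>
    (\<forall>x. (\<Sum>u\<leftarrow>ws. u x) = s x - (\<Sum>u\<leftarrow>V n. u x)) \<and>
    (AE x in M. variation us x \<le> variation (V n) x + variation ws x)" ..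
  from choice[OF this] obtain W where VW: "\<And>n. set (V n) \<subseteq> pos_L1_Linf M" "\<And>n. set (W n) \<subseteq> pos_L1_Linf M"
    "\<And>n x. ennreal (\<Sum>u\<leftarrow>V n. u x) = min (ennreal (s x)) (F n x)"
    "\<And>n x. (\<Sum>u\<leftarrow>W n. u x) = s x - (\<Sum>u\<leftarrow>V n. u x)"
    "\<And>n. AE x in M. variation us x \<le> variation (V n) x + variation (W n) x"
    by blast
  have sV: "s \<in> pos_L1_Linf M" using pos_L1_Linf_sum_list[OF us(1)] by (simp add: s_def[abs_def])
  then have s0: "0 \<le> s x" for x by (rule pos_L1_LinfD)
  have V0: "0 \<le> (\<Sum>u\<leftarrow>V n. u x)" for n x using pos_L1_LinfD(3)[OF pos_L1_Linf_sum_list[OF VW(1)]] .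
  note [measurable] = pos_L1_LinfD(1)[OF sV] variation_measurable[OF us(1)]
    pos_L1_LinfD(1)[OF pos_L1_Linf_sum_list[OF VW(2)]]
  have "AE x in M. variation us x - (SUP n. modulus (F n) x) = 0"
  proof (rule nn_integral_eq_0_of_le_null_sequence)
    fix n
    have "AE x in M. variation (V n) x \<le> modulus (F n) x"
      by (rule variation_le_modulus[OF VW(1)]) (simp add: VW(3))
    with VW(5)[of n] show "AE x in M. variation us x - (SUP n. modulus (F n) x) \<le> variation (W n) x"
    proof eventually_elim
      case (elim x)
      have "variation us x \<le> (SUP n. modulus (F n) x) + variation (W n) x"
        by (rule order_trans[OF elim(1)] add_right_mono)+ (auto intro: SUP_upper2 elim(2))
      then show ?case using variation_finite[of us x] by (auto simp: ennreal_minus_le_iff)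
    qed
  next
    have "(\<lambda>n. \<integral>\<^sup>+x. ennreal (\<Sum>u\<leftarrow>W n. u x) \<partial>M) \<longlonglongrightarrow> (\<integral>\<^sup>+x. 0 \<partial>M)"
    proof (rule nn_integral_dominated_convergence)
      show "AE x in M. ennreal (\<Sum>u\<leftarrow>W n. u x) \<le> ennreal (s x)" for n
        using V0 by (auto simp: VW(4) intro!: ennreal_leI)
      show "(\<integral>\<^sup>+x. ennreal (s x) \<partial>M) < \<infinity>"
        using pos_L1_LinfD(2)[OF sV] s0 by (simp add: nn_integral_eq_integral)
      show "AE x in M. (\<lambda>n. ennreal (\<Sum>u\<leftarrow>W n. u x)) \<longlonglongrightarrow> 0"
        using us(2)
      proof eventually_elim
        case (elim x)
        have "(\<lambda>n. F n x) \<longlonglongrightarrow> (SUP n. F n x)"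
          by (rule LIMSEQ_SUP) (use inc in \<open>auto simp: incseq_def le_fun_def\<close>)
        then have "(\<lambda>n. ennreal (\<Sum>u\<leftarrow>V n. u x)) \<longlonglongrightarrow> min (ennreal (s x)) (SUP n. F n x)"
          unfolding VW(3) by (intro tendsto_intros)
        then have "(\<lambda>n. ennreal (s x) - ennreal (\<Sum>u\<leftarrow>V n. u x)) \<longlonglongrightarrow> ennreal (s x) - ennreal (s x)"
          using elim by (intro tendsto_diff_ennreal tendsto_const) (simp_all only: s_def[symmetric] min_absorb1 ennreal_neq_top not_False_eq_True)
        then show ?case using V0 by (simp add: VW(4) ennreal_minus)
      qed
    qed measurable
    then have lim: "(\<lambda>n. \<integral>\<^sup>+x. ennreal (\<Sum>u\<leftarrow>W n. u x) \<partial>M) \<longlonglongrightarrow> 0" by simp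
    show "(\<lambda>n. \<integral>\<^sup>+x. variation (W n) x \<partial>M) \<longlonglongrightarrow> 0"
      by (rule tendsto_sandwich[OF _ _ tendsto_const lim]) (simp_all add: nn_integral_variation[OF VW(2)])
  qed measurable
  then show "AE x in M. variation us x \<le> (SUP n. modulus (F n) x)"
    by eventually_elim (auto intro: ennreal_le_of_diff_eq_0 variation_finite)
qed

lemma sum_list_norm_le:
  fixes h :: "'b \<Rightarrow> complex"
  shows "norm (\<Sum>x\<leftarrow>xs. h x) \<le> (\<Sum>x\<leftarrow>xs. norm (h x))"
  by (induction xs) (auto intro: norm_triangle_mono)

lemma lincomb:
  assumes "snd ` set ps \<subseteq> pos_L1_Linf M"
  shows "(\<lambda>y. \<Sum>p\<leftarrow>ps. fst p * complex_of_real (snd p y)) \<in> L1_Linf M"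
    "AE x in M. A (\<lambda>y. \<Sum>p\<leftarrow>ps. fst p * complex_of_real (snd p y)) x
       = (\<Sum>p\<leftarrow>ps. fst p * A (\<lambda>y. complex_of_real (snd p y)) x)"
proof -
  have "(\<lambda>y. \<Sum>p\<leftarrow>ps. fst p * complex_of_real (snd p y)) \<in> L1_Linf M \<and>
    (AE x in M. A (\<lambda>y. \<Sum>p\<leftarrow>ps. fst p * complex_of_real (snd p y)) x
       = (\<Sum>p\<leftarrow>ps. fst p * A (\<lambda>y. complex_of_real (snd p y)) x))"
    using assms
  proof (induction ps)
    case Nil
    have "AE x in M. A (\<lambda>_. 0) x = 0"
      using scale[OF of_real_L1_Linf[OF pos_L1_Linf_zero], of 0] by simp
    then show ?case using of_real_L1_Linf[OF pos_L1_Linf_zero] by simp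
  next
    case (Cons p ps)
    let ?f = "\<lambda>y. fst p * complex_of_real (snd p y)" and ?g = "\<lambda>y. \<Sum>p\<leftarrow>ps. fst p * complex_of_real (snd p y)"
    have p: "(\<lambda>y. complex_of_real (snd p y)) \<in> L1_Linf M" using Cons.prems by (intro of_real_L1_Linf) auto
    have IH: "?g \<in> L1_Linf M" "AE x in M. A ?g x = (\<Sum>p\<leftarrow>ps. fst p * A (\<lambda>y. complex_of_real (snd p y)) x)"
      using Cons by auto
    have "AE x in M. A (\<lambda>y. ?f y + ?g y) x = A ?f x + A ?g x" by (intro add IH L1_Linf_scale p)
    moreover have "AE x in M. A ?f x = fst p * A (\<lambda>y. complex_of_real (snd p y)) x" by (rule scale[OF p])
    ultimately have "AE x in M. A (\<lambda>y. ?f y + ?g y) x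
       = fst p * A (\<lambda>y. complex_of_real (snd p y)) x + (\<Sum>p\<leftarrow>ps. fst p * A (\<lambda>y. complex_of_real (snd p y)) x)"
      using IH(2) by eventually_elim simp
    then show ?case using L1_Linf_add[OF L1_Linf_scale[OF p] IH(1)] by simp
  qed
  then show "(\<lambda>y. \<Sum>p\<leftarrow>ps. fst p * complex_of_real (snd p y)) \<in> L1_Linf M"
    "AE x in M. A (\<lambda>y. \<Sum>p\<leftarrow>ps. fst p * complex_of_real (snd p y)) x
       = (\<Sum>p\<leftarrow>ps. fst p * A (\<lambda>y. complex_of_real (snd p y)) x)" by auto
qed

text \<open>Since \<open>\<Sum> |z\<^sub>i|\<close> is the supremum of \<open>|\<Sum> c\<^sub>i z\<^sub>i|\<close> over a countable set of phases \<open>c\<close>, the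
  \<open>L\<^sup>\<infinity>\<close> bound for the functions \<open>\<Sum> c\<^sub>i u\<^sub>i\<close> bounds the variation.\<close>

lemma variation_le_1:
  assumes us: "set us \<subseteq> pos_L1_Linf M" and le: "AE x in M. ennreal (\<Sum>u\<leftarrow>us. u x) \<le> 1"
  shows "AE x in M. variation us x \<le> 1"
proof -
  obtain D :: "complex set" where D0: "countable D" "\<And>d. d \<in> D \<Longrightarrow> norm d \<le> 1"
    and D: "\<And>z e. norm z \<le> 1 \<Longrightarrow> 0 < e \<Longrightarrow> \<exists>d\<in>D. norm (d - z) < e"
    using countable_dense_unit_disc by metis
  have "AE x in M. \<forall>cs\<in>lists D \<inter> {cs. length cs = length us}.
     norm (\<Sum>p\<leftarrow>zip cs us. fst p * A (\<lambda>y. complex_of_real (snd p y)) x) \<le> 1"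
  proof (subst AE_ball_countable, goal_cases)
    case 1 show ?case using D0(1) by (intro countable_Int1 countable_lists)
  next
    case 2
    show ?case
    proof
      fix cs assume "cs \<in> lists D \<inter> {cs. length cs = length us}"
      then have cs: "length cs = length us" "\<And>c. c \<in> set cs \<Longrightarrow> norm c \<le> 1" using D0(2) by auto
      let ?g = "\<lambda>y. \<Sum>p\<leftarrow>zip cs us. fst p * complex_of_real (snd p y)"
      have "snd ` set (zip cs us) \<subseteq> pos_L1_Linf M" using us by (auto dest: set_zip_rightD)
      note L = lincomb[OF this]
      have gle: "norm (?g y) \<le> (\<Sum>u\<leftarrow>us. u y)" for y
        using cs us
      proof (induction cs us rule: list_induct2)
        case (Cons c cs u us)
        then have "norm c \<le> 1" "0 \<le> u y" using pos_L1_LinfD(3)[of u M y] by auto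
        then have "norm (c * complex_of_real (u y)) \<le> u y" by (simp add: norm_mult mult_left_le_one_le)
        moreover have "norm (\<Sum>p\<leftarrow>zip cs us. fst p * complex_of_real (snd p y)) \<le> (\<Sum>u\<leftarrow>us. u y)"
          using Cons by auto
        ultimately show ?case by (simp add: norm_triangle_mono)
      qed simp
      have "AE x in M. norm (?g x) \<le> 1"
        using le by eventually_elim (rule order_trans[OF gle], simp)
      from Linf[OF L(1) this] L(2)
      show "AE x in M. norm (\<Sum>p\<leftarrow>zip cs us. fst p * A (\<lambda>y. complex_of_real (snd p y)) x) \<le> 1"
        by eventually_elim simp
    qed
  qed
  then show ?thesis
  proof eventually_elim
    case (elim x)
    let ?a = "\<lambda>u. A (\<lambda>y. complex_of_real (u y)) x"
    have "(\<Sum>u\<leftarrow>us. norm (?a u)) \<le> 1"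
    proof (rule field_le_epsilon)
      fix e :: real assume "0 < e"
      from sum_list_norm_dual[OF D this, of "map ?a us"] obtain cs where cs: "cs \<in> lists D" "length cs = length us"
        "(\<Sum>u\<leftarrow>us. norm (?a u)) \<le> Re (\<Sum>p\<leftarrow>zip cs (map ?a us). fst p * snd p) + e"
        by (auto simp: o_def)
      have "(\<Sum>p\<leftarrow>zip cs (map ?a us). fst p * snd p) = (\<Sum>p\<leftarrow>zip cs us. fst p * ?a (snd p))"
        by (simp add: zip_map2 o_def split_def)
      moreover have "norm (\<Sum>p\<leftarrow>zip cs us. fst p * ?a (snd p)) \<le> 1" using elim cs by blast
      ultimately have "Re (\<Sum>p\<leftarrow>zip cs (map ?a us). fst p * snd p) \<le> 1"
        using complex_Re_le_cmod order_trans by metis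
      with cs(3) show "(\<Sum>u\<leftarrow>us. norm (?a u)) \<le> 1 + e" by linarith
    qed
    then show ?case by (simp add: variation_def sum_list_ennreal)
  qed
qed

lemma positive_contraction_modulus: "positive_contraction M modulus"
proof unfold_locales
  fix f g :: "'a \<Rightarrow> ennreal" and c :: real assume [measurable]: "f \<in> borel_measurable M"
  show "modulus f \<in> borel_measurable M" by measurable
  show int: "(\<integral>\<^sup>+x. modulus f x \<partial>M) \<le> (\<integral>\<^sup>+x. f x \<partial>M)" by (rule nn_integral_modulus) measurable
  show "AE x in M. modulus (\<lambda>x. ennreal c * f x) x = ennreal c * modulus f x" if "0 \<le> c"
  proof (cases "c = 0")
    case True
    \<comment> \<open>The factor 0 has no inverse, so this case comes from the integral bound
      instead.\<close>
    have "(\<integral>\<^sup>+x. modulus (\<lambda>_. 0) x \<partial>M) = 0" using nn_integral_modulus[of "\<lambda>_. 0"] by simp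
    then have "AE x in M. modulus (\<lambda>_. 0) x = 0" by (simp add: nn_integral_0_iff_AE)
    then show ?thesis using True by simp
  qed (use that modulus_cmult in auto)
  assume [measurable]: "g \<in> borel_measurable M"
  show "AE x in M. modulus f x \<le> modulus g x" if "AE x in M. f x \<le> g x" by (rule modulus_mono[OF that])
  show "AE x in M. modulus (\<lambda>x. f x + g x) x = modulus f x + modulus g x"
    using modulus_add_le[of f g] modulus_add_ge[of f g] by (auto elim: eventually_elim2)
next
  show "AE x in M. modulus (\<lambda>x. SUP n. F n x) x \<le> (SUP n. modulus (F n) x)"
    if "\<And>n::nat. F n \<in> borel_measurable M" "incseq F" for F using that by (rule modulus_SUP)
  show "AE x in M. modulus (\<lambda>_. 1) x \<le> 1"
    by (rule modulus_least) (rule variation_le_1)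
qed

sublocale modulus: positive_contraction M modulus
  by (rule positive_contraction_modulus)

section \<open>The modulus dominates the operator\<close>

text \<open>Here \<open>|f| s\<close> stands for \<open>f = |f| sgn f\<close> with a simple function
  in place of the sign. Over the level sets of \<open>s\<close> it is a finite combination of
  functions \<open>c * |f| 1_B\<close>, and the functions \<open>|c| |f| 1_B\<close> form a
  decomposition below \<open>|f|\<close>.\<close>

lemma norm_le_modulus_simple:
  assumes f: "f \<in> L1_Linf M" and s: "simple_function M s" "\<And>x. norm (s x) \<le> 1"
  shows "(\<lambda>x. of_real (norm (f x)) * s x) \<in> L1_Linf M"
    "AE x in M. ennreal (norm (A (\<lambda>x. of_real (norm (f x)) * s x) x)) \<le> modulus (\<lambda>x. ennreal (norm (f x))) x"
proof -
  obtain cs where cs: "set cs = s ` space M" "distinct cs"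
    using finite_distinct_list simple_functionD(1)[OF s(1)] by metis
  define B where "B c = s -` {c} \<inter> space M" for c
  have [measurable]: "B c \<in> sets M" for c unfolding B_def by (rule simple_functionD(2)[OF s(1)])
  define u where "u c x = norm (f x) * indicat_real (B c) x" for c x
  have u: "u c \<in> pos_L1_Linf M" for c unfolding u_def
    by (rule pos_L1_Linf_weight[OF norm_pos_L1_Linf[OF f]]) (auto simp: indicator_def)
  define g where "g = (\<lambda>x. of_real (norm (f x)) * s x)"
  define g' where "g' = (\<lambda>y. \<Sum>p\<leftarrow>map (\<lambda>c. (c, u c)) cs. fst p * complex_of_real (snd p y))"
  have "snd ` set (map (\<lambda>c. (c, u c)) cs) \<subseteq> pos_L1_Linf M" using u by auto
  note L = lincomb[OF this, folded g'_def]
  have val: "(\<Sum>c\<leftarrow>cs. h c * indicat_real (B c) x) = h (s x)" if x: "x \<in> space M" for h :: "complex \<Rightarrow> real" and x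
  proof -
    have "(\<Sum>c\<leftarrow>cs. h c * indicat_real (B c) x) = (\<Sum>c\<in>s ` space M. h c * indicat_real (B c) x)"
      using cs by (simp add: sum.distinct_set_conv_list[symmetric])
    also have "\<dots> = (\<Sum>c\<in>s ` space M. if c = s x then h c else 0)"
      by (rule sum.cong) (use x in \<open>auto simp: B_def indicator_def\<close>)
    also have "\<dots> = h (s x)" using simple_functionD(1)[OF s(1)] x by simp
    finally show ?thesis .
  qed
  have valc: "(\<Sum>c\<leftarrow>cs. c * complex_of_real (u c x)) = complex_of_real (norm (f x)) * s x" if x: "x \<in> space M" for x
  proof -
    have "(\<Sum>c\<leftarrow>cs. c * complex_of_real (u c x)) = (\<Sum>c\<in>s ` space M. c * complex_of_real (u c x))"
      using cs by (simp add: sum.distinct_set_conv_list[symmetric])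
    also have "\<dots> = (\<Sum>c\<in>s ` space M. if c = s x then c * of_real (norm (f x)) else 0)"
      by (rule sum.cong) (use x in \<open>auto simp: B_def u_def indicator_def\<close>)
    also have "\<dots> = complex_of_real (norm (f x)) * s x" using simple_functionD(1)[OF s(1)] x by simp
    finally show ?thesis .
  qed
  have gg: "AE x in M. g' x = g x"
    using AE_space by eventually_elim (simp add: g_def g'_def o_def valc)
  have [measurable]: "s \<in> borel_measurable M" "f \<in> borel_measurable M"
    using s(1) L1_LinfD[OF f] by (auto intro: borel_measurable_simple_function)
  have gV: "g \<in> L1_Linf M"
  proof (rule L1_Linf_dominated[OF f])
    show "g \<in> borel_measurable M" unfolding g_def by measurable
    show "AE x in M. norm (g x) \<le> norm (f x)" using s(2) by (simp add: g_def norm_mult mult_left_le)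
  qed
  then show "(\<lambda>x. of_real (norm (f x)) * s x) \<in> L1_Linf M" by (simp add: g_def)
  define us where "us = map (\<lambda>c x. norm c * u c x) cs"
  have usV: "set us \<subseteq> pos_L1_Linf M" using u by (auto simp: us_def intro!: pos_L1_Linf_scale)
  have "AE x in M. ennreal (\<Sum>u\<leftarrow>us. u x) \<le> ennreal (norm (f x))"
    using AE_space
  proof eventually_elim
    case (elim x)
    have "(\<Sum>u\<leftarrow>us. u x) = (\<Sum>c\<leftarrow>cs. (norm c * norm (f x)) * indicat_real (B c) x)"
      by (simp add: us_def o_def u_def mult.assoc)
    also have "\<dots> = norm (s x) * norm (f x)" using elim by (rule val)
    also have "\<dots> \<le> norm (f x)" using s(2)[of x] by (simp add: mult_left_le_one_le)
    finally show ?case by (rule ennreal_leI)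
  qed
  from variation_le_modulus[OF usV this] have 1: "AE x in M. variation us x \<le> modulus (\<lambda>x. ennreal (norm (f x))) x" .
  have "AE x in M. \<forall>c\<in>set cs. A (\<lambda>y. of_real (norm c) * complex_of_real (u c y)) x
      = of_real (norm c) * A (\<lambda>y. complex_of_real (u c y)) x"
    by (subst AE_ball_countable) (auto intro!: countable_finite scale of_real_L1_Linf u)
  moreover have "AE x in M. A g x = A g' x" using gg by (intro cong gV L(1)) auto
  ultimately have "AE x in M. ennreal (norm (A g x)) \<le> modulus (\<lambda>x. ennreal (norm (f x))) x"
    using L(2) 1
  proof eventually_elim
    case (elim x)
    have "norm (A g x) \<le> (\<Sum>c\<leftarrow>cs. norm (c * A (\<lambda>y. complex_of_real (u c y)) x))"
      using sum_list_norm_le[of "\<lambda>c. c * A (\<lambda>y. complex_of_real (u c y)) x" cs] elim(2,3) by (simp add: o_def)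
    also have "\<dots> = (\<Sum>c\<leftarrow>cs. norm (A (\<lambda>y. complex_of_real (norm c * u c y)) x))"
      using elim(1) by (intro arg_cong[where f = sum_list] map_cong refl) (simp add: norm_mult)
    finally have "ennreal (norm (A g x)) \<le> variation us x"
      by (simp add: variation_def us_def o_def sum_list_ennreal ennreal_leI)
    then show ?case using elim(4) by simp
  qed
  then show "AE x in M. ennreal (norm (A (\<lambda>x. of_real (norm (f x)) * s x) x)) \<le> modulus (\<lambda>x. ennreal (norm (f x))) x"
    by (simp add: g_def)
qed

lemma A_diff:
  assumes "f \<in> L1_Linf M" "g \<in> L1_Linf M"
  shows "AE x in M. A (\<lambda>y. f y - g y) x = A f x - A g x"
proof -
  have "AE x in M. A (\<lambda>y. f y + (-1) * g y) x = A f x + A (\<lambda>y. (-1) * g y) x"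
    by (intro add L1_Linf_scale assms)
  moreover have "AE x in M. A (\<lambda>y. (-1) * g y) x = (-1) * A g x" by (rule scale[OF assms(2)])
  ultimately show ?thesis by (auto elim: eventually_elim2)
qed

text \<open>Simple approximations of \<open>sgn f\<close> give functions \<open>g i\<close> that
  converge to \<open>f\<close> in \<open>L^1\<close>; contractivity carries the convergence through
  \<open>A\<close>, so the bound for \<open>A (g i)\<close> passes to \<open>A f\<close>.\<close>

theorem norm_le_modulus:
  assumes f: "f \<in> L1_Linf M"
  shows "AE x in M. ennreal (norm (A f x)) \<le> modulus (\<lambda>x. ennreal (norm (f x))) x"
proof -
  have [measurable]: "f \<in> borel_measurable M" using f by (rule L1_LinfD)
  have [measurable]: "(\<lambda>x. sgn (f x)) \<in> borel_measurable M"
  proof -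
    have "(\<lambda>x. sgn (f x)) = (\<lambda>x. f x /\<^sub>R norm (f x))" by (simp add: sgn_div_norm)
    then show ?thesis by simp
  qed
  obtain s0 where s0: "\<And>i. simple_function M (s0 i)" "\<And>x. x \<in> space M \<Longrightarrow> (\<lambda>i. s0 i x) \<longlonglongrightarrow> sgn (f x)"
    using borel_measurable_implies_sequence_metric[of "\<lambda>x. sgn (f x)" M 0] by auto
  \<comment> \<open>Radial projection to the unit disc: it keeps the function simple and does not
    change the limit, whose modulus is at most 1.\<close>
  define s where "s i x = s0 i x /\<^sub>R max 1 (norm (s0 i x))" for i x
  have s: "simple_function M (s i)" for i
    unfolding s_def by (rule simple_function_compose1[OF s0(1), of "\<lambda>z. z /\<^sub>R max 1 (norm z)" i])
  have s1: "norm (s i x) \<le> 1" for i x by (simp add: s_def divide_simps max_def)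
  have slim: "(\<lambda>i. s i x) \<longlonglongrightarrow> sgn (f x)" if "x \<in> space M" for x
  proof -
    have "(\<lambda>i. s i x) \<longlonglongrightarrow> sgn (f x) /\<^sub>R max 1 (norm (sgn (f x)))"
      unfolding s_def by (intro tendsto_intros s0(2)[OF that]) auto
    then show ?thesis by (simp add: norm_sgn)
  qed
  define g where "g i x = of_real (norm (f x)) * s i x" for i x
  have g: "g i \<in> L1_Linf M" and gle: "AE x in M. ennreal (norm (A (g i) x)) \<le> modulus (\<lambda>x. ennreal (norm (f x))) x" for i
    using norm_le_modulus_simple[OF f s s1] by (auto simp: g_def[abs_def])
  note [measurable] = L1_LinfD(1)[OF g] L1_LinfD(1)[OF closed[OF f]]
  have "AE x in M. ennreal (norm (A f x)) - modulus (\<lambda>x. ennreal (norm (f x))) x = 0"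
  proof (rule nn_integral_eq_0_of_le_null_sequence)
    fix i
    show "AE x in M. ennreal (norm (A f x)) - modulus (\<lambda>x. ennreal (norm (f x))) x \<le> ennreal (norm (A (\<lambda>x. f x - g i x) x))"
      using A_diff[OF f g[of i]] gle[of i]
    proof eventually_elim
      case (elim x)
      have "norm (A f x) \<le> norm (A (g i) x) + norm (A f x - A (g i) x)"
        by (metis norm_triangle_sub)
      then have "ennreal (norm (A f x)) \<le> ennreal (norm (A (g i) x)) + ennreal (norm (A (\<lambda>x. f x - g i x) x))"
        unfolding elim(1) by (simp add: ennreal_plus[symmetric] ennreal_leI del: ennreal_plus)
      also have "\<dots> \<le> modulus (\<lambda>x. ennreal (norm (f x))) x + ennreal (norm (A (\<lambda>x. f x - g i x) x))"
        by (rule add_right_mono[OF elim(2)])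
      finally show ?case by (auto simp: ennreal_minus_le_iff)
    qed
  next
    have lim: "(\<lambda>i. \<integral>\<^sup>+x. ennreal (norm (f x - g i x)) \<partial>M) \<longlonglongrightarrow> 0"
    proof (rule nn_integral_dominated_convergence_norm)
      show "AE x in M. norm (g i x) \<le> norm (f x)" for i using s1 by (simp add: g_def norm_mult mult_left_le)
      show "(\<integral>\<^sup>+x. ennreal (norm (f x)) \<partial>M) < \<infinity>"
        using L1_LinfD(2)[OF f] by (simp add: nn_integral_eq_integral)
      show "AE x in M. (\<lambda>i. g i x) \<longlonglongrightarrow> f x"
        using AE_space
      proof eventually_elim
        case (elim x)
        have "(\<lambda>i. g i x) \<longlonglongrightarrow> of_real (norm (f x)) * sgn (f x)"
          unfolding g_def by (intro tendsto_intros slim elim)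
        moreover have "complex_of_real (norm (f x)) * sgn (f x) = f x"
          by (cases "f x = 0") (simp_all add: sgn_div_norm scaleR_conv_of_real)
        ultimately show ?case by simp
      qed
    qed measurable
    show "(\<lambda>i. \<integral>\<^sup>+x. ennreal (norm (A (\<lambda>x. f x - g i x) x)) \<partial>M) \<longlonglongrightarrow> 0"
      by (rule tendsto_sandwich[OF _ _ tendsto_const lim]) (auto intro!: L1 L1_Linf_diff f g always_eventually)
  qed measurable
  then show ?thesis by eventually_elim (auto intro: ennreal_le_of_diff_eq_0)
qed

end

text \<open>For each entry, \<open>|A (B u)|\<close> is at most the modulus of \<open>A\<close> at
  \<open>|B u|\<close>; summing uses additivity of that modulus, and the sum of the
  \<open>|B u|\<close> is a variation of \<open>B\<close>. The third operator \<open>C\<close> is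
  needed because \<open>T (s + t)\<close> equals the composition only up to null sets.\<close>

lemma modulus_comp_le:
  assumes A: "L1_Linf_contraction M A" and B: "L1_Linf_contraction M B" and C: "L1_Linf_contraction M C"
    and eq: "\<And>f. f \<in> L1_Linf M \<Longrightarrow> AE x in M. C f x = A (B f) x"
    and [measurable]: "f \<in> borel_measurable M"
  shows "AE x in M. L1_Linf_contraction.modulus M C f x
    \<le> L1_Linf_contraction.modulus M A (L1_Linf_contraction.modulus M B f) x"
proof -
  interpret A: L1_Linf_contraction M A by fact
  interpret B: L1_Linf_contraction M B by fact
  interpret C: L1_Linf_contraction M C by fact
  show ?thesis
  proof (rule C.modulus_least)
    fix us assume us: "set us \<subseteq> pos_L1_Linf M" "AE x in M. ennreal (\<Sum>u\<leftarrow>us. u x) \<le> f x"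
    define fs where "fs = map (\<lambda>u x. ennreal (norm (B (\<lambda>y. complex_of_real (u y)) x))) us"
    have fs: "set fs \<subseteq> borel_measurable M" using us(1) B.A_real_measurable by (auto simp: fs_def)
    have "AE x in M. \<forall>u\<in>set us. ennreal (norm (C (\<lambda>y. complex_of_real (u y)) x))
        \<le> A.modulus (\<lambda>x. ennreal (norm (B (\<lambda>y. complex_of_real (u y)) x))) x"
    proof (subst AE_ball_countable, simp add: countable_finite, intro ballI)
      fix u assume "u \<in> set us"
      then have u: "(\<lambda>y. complex_of_real (u y)) \<in> L1_Linf M" using us by (intro of_real_L1_Linf) auto
      show "AE x in M. ennreal (norm (C (\<lambda>y. complex_of_real (u y)) x))
        \<le> A.modulus (\<lambda>x. ennreal (norm (B (\<lambda>y. complex_of_real (u y)) x))) x"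
        using A.norm_le_modulus[OF B.closed[OF u]] eq[OF u] by eventually_elim simp
    qed
    moreover have "AE x in M. A.modulus (\<lambda>x. \<Sum>f\<leftarrow>fs. f x) x = (\<Sum>f\<leftarrow>fs. A.modulus f x)"
      by (rule A.modulus.sum_list[OF fs])
    moreover have "AE x in M. A.modulus (\<lambda>x. \<Sum>f\<leftarrow>fs. f x) x \<le> A.modulus (B.modulus f) x"
    proof (rule A.modulus_mono)
      show "AE x in M. (\<Sum>f\<leftarrow>fs. f x) \<le> B.modulus f x"
        using B.variation_le_modulus[OF us] by (simp add: fs_def o_def B.variation_def)
    qed
    ultimately show "AE x in M. C.variation us x \<le> A.modulus (B.modulus f) x"
    proof eventually_elim
      case (elim x)
      have "C.variation us x \<le> (\<Sum>f\<leftarrow>fs. A.modulus f x)"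
        unfolding C.variation_def fs_def map_map o_def by (rule sum_list_mono) (use elim in auto)
      then show ?case using elim by simp
    qed
  qed
qed

section \<open>The dominating positive semigroup\<close>

locale L1_Linf_semigroup = sigma_finite_measure M for M :: "'a measure" +
  fixes T :: "real \<Rightarrow> ('a \<Rightarrow> complex) \<Rightarrow> ('a \<Rightarrow> complex)"
  assumes contr: "0 \<le> t \<Longrightarrow> L1_Linf_contraction M (T t)"
    and T_0: "f \<in> L1_Linf M \<Longrightarrow> AE x in M. T 0 f x = f x"
    and T_add: "\<lbrakk>0 \<le> s; 0 \<le> t; f \<in> L1_Linf M\<rbrakk> \<Longrightarrow> AE x in M. T (s + t) f x = T s (T t f) x"
begin

abbreviation modulus_at :: "real \<Rightarrow> ('a \<Rightarrow> ennreal) \<Rightarrow> 'a \<Rightarrow> ennreal" where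
  "modulus_at t \<equiv> L1_Linf_contraction.modulus M (T t)"

primrec partition_op :: "real list \<Rightarrow> ('a \<Rightarrow> ennreal) \<Rightarrow> 'a \<Rightarrow> ennreal" where
  "partition_op [] f = f"
| "partition_op (t # ts) f = modulus_at t (partition_op ts f)"

text \<open>Partitions are lists of interval lengths. Strict positivity makes the empty list the
  only partition of 0, so that the operator at time 0 is the identity.\<close>

definition partitions :: "real \<Rightarrow> real list set" where
  "partitions t = {ts. (\<forall>s\<in>set ts. 0 < s) \<and> sum_list ts = t}"

definition dominant :: "real \<Rightarrow> ('a \<Rightarrow> ennreal) \<Rightarrow> 'a \<Rightarrow> ennreal" where
  "dominant t f = ess_Sup M ((\<lambda>P. P f) ` partition_op ` partitions t)"

lemma modulus_at: "0 \<le> t \<Longrightarrow> positive_contraction M (modulus_at t)"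
  by (rule L1_Linf_contraction.positive_contraction_modulus[OF contr])

lemma partition_op:
  assumes "\<forall>s\<in>set ts. 0 < s"
  shows "positive_contraction M (partition_op ts)"
  using assms
proof (induction ts)
  case Nil
  have "partition_op [] = (\<lambda>f. f)" by (simp add: fun_eq_iff)
  then show ?case using positive_contraction_id[OF sigma_finite_measure_axioms] by simp
next
  case (Cons t ts)
  have "partition_op (t # ts) = (\<lambda>f. modulus_at t (partition_op ts f))" by (simp add: fun_eq_iff)
  moreover have "positive_contraction M (\<lambda>f. modulus_at t (partition_op ts f))"
    by (rule positive_contraction_comp[OF modulus_at Cons.IH]) (use Cons.prems in auto)
  ultimately show ?case by simp
qed

lemma partition_op_append: "partition_op (ts @ us) f = partition_op ts (partition_op us f)"
  by (induction ts) auto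

section \<open>Refinement of partitions\<close>

lemma modulus_at_add:
  assumes "0 \<le> s" "0 \<le> t" "f \<in> borel_measurable M"
  shows "AE x in M. modulus_at (s + t) f x \<le> modulus_at s (modulus_at t f) x"
  using assms by (intro modulus_comp_le contr T_add) auto

lemma modulus_at_mono:
  assumes "0 \<le> t" "AE x in M. f x \<le> g x"
  shows "AE x in M. modulus_at t f x \<le> modulus_at t g x"
  by (rule L1_Linf_contraction.modulus_mono[OF contr]) fact+

text \<open>Induction on the total number of intervals: the shorter of the two first intervals is
  split off the longer one, and subadditivity of the modulus shows that this cut only increases the
  operator.\<close>

lemma common_refinement:
  assumes "\<forall>s\<in>set ts. 0 < s" "\<forall>s\<in>set us. 0 < s" "sum_list ts = sum_list us"
  shows "\<exists>vs. (\<forall>s\<in>set vs. 0 < s) \<and> sum_list vs = sum_list ts \<and> (\<forall>f\<in>borel_measurable M.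
    (AE x in M. partition_op ts f x \<le> partition_op vs f x) \<and> (AE x in M. partition_op us f x \<le> partition_op vs f x))"
  using assms
proof (induction "length ts + length us" arbitrary: ts us rule: less_induct)
  case less
  have pos: "0 \<le> sum_list ts'" if "\<forall>s\<in>set ts'. 0 < s" for ts' :: "real list"
    using that by (intro sum_list_nonneg) (auto simp: less_imp_le)
  show ?case
  proof (cases "ts = [] \<or> us = []")
    case True
    have "ts = [] \<and> us = []"
      using True less.prems pos[of "tl ts"] pos[of "tl us"] by (cases ts; cases us) auto
    then show ?thesis by (intro exI[of _ "[]"]) auto
  next
    case False
    then obtain a ts' b us' where eq: "ts = a # ts'" "us = b # us'" by (meson neq_Nil_conv)
    \<comment> \<open>Stated for arbitrary heads and tails within the length bound, so that it
      serves \<open>a < b\<close> and, with the roles exchanged, \<open>b < a\<close>.\<close>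
    have split: "\<exists>vs. (\<forall>s\<in>set vs. 0 < s) \<and> sum_list vs = sum_list (a # ts') \<and> (\<forall>f\<in>borel_measurable M.
      (AE x in M. partition_op (a # ts') f x \<le> partition_op vs f x) \<and> (AE x in M. partition_op (b # us') f x \<le> partition_op vs f x))"
      if *: "a < b" "length (a # ts') + length (b # us') \<le> length ts + length us"
       "\<forall>s\<in>set (a # ts'). 0 < s" "\<forall>s\<in>set (b # us'). 0 < s" "sum_list (a # ts') = sum_list (b # us')"
      for a b ts' us'
    proof -
      \<comment> \<open>The rest \<open>b - a\<close> of the longer interval stays in its list, so
        the total length falls by exactly one.\<close>
      have "\<exists>vs. (\<forall>s\<in>set vs. 0 < s) \<and> sum_list vs = sum_list ts' \<and> (\<forall>f\<in>borel_measurable M.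
        (AE x in M. partition_op ts' f x \<le> partition_op vs f x) \<and> (AE x in M. partition_op ((b - a) # us') f x \<le> partition_op vs f x))"
        by (rule less.hyps) (use * in auto)
      then obtain vs where vs: "\<forall>s\<in>set vs. 0 < s" "sum_list vs = sum_list ts'"
        "\<And>f. f \<in> borel_measurable M \<Longrightarrow> AE x in M. partition_op ts' f x \<le> partition_op vs f x"
        "\<And>f. f \<in> borel_measurable M \<Longrightarrow> AE x in M. partition_op ((b - a) # us') f x \<le> partition_op vs f x"
        by blast
      have a: "0 < a" "0 \<le> b - a" using * by auto
      show ?thesis
      proof (intro exI[of _ "a # vs"] conjI ballI)
        fix f :: "'a \<Rightarrow> ennreal" assume f: "f \<in> borel_measurable M"
        show "AE x in M. partition_op (a # ts') f x \<le> partition_op (a # vs) f x"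
          using modulus_at_mono[of a, OF _ vs(3)[OF f]] a by simp
        have "partition_op us' f \<in> borel_measurable M"
          by (rule positive_contraction.measurable_op[OF partition_op f]) (use * in auto)
        from modulus_at_add[of a "b - a", OF _ _ this] a
        have "AE x in M. modulus_at b (partition_op us' f) x \<le> modulus_at a (modulus_at (b - a) (partition_op us' f)) x"
          by simp
        moreover have "AE x in M. modulus_at a (modulus_at (b - a) (partition_op us' f)) x \<le> modulus_at a (partition_op vs f) x"
          using modulus_at_mono[of a, OF _ vs(4)[OF f]] a by simp
        ultimately show "AE x in M. partition_op (b # us') f x \<le> partition_op (a # vs) f x"
          unfolding partition_op.simps by eventually_elim (rule order_trans)
      qed (use vs a in auto)
    qed
    consider "a = b" | "a < b" | "b < a" by linarith
    then show ?thesis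
    proof cases
      case 1
      have "\<exists>vs. (\<forall>s\<in>set vs. 0 < s) \<and> sum_list vs = sum_list ts' \<and> (\<forall>f\<in>borel_measurable M.
        (AE x in M. partition_op ts' f x \<le> partition_op vs f x) \<and> (AE x in M. partition_op us' f x \<le> partition_op vs f x))"
        by (rule less.hyps) (use less.prems eq 1 in auto)
      then obtain vs where vs: "\<forall>s\<in>set vs. 0 < s" "sum_list vs = sum_list ts'"
        "\<And>f. f \<in> borel_measurable M \<Longrightarrow> AE x in M. partition_op ts' f x \<le> partition_op vs f x"
        "\<And>f. f \<in> borel_measurable M \<Longrightarrow> AE x in M. partition_op us' f x \<le> partition_op vs f x"
        by blast
      have "0 < a" using less.prems eq by auto
      then show ?thesis
        using vs modulus_at_mono[of a] 1 by (intro exI[of _ "a # vs"]) (auto simp: eq)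
    next
      case 2
      then show ?thesis using split[of a b ts' us'] less.prems by (simp add: eq)
    next
      case 3
      then obtain vs where "(\<forall>s\<in>set vs. 0 < s) \<and> sum_list vs = sum_list us \<and> (\<forall>f\<in>borel_measurable M.
      (AE x in M. partition_op us f x \<le> partition_op vs f x) \<and> (AE x in M. partition_op ts f x \<le> partition_op vs f x))"
        using split[of b a us' ts'] less.prems unfolding eq by auto
      then show ?thesis using less.prems(3) by (intro exI[of _ vs]) auto
    qed
  qed
qed

text \<open>Inserting the cut point \<open>s\<close> into the partition: the interval that contains
  \<open>s\<close> in its interior is divided, which by subadditivity of the modulus can only
  increase the operator.\<close>

lemma split_partition:
  assumes "\<forall>r\<in>set vs. 0 < r" "sum_list vs = s + t" "0 \<le> s" "0 \<le> t"
  shows "\<exists>ts us. ts \<in> partitions s \<and> us \<in> partitions t \<and>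
    (\<forall>f\<in>borel_measurable M. AE x in M. partition_op vs f x \<le> partition_op (ts @ us) f x)"
  using assms
proof (induction vs arbitrary: s)
  case Nil
  then have "s = 0" "t = 0" by auto
  then show ?case by (intro exI[of _ "[]"]) (auto simp: partitions_def)
next
  case (Cons v vs)
  consider "s = 0" | "0 < s" "v \<le> s" | "0 < s" "s < v" using Cons.prems by linarith
  then show ?case
  proof cases
    case 1
    then show ?thesis using Cons.prems
      by (intro exI[of _ "[]"] exI[of _ "v # vs"]) (auto simp: partitions_def)
  next
    case 2
    have "\<exists>ts us. ts \<in> partitions (s - v) \<and> us \<in> partitions t \<and>
      (\<forall>f\<in>borel_measurable M. AE x in M. partition_op vs f x \<le> partition_op (ts @ us) f x)"
      by (rule Cons.IH) (use Cons.prems 2 in auto)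
    then obtain ts us where *: "ts \<in> partitions (s - v)" "us \<in> partitions t"
      "\<And>f. f \<in> borel_measurable M \<Longrightarrow> AE x in M. partition_op vs f x \<le> partition_op (ts @ us) f x" by blast
    show ?thesis
      using * Cons.prems modulus_at_mono[of v, OF _ *(3)]
      by (intro exI[of _ "v # ts"] exI[of _ us]) (auto simp: partitions_def)
  next
    case 3
    have "AE x in M. partition_op (v # vs) f x \<le> partition_op ([s] @ (v - s) # vs) f x" 
      if f: "f \<in> borel_measurable M" for f
      using modulus_at_add[of s "v - s", OF _ _ positive_contraction.measurable_op[OF partition_op f]] 3 Cons.prems
      by auto
    then show ?thesis using Cons.prems 3
      by (intro exI[of _ "[s]"] exI[of _ "(v - s) # vs"]) (auto simp: partitions_def)
  qed
qed

lemma partitions_nonempty: "0 \<le> t \<Longrightarrow> partitions t \<noteq> {}"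
  by (cases "t = 0") (auto simp: partitions_def intro: exI[of _ "[]"] exI[of _ "[t]"])

lemma partitions_pc: "ts \<in> partitions t \<Longrightarrow> positive_contraction M (partition_op ts)"
  by (rule partition_op) (simp add: partitions_def)

lemma partitions_directed:
  assumes "P \<in> partition_op ` partitions t" "Q \<in> partition_op ` partitions t"
  shows "\<exists>R\<in>partition_op ` partitions t. \<forall>f\<in>borel_measurable M.
    (AE x in M. P f x \<le> R f x) \<and> (AE x in M. Q f x \<le> R f x)"
proof -
  obtain ts us where "ts \<in> partitions t" "P = partition_op ts" "us \<in> partitions t" "Q = partition_op us"
    using assms by auto
  then show ?thesis using common_refinement[of ts us] unfolding partitions_def by auto
qed

section \<open>The supremum over all partitions and its semigroup law\<close>

lemma positive_contraction_dominant:
  assumes "0 \<le> t"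
  shows "positive_contraction M (dominant t)"
  unfolding dominant_def[abs_def]
proof (rule positive_contraction_ess_Sup[OF sigma_finite_measure_axioms])
  show "partition_op ` partitions t \<noteq> {}" using partitions_nonempty[OF assms] by simp
  show "positive_contraction M P" if "P \<in> partition_op ` partitions t" for P
    using that partitions_pc by auto
qed (rule partitions_directed)

lemma partition_sets:
  assumes "0 \<le> t" "f \<in> borel_measurable M"
  shows "(\<lambda>P. P f) ` partition_op ` partitions t \<subseteq> borel_measurable M"
    and "(\<lambda>P. P f) ` partition_op ` partitions t \<noteq> {}"
  using assms partitions_nonempty[OF assms(1)] by (auto intro: positive_contraction.measurable_op[OF partitions_pc])

lemma partition_op_le_dominant:
  assumes "0 \<le> t" "f \<in> borel_measurable M" "ts \<in> partitions t"
  shows "AE x in M. partition_op ts f x \<le> dominant t f x"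
  unfolding dominant_def by (rule ess_Sup_upper[OF partition_sets]) (use assms in auto)

lemma dominant_least:
  assumes "0 \<le> t" "f \<in> borel_measurable M" "\<And>ts. ts \<in> partitions t \<Longrightarrow> AE x in M. partition_op ts f x \<le> g x"
  shows "AE x in M. dominant t f x \<le> g x"
  unfolding dominant_def by (rule ess_Sup_least[OF partition_sets]) (use assms in auto)

lemma dominant_measurable:
  "0 \<le> t \<Longrightarrow> f \<in> borel_measurable M \<Longrightarrow> dominant t f \<in> borel_measurable M"
  by (rule positive_contraction.measurable_op[OF positive_contraction_dominant])

lemma dominant_sequence:
  assumes "0 \<le> t" "f \<in> borel_measurable M"
  obtains U :: "nat \<Rightarrow> real list" where "\<And>n. U n \<in> partitions t" "AE x in M. incseq (\<lambda>n. partition_op (U n) f x)"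
    "AE x in M. dominant t f x = (SUP n. partition_op (U n) f x)"
proof -
  obtain b :: "nat \<Rightarrow> 'a \<Rightarrow> ennreal" where b: "range b \<subseteq> (\<lambda>P. P f) ` partition_op ` partitions t"
    "AE x in M. incseq (\<lambda>n. b n x)" "AE x in M. dominant t f x = (SUP n. b n x)"
    unfolding dominant_def
  proof (rule ess_Sup_directed[OF partition_sets[OF assms]])
    fix g h assume "g \<in> (\<lambda>P. P f) ` partition_op ` partitions t" "h \<in> (\<lambda>P. P f) ` partition_op ` partitions t"
    then obtain P Q where "g = P f" "h = Q f" "P \<in> partition_op ` partitions t" "Q \<in> partition_op ` partitions t" by blast
    with partitions_directed[of P t Q] assms(2)
    show "\<exists>k\<in>(\<lambda>P. P f) ` partition_op ` partitions t. (AE x in M. g x \<le> k x) \<and> (AE x in M. h x \<le> k x)"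
      by blast
  qed blast
  have "\<forall>n. \<exists>ts. b n = partition_op ts f \<and> ts \<in> partitions t" using b(1) by (auto simp: image_subset_iff)
  from choice[OF this] obtain U where U: "\<forall>n. b n = partition_op (U n) f \<and> U n \<in> partitions t" ..
  then have "b = (\<lambda>n. partition_op (U n) f)" by auto
  with U b show ?thesis by (intro that[of U]) simp_all
qed

lemma dominant_0:
  assumes "f \<in> borel_measurable M"
  shows "AE x in M. dominant 0 f x = f x"
proof -
  have "ts = []" if "ts \<in> partitions 0" for ts
  proof (cases ts)
    case (Cons a us)
    then have "0 \<le> sum_list us" using that by (intro sum_list_nonneg) (auto simp: partitions_def less_imp_le)
    then show ?thesis using that Cons by (auto simp: partitions_def)
  qed
  then have 1: "AE x in M. dominant 0 f x \<le> f x"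
    using assms by (intro dominant_least) fastforce+
  have "[] \<in> partitions 0" by (simp add: partitions_def)
  from partition_op_le_dominant[OF _ assms this] have "AE x in M. f x \<le> dominant 0 f x" by simp
  with 1 show ?thesis by eventually_elim auto
qed

text \<open>One inequality cuts every partition of \<open>s + t\<close> at \<open>s\<close>; the
  other concatenates partitions. In the latter, \<open>dominant t f\<close> is replaced by an
  increasing sequence of partition operators, through which a fixed operator for \<open>s\<close> is
  continuous.\<close>

lemma dominant_add:
  assumes s: "0 \<le> s" and t: "0 \<le> t" and f: "f \<in> borel_measurable M"
  shows "AE x in M. dominant (s + t) f x = dominant s (dominant t f) x"
proof -
  have st: "0 \<le> s + t" using s t by simp
  note meas = dominant_measurable[OF t f]
  have "AE x in M. dominant (s + t) f x \<le> dominant s (dominant t f) x"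
  proof (rule dominant_least[OF st f])
    fix vs assume "vs \<in> partitions (s + t)"
    then obtain ts us where *: "ts \<in> partitions s" "us \<in> partitions t"
      "AE x in M. partition_op vs f x \<le> partition_op (ts @ us) f x"
      using split_partition[of vs s t] s t f unfolding partitions_def by auto
    have "AE x in M. partition_op ts (partition_op us f) x \<le> partition_op ts (dominant t f) x"
      by (rule positive_contraction.mono[OF partitions_pc[OF *(1)]
            positive_contraction.measurable_op[OF partitions_pc[OF *(2)] f] meas
            partition_op_le_dominant[OF t f *(2)]])
    with *(3) partition_op_le_dominant[OF s meas *(1)]
    show "AE x in M. partition_op vs f x \<le> dominant s (dominant t f) x"
      unfolding partition_op_append by eventually_elim (blast intro: order_trans)
  qed
  moreover have "AE x in M. dominant s (dominant t f) x \<le> dominant (s + t) f x"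
  proof (rule dominant_least[OF s meas])
    fix ts assume ts: "ts \<in> partitions s"
    interpret P: positive_contraction M "partition_op ts" by (rule partitions_pc[OF ts])
    obtain U :: "nat \<Rightarrow> real list" where U: "\<And>n. U n \<in> partitions t" "AE x in M. incseq (\<lambda>n. partition_op (U n) f x)"
      "AE x in M. dominant t f x = (SUP n. partition_op (U n) f x)"
      using dominant_sequence[OF t f] by blast
    note [measurable] = positive_contraction.measurable_op[OF partitions_pc[OF U(1)] f] meas
    have "AE x in M. partition_op ts (dominant t f) x = partition_op ts (\<lambda>x. SUP n. partition_op (U n) f x) x"
      by (rule P.AE_cong) (use U in auto)
    moreover have "AE x in M. partition_op ts (\<lambda>x. SUP n. partition_op (U n) f x) x = (SUP n. partition_op ts (partition_op (U n) f) x)"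
      by (rule P.SUP_eq_AE) (use U in auto)
    moreover have "AE x in M. \<forall>n. partition_op (ts @ U n) f x \<le> dominant (s + t) f x"
      unfolding AE_all_countable using ts U(1)
      by (intro allI partition_op_le_dominant[OF st f]) (auto simp: partitions_def)
    ultimately show "AE x in M. partition_op ts (dominant t f) x \<le> dominant (s + t) f x"
      by eventually_elim (simp add: partition_op_append SUP_least)
  qed
  ultimately show ?thesis by eventually_elim auto
qed

lemma norm_le_dominant:
  assumes t: "0 \<le> t" and f: "f \<in> L1_Linf M"
  shows "AE x in M. ennreal (norm (T t f x)) \<le> dominant t (\<lambda>x. ennreal (norm (f x))) x"
proof (cases "t = 0")
  case True
  have [measurable]: "f \<in> borel_measurable M" using f by (rule L1_LinfD)
  have "AE x in M. dominant 0 (\<lambda>x. ennreal (norm (f x))) x = ennreal (norm (f x))"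
    by (rule dominant_0) measurable
  then show ?thesis using T_0[OF f] unfolding True by eventually_elim simp
next
  case False
  have [measurable]: "f \<in> borel_measurable M" using f by (rule L1_LinfD)
  have "AE x in M. partition_op [t] (\<lambda>x. ennreal (norm (f x))) x \<le> dominant t (\<lambda>x. ennreal (norm (f x))) x"
    by (rule partition_op_le_dominant) (use t False in \<open>auto simp: partitions_def\<close>)
  moreover have "AE x in M. ennreal (norm (T t f x)) \<le> modulus_at t (\<lambda>x. ennreal (norm (f x))) x"
    by (rule L1_Linf_contraction.norm_le_modulus[OF contr[OF t] f])
  ultimately show ?thesis by eventually_elim simp
qed

end

section \<open>Action on \<open>L\<^sup>p\<close>\<close>

text \<open>The p-th power of the norm with infinity as a genuine value, whereas
  \<open>Lp_norm\<close> inherits the default 0 of the Bochner integral for functions that are not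
  integrable.\<close>

definition powr_integral :: "'a measure \<Rightarrow> real \<Rightarrow> ('a \<Rightarrow> complex) \<Rightarrow> ennreal" where
  "powr_integral M p f = (\<integral>\<^sup>+x. ennreal (norm (f x) powr p) \<partial>M)"

lemma enn2real_ge_1:
  assumes "1 \<le> p" "p < (\<infinity>::ennreal)"
  shows "1 \<le> enn2real p"
  using assms by (cases p) (auto simp: ennreal_ge_1)

lemma Lp_space_iff:
  assumes "p < \<infinity>"
  shows "f \<in> Lp_space M p \<longleftrightarrow> f \<in> borel_measurable M \<and> powr_integral M (enn2real p) f < \<infinity>"
proof -
  have "integrable M (\<lambda>x. norm (f x) powr enn2real p) \<longleftrightarrow> powr_integral M (enn2real p) f < \<infinity>"
    if [measurable]: "f \<in> borel_measurable M"
    by (simp add: powr_integral_def integrable_iff_bounded)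
  then show ?thesis using assms by (auto simp: Lp_space_def)
qed

lemma Lp_space_measurable: "f \<in> Lp_space M p \<Longrightarrow> f \<in> borel_measurable M"
  by (simp add: Lp_space_def)

text \<open>Outside \<open>L^p\<close> both sides are 0: the integral by its default and
  \<open>enn2real\<close> by its value at infinity.\<close>

lemma Lp_norm_eq:
  assumes "p < \<infinity>" "f \<in> borel_measurable M"
  shows "Lp_norm M p f = enn2real (powr_integral M (enn2real p) f) powr (1 / enn2real p)"
proof -
  note [measurable] = assms(2)
  have "(LINT x|M. norm (f x) powr enn2real p) = enn2real (powr_integral M (enn2real p) f)"
    unfolding powr_integral_def by (rule integral_eq_nn_integral) auto
  then show ?thesis using assms(1) by (simp add: Lp_norm_def)
qed

lemma Lp_norm_le_iff:
  assumes p: "1 \<le> p" "p < \<infinity>" and f: "f \<in> Lp_space M p" and g: "g \<in> Lp_space M p"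
  shows "Lp_norm M p f \<le> Lp_norm M p g \<longleftrightarrow> powr_integral M (enn2real p) f \<le> powr_integral M (enn2real p) g"
proof -
  let ?q = "enn2real p"
  have q: "1 \<le> ?q" using enn2real_ge_1[OF p] .
  have fin: "powr_integral M ?q f < \<infinity>" "powr_integral M ?q g < \<infinity>"
    using f g p by (auto simp: Lp_space_iff)
  have "Lp_norm M p f \<le> Lp_norm M p g
      \<longleftrightarrow> enn2real (powr_integral M ?q f) powr (1 / ?q) \<le> enn2real (powr_integral M ?q g) powr (1 / ?q)"
    using f g p by (simp add: Lp_norm_eq Lp_space_measurable)
  also have "\<dots> \<longleftrightarrow> enn2real (powr_integral M ?q f) \<le> enn2real (powr_integral M ?q g)"
    using q by (meson divide_pos_pos enn2real_nonneg less_le_trans not_le powr_less_mono2 powr_mono2 zero_less_one less_imp_le)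
  also have "\<dots> \<longleftrightarrow> powr_integral M ?q f \<le> powr_integral M ?q g"
    using fin by (cases "powr_integral M ?q f"; cases "powr_integral M ?q g") (auto simp: ennreal_le_iff)
  finally show ?thesis .
qed

lemma powr_integral_mono:
  assumes "AE x in M. norm (f x) \<le> norm (g x)" "0 \<le> p"
  shows "powr_integral M p f \<le> powr_integral M p g"
  unfolding powr_integral_def
  by (rule nn_integral_mono_AE) (use assms in \<open>auto elim!: eventually_mono intro!: ennreal_leI powr_mono2\<close>)

lemma powr_integral_cong:
  assumes "AE x in M. f x = g x"
  shows "powr_integral M p f = powr_integral M p g"
  unfolding powr_integral_def by (rule nn_integral_cong_AE) (use assms in auto)

lemma powr_add_le:
  fixes a b p :: real
  assumes "0 \<le> a" "0 \<le> b" "0 \<le> p"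
  shows "(a + b) powr p \<le> 2 powr p * (a powr p + b powr p)"
proof -
  have "(a + b) powr p \<le> (2 * max a b) powr p" using assms by (intro powr_mono2) auto
  also have "\<dots> = 2 powr p * max a b powr p" using assms by (simp add: powr_mult)
  also have "\<dots> \<le> 2 powr p * (a powr p + b powr p)" by (intro mult_left_mono) (auto simp: max_def)
  finally show ?thesis .
qed

text \<open>A quasi-triangle inequality for p-th powers with the crude constant 2^p, sufficient for
  convergence statements.\<close>

lemma powr_integral_add_le:
  assumes [measurable]: "f \<in> borel_measurable M" "g \<in> borel_measurable M" and p: "0 \<le> p"
  shows "powr_integral M p (\<lambda>x. f x + g x) \<le> ennreal (2 powr p) * (powr_integral M p f + powr_integral M p g)"
proof -
  have "powr_integral M p (\<lambda>x. f x + g x)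
      \<le> (\<integral>\<^sup>+x. ennreal (2 powr p) * (ennreal (norm (f x) powr p) + ennreal (norm (g x) powr p)) \<partial>M)"
    unfolding powr_integral_def
  proof (rule nn_integral_mono)
    fix x
    have "norm (f x + g x) powr p \<le> (norm (f x) + norm (g x)) powr p"
      using p by (intro powr_mono2 norm_triangle_ineq) auto
    also have "\<dots> \<le> 2 powr p * (norm (f x) powr p + norm (g x) powr p)"
      using p by (intro powr_add_le) auto
    finally show "ennreal (norm (f x + g x) powr p)
      \<le> ennreal (2 powr p) * (ennreal (norm (f x) powr p) + ennreal (norm (g x) powr p))"
      by (simp add: ennreal_mult[symmetric] ennreal_plus[symmetric] ennreal_leI del: ennreal_plus)
  qed
  also have "\<dots> = ennreal (2 powr p) * (powr_integral M p f + powr_integral M p g)"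
    unfolding powr_integral_def by (subst nn_integral_cmult, measurable) (subst nn_integral_add, measurable)
  finally show ?thesis .
qed

lemma powr_integral_scale:
  assumes [measurable]: "f \<in> borel_measurable M"
  shows "powr_integral M p (\<lambda>x. c * f x) = ennreal (norm c powr p) * powr_integral M p f"
proof -
  have "powr_integral M p (\<lambda>x. c * f x) = (\<integral>\<^sup>+x. ennreal (norm c powr p) * ennreal (norm (f x) powr p) \<partial>M)"
    unfolding powr_integral_def by (simp add: norm_mult powr_mult ennreal_mult')
  then show ?thesis unfolding powr_integral_def by (simp add: nn_integral_cmult)
qed

lemma Lp_space_add:
  assumes "p < \<infinity>" "f \<in> Lp_space M p" "g \<in> Lp_space M p"
  shows "(\<lambda>x. f x + g x) \<in> Lp_space M p"
proof -
  have f: "f \<in> borel_measurable M" "g \<in> borel_measurable M"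
    and fin: "powr_integral M (enn2real p) f < \<infinity>" "powr_integral M (enn2real p) g < \<infinity>"
    using assms by (auto simp: Lp_space_iff)
  have "powr_integral M (enn2real p) (\<lambda>x. f x + g x) < \<infinity>"
    by (rule le_less_trans[OF powr_integral_add_le[OF f]]) (use fin in \<open>auto simp: ennreal_mult_less_top\<close>)
  then show ?thesis using f assms(1) by (simp add: Lp_space_iff)
qed

lemma Lp_space_scale:
  assumes "p < \<infinity>" "f \<in> Lp_space M p"
  shows "(\<lambda>x. c * f x) \<in> Lp_space M p"
  using assms by (auto simp: Lp_space_iff powr_integral_scale ennreal_mult_less_top)

lemma Lp_space_diff:
  assumes "p < \<infinity>" "f \<in> Lp_space M p" "g \<in> Lp_space M p"
  shows "(\<lambda>x. f x - g x) \<in> Lp_space M p"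
  using Lp_space_add[OF assms(1,2) Lp_space_scale[OF assms(1,3), of "-1"]] by simp

lemma Lp_space_dominated:
  assumes "p < \<infinity>" "g \<in> Lp_space M p" "f \<in> borel_measurable M" "AE x in M. norm (f x) \<le> norm (g x)"
  shows "f \<in> Lp_space M p"
  using assms powr_integral_mono[OF assms(4), of "enn2real p"]
  by (auto simp: Lp_space_iff)

lemma Linf_space_iff:
  "f \<in> Lp_space M \<infinity> \<longleftrightarrow> f \<in> borel_measurable M \<and> (\<exists>c\<ge>0. AE x in M. norm (f x) \<le> c)"
proof (cases "f \<in> borel_measurable M")
  case True
  note [measurable] = True
  have "esssup M (\<lambda>x. ennreal (norm (f x))) < \<infinity> \<longleftrightarrow> (\<exists>c\<ge>0. AE x in M. norm (f x) \<le> c)"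
  proof
    assume *: "esssup M (\<lambda>x. ennreal (norm (f x))) < \<infinity>"
    then obtain c where c: "0 \<le> c" "esssup M (\<lambda>x. ennreal (norm (f x))) = ennreal c"
      by (cases "esssup M (\<lambda>x. ennreal (norm (f x)))") auto
    have "AE x in M. ennreal (norm (f x)) \<le> esssup M (\<lambda>x. ennreal (norm (f x)))" by (rule esssup_AE)
    then have "AE x in M. norm (f x) \<le> c" unfolding c by eventually_elim (use c in simp)
    with c show "\<exists>c\<ge>0. AE x in M. norm (f x) \<le> c" by auto
  next
    assume "\<exists>c\<ge>0. AE x in M. norm (f x) \<le> c"
    then obtain c where c: "0 \<le> c" "AE x in M. norm (f x) \<le> c" by auto
    have "esssup M (\<lambda>x. ennreal (norm (f x))) \<le> ennreal c"
      by (rule esssup_I) (use c in \<open>auto intro: ennreal_leI\<close>)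
    then show "esssup M (\<lambda>x. ennreal (norm (f x))) < \<infinity>" using le_less_trans by fastforce
  qed
  then show ?thesis using True by (simp add: Lp_space_def)
qed (simp add: Lp_space_def)

lemma Linf_norm_leD:
  assumes f: "f \<in> Lp_space M \<infinity>" and g: "g \<in> Lp_space M \<infinity>" and le: "Lp_norm M \<infinity> f \<le> Lp_norm M \<infinity> g"
    and c: "AE x in M. norm (g x) \<le> c" "0 \<le> c"
  shows "AE x in M. norm (f x) \<le> c"
proof -
  have [measurable]: "f \<in> borel_measurable M" "g \<in> borel_measurable M" using f g by (auto simp: Lp_space_def)
  have fin: "esssup M (\<lambda>x. ennreal (norm (f x))) < \<infinity>" "esssup M (\<lambda>x. ennreal (norm (g x))) < \<infinity>"
    using f g by (auto simp: Lp_space_def)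
  have "esssup M (\<lambda>x. ennreal (norm (f x))) \<le> esssup M (\<lambda>x. ennreal (norm (g x)))"
    using le fin unfolding Lp_norm_def
    by (cases "esssup M (\<lambda>x. ennreal (norm (f x)))"; cases "esssup M (\<lambda>x. ennreal (norm (g x)))") auto
  also have "\<dots> \<le> ennreal c" by (rule esssup_I) (use c in \<open>auto intro: ennreal_leI\<close>)
  finally have le: "esssup M (\<lambda>x. ennreal (norm (f x))) \<le> ennreal c" .
  have "AE x in M. ennreal (norm (f x)) \<le> esssup M (\<lambda>x. ennreal (norm (f x)))" by (rule esssup_AE)
  then show ?thesis
  proof eventually_elim
    case (elim x)
    from order_trans[OF elim le] show ?case using c by simp
  qed
qed

lemma Linf_norm_leI:
  assumes f: "f \<in> Lp_space M \<infinity>" and g: "g \<in> Lp_space M \<infinity>"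
    and le: "\<And>c. 0 \<le> c \<Longrightarrow> AE x in M. norm (g x) \<le> c \<Longrightarrow> AE x in M. norm (f x) \<le> c"
  shows "Lp_norm M \<infinity> f \<le> Lp_norm M \<infinity> g"
proof -
  have [measurable]: "f \<in> borel_measurable M" "g \<in> borel_measurable M" using f g by (auto simp: Lp_space_def)
  obtain c where c: "0 \<le> c" "esssup M (\<lambda>x. ennreal (norm (g x))) = ennreal c"
    using g by (cases "esssup M (\<lambda>x. ennreal (norm (g x)))") (auto simp: Lp_space_def)
  have "AE x in M. ennreal (norm (g x)) \<le> esssup M (\<lambda>x. ennreal (norm (g x)))" by (rule esssup_AE)
  then have "AE x in M. norm (g x) \<le> c" unfolding c by eventually_elim (use c in simp)
  then have "AE x in M. norm (f x) \<le> c" by (rule le[OF c(1)])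
  then have "esssup M (\<lambda>x. ennreal (norm (f x))) \<le> ennreal c"
    by (intro esssup_I) (auto intro: ennreal_leI)
  then have "enn2real (esssup M (\<lambda>x. ennreal (norm (f x)))) \<le> c"
    using c(1) enn2real_leI by blast
  then show ?thesis using c by (simp add: Lp_norm_def)
qed

lemma L1_Linf_subset_Lp:
  assumes p: "1 \<le> p" and f: "f \<in> L1_Linf M"
  shows "f \<in> Lp_space M p"
proof (cases "p = \<infinity>")
  case True
  obtain c where "AE x in M. norm (f x) \<le> c" using f by (auto simp: L1_Linf_def)
  \<comment> \<open>The bound \<open>c\<close> may be negative if the whole space is a null
    set.\<close>
  then have "AE x in M. norm (f x) \<le> max c 0" by eventually_elim auto
  then show ?thesis using L1_LinfD(1)[OF f] unfolding True Linf_space_iff by (intro conjI exI[of _ "max c 0"]) auto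
next
  case False
  then have p': "p < \<infinity>" by (simp add: less_top)
  let ?q = "enn2real p"
  have q: "1 \<le> ?q" using enn2real_ge_1[OF p p'] .
  obtain c where c: "AE x in M. norm (f x) \<le> c" using f by (auto simp: L1_Linf_def)
  have [measurable]: "f \<in> borel_measurable M" using f by (rule L1_LinfD)
  have "powr_integral M ?q f \<le> (\<integral>\<^sup>+x. ennreal (max c 0 powr (?q - 1)) * ennreal (norm (f x)) \<partial>M)"
    unfolding powr_integral_def
  proof (rule nn_integral_mono_AE)
    show "AE x in M. ennreal (norm (f x) powr ?q) \<le> ennreal (max c 0 powr (?q - 1)) * ennreal (norm (f x))"
      using c
    proof eventually_elim
      case (elim x)
      have "norm (f x) powr ?q = norm (f x) powr (?q - 1) * norm (f x)"
        by (cases "f x = 0") (auto simp: powr_diff)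
      also have "\<dots> \<le> max c 0 powr (?q - 1) * norm (f x)"
        using elim q by (intro mult_right_mono powr_mono2) auto
      finally show ?case by (simp add: ennreal_mult[symmetric] ennreal_leI)
    qed
  qed
  also have "\<dots> = ennreal (max c 0 powr (?q - 1)) * (\<integral>\<^sup>+x. norm (f x) \<partial>M)"
    by (rule nn_integral_cmult) measurable
  also have "\<dots> < \<infinity>"
    using L1_LinfD(2)[OF f] by (simp add: ennreal_mult_less_top nn_integral_eq_integral)
  finally show ?thesis using p' by (simp add: Lp_space_iff)
qed

text \<open>Convergence to 0 in \<open>L^1\<close> of the p-th powers gives an almost everywhere
  convergent subsequence; taking p-th roots returns to the functions.\<close>

lemma powr_integral_subseq_AE:
  assumes f: "\<And>n::nat. f n \<in> borel_measurable M" and p: "0 < p"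
    and lim: "(\<lambda>n. powr_integral M p (f n)) \<longlonglongrightarrow> 0"
  shows "\<exists>r. strict_mono r \<and> (AE x in M. (\<lambda>n. f (r n) x) \<longlonglongrightarrow> 0)"
proof -
  note [measurable] = f
  have "\<forall>\<^sub>F n in sequentially. powr_integral M p (f n) < 1"
    using lim by (rule order_tendstoD) simp
  then obtain N where N: "\<And>n. n \<ge> N \<Longrightarrow> powr_integral M p (f n) < 1"
    by (auto simp: eventually_sequentially)
  \<comment> \<open>The shift by \<open>N\<close> discards the terms whose integral might be
    infinite.\<close>
  define u where "u n x = norm (f (n + N) x) powr p" for n x
  have int: "integrable M (u n)" for n
    using N[of "n + N"] unfolding u_def[abs_def]
    by (auto simp: integrable_iff_bounded powr_integral_def intro: less_trans)
  have "(\<lambda>n. enn2real (powr_integral M p (f (n + N)))) \<longlonglongrightarrow> 0"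
    by (rule tendsto_enn2real) (use LIMSEQ_ignore_initial_segment[OF lim] in simp_all)
  moreover have "(LINT x|M. norm (u n x)) = enn2real (powr_integral M p (f (n + N)))" for n
    unfolding powr_integral_def u_def by (subst integral_eq_nn_integral) auto
  ultimately have "(\<lambda>n. LINT x|M. norm (u n x)) \<longlonglongrightarrow> 0" by simp
  from tendsto_L1_AE_subseq[OF int this] obtain r where r: "strict_mono r" "AE x in M. (\<lambda>n. u (r n) x) \<longlonglongrightarrow> 0"
    by auto
  from r(2) have "AE x in M. (\<lambda>n. f (r n + N) x) \<longlonglongrightarrow> 0"
  proof eventually_elim
    case (elim x)
    have "(\<lambda>n. u (r n) x powr (1 / p)) \<longlonglongrightarrow> 0 powr (1 / p)"
      by (rule tendsto_powr'[OF elim tendsto_const]) (use p in \<open>auto simp: u_def\<close>)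
    moreover have "u (r n) x powr (1 / p) = norm (f (r n + N) x)" for n
      using p by (simp add: u_def powr_powr)
    ultimately show ?case by (simp add: tendsto_norm_zero_iff)
  qed
  moreover have "strict_mono (\<lambda>n. r n + N)" using r(1) by (simp add: strict_mono_def)
  ultimately show ?thesis by (intro exI[of _ "\<lambda>n. r n + N"]) auto
qed

section \<open>Approximation by cutoffs\<close>

context sigma_finite_measure
begin

text \<open>Cutting off to a set of finite measure on which \<open>f\<close> is bounded approximates every measurable
  function by elements of \<open>L\<^sup>1 \<inter> L\<^sup>\<infinity>\<close>.\<close>

definition exhaustion :: "nat \<Rightarrow> 'a set" where
  "exhaustion = (SOME A. range A \<subseteq> sets M \<and> (\<Union>i. A i) = space M \<and> (\<forall>i. emeasure M (A i) \<noteq> \<infinity>) \<and> incseq A)"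

lemma exhaustion: "exhaustion n \<in> sets M" "(\<Union>i. exhaustion i) = space M"
  "emeasure M (exhaustion i) \<noteq> \<infinity>" "incseq exhaustion"
proof -
  have "\<exists>A::nat \<Rightarrow> 'a set. range A \<subseteq> sets M \<and> (\<Union>i. A i) = space M \<and> (\<forall>i. emeasure M (A i) \<noteq> \<infinity>) \<and> incseq A"
    using sigma_finite_incseq by metis
  from someI_ex[OF this, folded exhaustion_def]
  show "exhaustion n \<in> sets M" "(\<Union>i. exhaustion i) = space M"
    "emeasure M (exhaustion i) \<noteq> \<infinity>" "incseq exhaustion" by auto
qed

definition cutoff :: "nat \<Rightarrow> ('a \<Rightarrow> complex) \<Rightarrow> 'a \<Rightarrow> complex" where
  "cutoff n f x = (if x \<in> exhaustion n \<and> norm (f x) \<le> real n then f x else 0)"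

lemma cutoff_measurable [measurable]:
  assumes [measurable]: "f \<in> borel_measurable M"
  shows "cutoff n f \<in> borel_measurable M"
proof -
  note [measurable] = exhaustion(1)
  show ?thesis unfolding cutoff_def[abs_def] by measurable
qed

lemma cutoff_L1_Linf:
  assumes [measurable]: "f \<in> borel_measurable M"
  shows "cutoff n f \<in> L1_Linf M"
proof -
  note [measurable] = exhaustion(1)
  have le: "norm (cutoff n f x) \<le> real n * indicator (exhaustion n) x" for x
    by (auto simp: cutoff_def indicator_def)
  have "integrable M (\<lambda>x. real n * indicat_real (exhaustion n) x)"
    using exhaustion(1,3) by (auto simp: less_top[symmetric] intro!: integrable_mult_right)
  then have "integrable M (cutoff n f)"
    by (rule Bochner_Integration.integrable_bound) (use le in \<open>auto intro!: AE_I2 order_trans[OF le]\<close>)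
  moreover have "norm (cutoff n f x) \<le> real n" for x by (auto simp: cutoff_def)
  ultimately show ?thesis by (auto simp: L1_Linf_def)
qed

lemma norm_cutoff_le: "norm (cutoff n f x) \<le> norm (f x)"
  and norm_cutoff_diff_le: "norm (cutoff n f x - f x) \<le> norm (f x)"
  by (auto simp: cutoff_def)

lemma cutoff_eventually:
  assumes "x \<in> space M"
  shows "\<forall>\<^sub>F n in sequentially. cutoff n f x = f x"
proof -
  obtain i where i: "x \<in> exhaustion i" using assms exhaustion(2) by auto
  obtain k where k: "norm (f x) \<le> real k" using real_arch_simple by blast
  have "cutoff n f x = f x" if "n \<ge> max i k" for n
    using that i k incseqD[OF exhaustion(4), of i n] by (auto simp: cutoff_def)
  then show ?thesis unfolding eventually_sequentially by blast
qed

lemma powr_integral_cutoff: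
  assumes [measurable]: "f \<in> borel_measurable M" and p: "0 < p" and fin: "powr_integral M p f < \<infinity>"
  shows "(\<lambda>n. powr_integral M p (\<lambda>x. cutoff n f x - f x)) \<longlonglongrightarrow> 0"
proof -
  have "(\<lambda>n. \<integral>\<^sup>+x. ennreal (norm (cutoff n f x - f x) powr p) \<partial>M) \<longlonglongrightarrow> (\<integral>\<^sup>+x. 0 \<partial>M)"
  proof (rule nn_integral_dominated_convergence)
    show "AE x in M. ennreal (norm (cutoff n f x - f x) powr p) \<le> ennreal (norm (f x) powr p)" for n
      using p by (intro AE_I2 ennreal_leI powr_mono2 norm_cutoff_diff_le) auto
    show "(\<integral>\<^sup>+x. ennreal (norm (f x) powr p) \<partial>M) < \<infinity>" using fin by (simp add: powr_integral_def)
    show "AE x in M. (\<lambda>n. ennreal (norm (cutoff n f x - f x) powr p)) \<longlonglongrightarrow> 0"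
    proof (intro AE_I2 tendsto_eventually)
      fix x assume "x \<in> space M"
      from cutoff_eventually[OF this, of f]
      show "\<forall>\<^sub>F n in sequentially. ennreal (norm (cutoff n f x - f x) powr p) = 0"
        by eventually_elim simp
    qed
  qed measurable
  then show ?thesis by (simp add: powr_integral_def)
qed

end

section \<open>Positive operators on real and complex functions\<close>

context positive_contraction
begin

text \<open>\<^const>\<open>ennreal\<close> maps negative numbers to 0, so the two terms are the images of the positive and
  the negative part of \<open>u\<close>.\<close>

definition real_op :: "('a \<Rightarrow> real) \<Rightarrow> 'a \<Rightarrow> real" where
  "real_op u x = enn2real (P (\<lambda>x. ennreal (u x)) x) - enn2real (P (\<lambda>x. ennreal (- u x)) x)"

definition complex_op :: "('a \<Rightarrow> complex) \<Rightarrow> 'a \<Rightarrow> complex" where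
  "complex_op f x = Complex (real_op (\<lambda>x. Re (f x)) x) (real_op (\<lambda>x. Im (f x)) x)"

lemma finite_mono:
  assumes [measurable]: "f \<in> borel_measurable M" "g \<in> borel_measurable M" and "AE x in M. P g x < \<infinity>" "AE x in M. f x \<le> g x"
  shows "AE x in M. P f x < \<infinity>"
proof -
  have "AE x in M. P f x \<le> P g x" by (rule mono) (use assms in auto)
  with assms(3) show ?thesis by eventually_elim auto
qed

lemma real_op_measurable [measurable]:
  assumes [measurable]: "u \<in> borel_measurable M"
  shows "real_op u \<in> borel_measurable M"
proof -
  note [measurable] = measurable_op
  show ?thesis unfolding real_op_def[abs_def] by measurable
qed

text \<open>The value does not depend on how \<open>u\<close> is written as a difference: with u+
  and u- the parts of \<open>u\<close>, the identity u+ + b = a + u- involves only sums of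
  nonnegative functions, and finiteness allows rearranging its image.\<close>

lemma real_op_diff:
  assumes [measurable]: "u \<in> borel_measurable M" "a \<in> borel_measurable M" "b \<in> borel_measurable M"
    and nn: "\<And>x. 0 \<le> a x" "\<And>x. 0 \<le> b x"
    and fin: "AE x in M. P (\<lambda>x. ennreal (a x)) x < \<infinity>" "AE x in M. P (\<lambda>x. ennreal (b x)) x < \<infinity>"
    and eq: "AE x in M. u x = a x - b x"
  shows "AE x in M. real_op u x = enn2real (P (\<lambda>x. ennreal (a x)) x) - enn2real (P (\<lambda>x. ennreal (b x)) x)"
proof -
  have "AE x in M. P (\<lambda>x. ennreal (u x) + ennreal (b x)) x = P (\<lambda>x. ennreal (a x) + ennreal (- u x)) x"
  proof (rule AE_cong)
    show "AE x in M. ennreal (u x) + ennreal (b x) = ennreal (a x) + ennreal (- u x)"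
      using eq
    proof eventually_elim
      case (elim x)
      show ?case
      proof (cases "0 \<le> u x")
        case True
        then show ?thesis using elim nn[of x] by (simp add: ennreal_plus[symmetric] ennreal_neg del: ennreal_plus)
      next
        case False
        then show ?thesis using elim nn[of x] by (simp add: ennreal_plus[symmetric] ennreal_neg del: ennreal_plus)
      qed
    qed
  qed measurable
  moreover have "AE x in M. P (\<lambda>x. ennreal (u x) + ennreal (b x)) x = P (\<lambda>x. ennreal (u x)) x + P (\<lambda>x. ennreal (b x)) x"
    by (rule add) measurable
  moreover have "AE x in M. P (\<lambda>x. ennreal (a x) + ennreal (- u x)) x = P (\<lambda>x. ennreal (a x)) x + P (\<lambda>x. ennreal (- u x)) x"
    by (rule add) measurable
  moreover have "AE x in M. P (\<lambda>x. ennreal (u x)) x < \<infinity>"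
    by (rule finite_mono[OF _ _ fin(1)]) (use eq nn in \<open>auto elim!: eventually_mono intro!: ennreal_leI\<close>)
  moreover have "AE x in M. P (\<lambda>x. ennreal (- u x)) x < \<infinity>"
    by (rule finite_mono[OF _ _ fin(2)]) (use eq nn in \<open>auto elim!: eventually_mono intro!: ennreal_leI\<close>)
  ultimately show ?thesis using fin
  proof eventually_elim
    case (elim x)
    have "P (\<lambda>x. ennreal (u x)) x + P (\<lambda>x. ennreal (b x)) x = P (\<lambda>x. ennreal (a x)) x + P (\<lambda>x. ennreal (- u x)) x"
      using elim by simp
    from arg_cong[OF this, of enn2real]
    have "enn2real (P (\<lambda>x. ennreal (u x)) x) + enn2real (P (\<lambda>x. ennreal (b x)) x)
        = enn2real (P (\<lambda>x. ennreal (a x)) x) + enn2real (P (\<lambda>x. ennreal (- u x)) x)"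
      using elim(4-7) by (simp only: enn2real_plus infinity_ennreal_def)
    then show ?case by (simp add: real_op_def)
  qed
qed

lemma real_op_cong:
  assumes [measurable]: "u \<in> borel_measurable M" "v \<in> borel_measurable M" and eq: "AE x in M. u x = v x"
  shows "AE x in M. real_op u x = real_op v x"
proof -
  have "AE x in M. P (\<lambda>x. ennreal (u x)) x = P (\<lambda>x. ennreal (v x)) x"
    by (rule AE_cong) (use eq in auto)
  moreover have "AE x in M. P (\<lambda>x. ennreal (- u x)) x = P (\<lambda>x. ennreal (- v x)) x"
    by (rule AE_cong) (use eq in auto)
  ultimately show ?thesis by eventually_elim (simp add: real_op_def)
qed

text \<open>The sum of the positive parts minus the sum of the negative parts represents
  \<open>u + v\<close>, though these are generally not the parts of \<open>u + v\<close>;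
  independence of the representation closes the gap.\<close>

lemma real_op_add:
  assumes [measurable]: "u \<in> borel_measurable M" "v \<in> borel_measurable M"
    and fin: "AE x in M. P (\<lambda>x. ennreal \<bar>u x\<bar>) x < \<infinity>" "AE x in M. P (\<lambda>x. ennreal \<bar>v x\<bar>) x < \<infinity>"
  shows "AE x in M. real_op (\<lambda>x. u x + v x) x = real_op u x + real_op v x"
proof -
  have fu: "AE x in M. P (\<lambda>x. ennreal (u x)) x < \<infinity>" "AE x in M. P (\<lambda>x. ennreal (- u x)) x < \<infinity>"
    by (rule finite_mono[OF _ _ fin(1)]; auto intro!: ennreal_leI)+
  have fv: "AE x in M. P (\<lambda>x. ennreal (v x)) x < \<infinity>" "AE x in M. P (\<lambda>x. ennreal (- v x)) x < \<infinity>"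
    by (rule finite_mono[OF _ _ fin(2)]; auto intro!: ennreal_leI)+
  define a where "a x = max 0 (u x) + max 0 (v x)" for x
  define b where "b x = max 0 (- u x) + max 0 (- v x)" for x
  have [measurable]: "a \<in> borel_measurable M" "b \<in> borel_measurable M" unfolding a_def[abs_def] b_def[abs_def] by measurable
  have e: "ennreal (max 0 r + max 0 s) = ennreal r + ennreal s" for r s
    by (simp add: max_def ennreal_neg)
  have a: "AE x in M. P (\<lambda>x. ennreal (a x)) x = P (\<lambda>x. ennreal (u x)) x + P (\<lambda>x. ennreal (v x)) x"
    unfolding a_def e by (rule add) measurable
  have b: "AE x in M. P (\<lambda>x. ennreal (b x)) x = P (\<lambda>x. ennreal (- u x)) x + P (\<lambda>x. ennreal (- v x)) x"
    unfolding b_def e by (rule add) measurable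
  have "AE x in M. real_op (\<lambda>x. u x + v x) x = enn2real (P (\<lambda>x. ennreal (a x)) x) - enn2real (P (\<lambda>x. ennreal (b x)) x)"
  proof (rule real_op_diff)
    show "AE x in M. P (\<lambda>x. ennreal (a x)) x < \<infinity>" using a fu(1) fv(1) by eventually_elim simp
    show "AE x in M. P (\<lambda>x. ennreal (b x)) x < \<infinity>" using b fu(2) fv(2) by eventually_elim simp
    show "AE x in M. u x + v x = a x - b x" by (rule AE_I2) (auto simp: a_def b_def max_def)
  qed (auto simp: a_def b_def)
  then show ?thesis using a b fu fv
    by eventually_elim (simp add: real_op_def enn2real_plus)
qed

lemma real_op_uminus: "real_op (\<lambda>x. - u x) x = - real_op u x"
  by (simp add: real_op_def)

lemma real_op_scale:
  assumes [measurable]: "u \<in> borel_measurable M"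
  shows "AE x in M. real_op (\<lambda>x. c * u x) x = c * real_op u x"
proof -
  have pos: "AE x in M. real_op (\<lambda>x. c * u x) x = c * real_op u x" if c: "0 \<le> c" for c
  proof -
    have "AE x in M. P (\<lambda>x. ennreal c * ennreal (u x)) x = ennreal c * P (\<lambda>x. ennreal (u x)) x"
      by (rule cmult) (use c in auto)
    moreover have "AE x in M. P (\<lambda>x. ennreal c * ennreal (- u x)) x = ennreal c * P (\<lambda>x. ennreal (- u x)) x"
      by (rule cmult) (use c in auto)
    moreover have "ennreal (c * r) = ennreal c * ennreal r" for r using c by (rule ennreal_mult')
    moreover have "ennreal (- (c * r)) = ennreal c * ennreal (- r)" for r
      using ennreal_mult'[OF c, of "- r"] by simp
    ultimately show ?thesis
      by (auto elim!: eventually_elim2 simp: real_op_def enn2real_mult c right_diff_distrib)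
  qed
  show ?thesis
  proof (cases "0 \<le> c")
    case False
    have "AE x in M. real_op (\<lambda>x. (- c) * u x) x = (- c) * real_op u x" by (rule pos) (use False in auto)
    then show ?thesis using real_op_uminus[of "\<lambda>x. c * u x"] by simp
  qed (rule pos)
qed

lemma complex_op_measurable [measurable]:
  assumes [measurable]: "f \<in> borel_measurable M"
  shows "complex_op f \<in> borel_measurable M"
proof -
  have "(\<lambda>x. complex_of_real (real_op (\<lambda>x. Re (f x)) x) + \<i> * complex_of_real (real_op (\<lambda>x. Im (f x)) x)) \<in> borel_measurable M"
    by measurable
  also have "(\<lambda>x. complex_of_real (real_op (\<lambda>x. Re (f x)) x) + \<i> * complex_of_real (real_op (\<lambda>x. Im (f x)) x)) = complex_op f"
    by (simp add: complex_op_def fun_eq_iff complex_eq_iff)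
  finally show ?thesis .
qed

lemma complex_op_cong:
  assumes [measurable]: "f \<in> borel_measurable M" "g \<in> borel_measurable M" and eq: "AE x in M. f x = g x"
  shows "AE x in M. complex_op f x = complex_op g x"
proof -
  have "AE x in M. real_op (\<lambda>x. Re (f x)) x = real_op (\<lambda>x. Re (g x)) x"
    by (rule real_op_cong) (use eq in auto)
  moreover have "AE x in M. real_op (\<lambda>x. Im (f x)) x = real_op (\<lambda>x. Im (g x)) x"
    by (rule real_op_cong) (use eq in auto)
  ultimately show ?thesis by eventually_elim (simp add: complex_op_def)
qed

lemma finite_Re_Im:
  assumes [measurable]: "f \<in> borel_measurable M" and fin: "AE x in M. P (\<lambda>x. ennreal (norm (f x))) x < \<infinity>"
  shows "AE x in M. P (\<lambda>x. ennreal \<bar>Re (f x)\<bar>) x < \<infinity>" "AE x in M. P (\<lambda>x. ennreal \<bar>Im (f x)\<bar>) x < \<infinity>"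
proof -
  show "AE x in M. P (\<lambda>x. ennreal \<bar>Re (f x)\<bar>) x < \<infinity>"
    by (rule finite_mono[OF _ _ fin]) (auto intro!: AE_I2 abs_Re_le_cmod)
  show "AE x in M. P (\<lambda>x. ennreal \<bar>Im (f x)\<bar>) x < \<infinity>"
    by (rule finite_mono[OF _ _ fin]) (auto intro!: AE_I2 abs_Im_le_cmod)
qed

lemma complex_op_add:
  assumes [measurable]: "f \<in> borel_measurable M" "g \<in> borel_measurable M"
    and fin: "AE x in M. P (\<lambda>x. ennreal (norm (f x))) x < \<infinity>" "AE x in M. P (\<lambda>x. ennreal (norm (g x))) x < \<infinity>"
  shows "AE x in M. complex_op (\<lambda>x. f x + g x) x = complex_op f x + complex_op g x"
proof -
  have "AE x in M. real_op (\<lambda>x. Re (f x) + Re (g x)) x = real_op (\<lambda>x. Re (f x)) x + real_op (\<lambda>x. Re (g x)) x"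
    by (rule real_op_add) (use finite_Re_Im assms in auto)
  moreover have "AE x in M. real_op (\<lambda>x. Im (f x) + Im (g x)) x = real_op (\<lambda>x. Im (f x)) x + real_op (\<lambda>x. Im (g x)) x"
    by (rule real_op_add) (use finite_Re_Im assms in auto)
  ultimately show ?thesis by eventually_elim (simp add: complex_op_def complex_eq_iff)
qed

lemma complex_op_scale:
  assumes [measurable]: "f \<in> borel_measurable M" and fin: "AE x in M. P (\<lambda>x. ennreal (norm (f x))) x < \<infinity>"
  shows "AE x in M. complex_op (\<lambda>x. c * f x) x = c * complex_op f x"
proof -
  have comb: "AE x in M. real_op (\<lambda>x. a * u x + b * v x) x = a * real_op u x + b * real_op v x"
    if [measurable]: "u \<in> borel_measurable M" "v \<in> borel_measurable M" and 
      fin: "AE x in M. P (\<lambda>x. ennreal \<bar>u x\<bar>) x < \<infinity>" "AE x in M. P (\<lambda>x. ennreal \<bar>v x\<bar>) x < \<infinity>"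
    for u v :: "'a \<Rightarrow> real" and a b :: real
  proof -
    have fin': "AE x in M. P (\<lambda>x. ennreal \<bar>c * w x\<bar>) x < \<infinity>"
      if [measurable]: "w \<in> borel_measurable M" and *: "AE x in M. P (\<lambda>x. ennreal \<bar>w x\<bar>) x < \<infinity>" for w :: "'a \<Rightarrow> real" and c
    proof -
      have "AE x in M. P (\<lambda>x. ennreal \<bar>c\<bar> * ennreal \<bar>w x\<bar>) x = ennreal \<bar>c\<bar> * P (\<lambda>x. ennreal \<bar>w x\<bar>) x"
        by (rule cmult) auto
      with * show ?thesis by eventually_elim (simp add: abs_mult ennreal_mult ennreal_mult_less_top)
    qed
    have "AE x in M. real_op (\<lambda>x. a * u x + b * v x) x = real_op (\<lambda>x. a * u x) x + real_op (\<lambda>x. b * v x) x"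
      by (rule real_op_add) (use fin' fin in auto)
    with real_op_scale[OF that(1), of a] real_op_scale[OF that(2), of b] show ?thesis
      by eventually_elim simp
  qed
  note F = finite_Re_Im[OF assms]
  have "AE x in M. real_op (\<lambda>x. Re c * Re (f x) + (- Im c) * Im (f x)) x
      = Re c * real_op (\<lambda>x. Re (f x)) x + (- Im c) * real_op (\<lambda>x. Im (f x)) x"
    by (rule comb) (use F in auto)
  moreover have "AE x in M. real_op (\<lambda>x. Re c * Im (f x) + Im c * Re (f x)) x
      = Re c * real_op (\<lambda>x. Im (f x)) x + Im c * real_op (\<lambda>x. Re (f x)) x"
    by (rule comb) (use F in auto)
  ultimately show ?thesis by eventually_elim (simp add: complex_op_def complex_eq_iff)
qed

text \<open>Complex linearity turns the real part of \<open>c\<close> times the image of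
  \<open>f\<close> into the image of \<open>Re (c * f)\<close>, which is at most the image of
  \<open>|f|\<close>. Letting \<open>c\<close> run through countably many phases recovers the
  modulus.\<close>

lemma norm_complex_op_le:
  assumes [measurable]: "f \<in> borel_measurable M" and fin: "AE x in M. P (\<lambda>x. ennreal (norm (f x))) x < \<infinity>"
  shows "AE x in M. norm (complex_op f x) \<le> enn2real (P (\<lambda>x. ennreal (norm (f x))) x)"
proof -
  obtain D :: "complex set" where cD: "countable D" and D1: "\<And>d. d \<in> D \<Longrightarrow> norm d \<le> 1"
    and D: "\<And>z e. norm z \<le> 1 \<Longrightarrow> 0 < e \<Longrightarrow> \<exists>d\<in>D. norm (d - z) < e"
    using countable_dense_unit_disc by metis
  have le: "AE x in M. Re (c * complex_op f x) \<le> enn2real (P (\<lambda>x. ennreal (norm (f x))) x)" if c: "norm c \<le> 1" for c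
  proof -
    have le: "Re (c * f x) \<le> norm (f x)" for x
    proof -
      have "Re (c * f x) \<le> norm (c * f x)" by (rule complex_Re_le_cmod)
      also have "\<dots> \<le> norm (f x)" using c by (simp add: norm_mult mult_left_le_one_le)
      finally show ?thesis .
    qed
    have "AE x in M. P (\<lambda>x. ennreal (Re (c * f x))) x \<le> P (\<lambda>x. ennreal (norm (f x))) x"
      by (rule mono) (auto intro!: ennreal_leI le simp del: times_complex.sel)
    with complex_op_scale[OF assms, of c] fin show ?thesis
    proof eventually_elim
      case (elim x)
      have "Re (c * complex_op f x) = Re (complex_op (\<lambda>x. c * f x) x)" by (simp only: elim(1))
      also have "\<dots> = real_op (\<lambda>x. Re (c * f x)) x" by (simp only: complex_op_def complex.sel)
      also have "\<dots> \<le> enn2real (P (\<lambda>x. ennreal (Re (c * f x))) x)"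
        by (simp add: real_op_def del: times_complex.sel)
      also have "\<dots> \<le> enn2real (P (\<lambda>x. ennreal (norm (f x))) x)"
        using elim by (intro enn2real_mono) auto
      finally show ?case .
    qed
  qed
  have "AE x in M. \<forall>c\<in>D. Re (c * complex_op f x) \<le> enn2real (P (\<lambda>x. ennreal (norm (f x))) x)"
    by (subst AE_ball_countable[OF cD]) (use le D1 in auto)
  then show ?thesis
  proof eventually_elim
    case (elim x)
    let ?z = "complex_op f x"
    show ?case
    proof (rule field_le_epsilon)
      fix e :: real assume e: "0 < e"
      from sum_list_norm_dual[of D e "[?z]", OF D e] obtain c where "c \<in> D" "norm ?z \<le> Re (c * ?z) + e"
        by (auto simp: length_Suc_conv simp del: times_complex.sel)
      with elim show "norm ?z \<le> enn2real (P (\<lambda>x. ennreal (norm (f x))) x) + e" by fastforce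
    qed
  qed
qed

end

context positive_contraction
begin

text \<open>This makes the real-valued operators faithful on \<open>L^p\<close>:
  \<open>enn2real\<close> sends infinity to 0 and would destroy additivity there.\<close>

lemma finite_Lp:
  assumes "1 \<le> p" "f \<in> Lp_space M p"
  shows "AE x in M. P (\<lambda>x. ennreal (norm (f x))) x < \<infinity>"
proof (cases "p = \<infinity>")
  case True
  then obtain c where "0 \<le> c" "AE x in M. norm (f x) \<le> c" "f \<in> borel_measurable M"
    using assms Linf_space_iff by blast
  then have "AE x in M. P (\<lambda>x. ennreal (norm (f x))) x \<le> ennreal c"
    by (intro Linf) (auto elim!: eventually_mono intro: ennreal_leI)
  then show ?thesis by eventually_elim (auto intro: le_less_trans)
next
  case False
  then have p: "p < \<infinity>" by (simp add: less_top)
  have [measurable]: "f \<in> borel_measurable M" using assms by (auto simp: Lp_space_def)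
  have "powr_integral M (enn2real p) f < \<infinity>" using assms p by (simp add: Lp_space_iff)
  from powr_le[of "\<lambda>x. norm (f x)", OF _ _ enn2real_ge_1[OF assms(1) p]] this
  have "AE x in M. P (\<lambda>x. ennreal (norm (f x))) x < \<infinity> \<and>
    ennreal (enn2real (P (\<lambda>x. ennreal (norm (f x))) x) powr enn2real p) \<le> P (\<lambda>x. ennreal (norm (f x) powr enn2real p)) x"
    by (simp add: powr_integral_def)
  then show ?thesis by eventually_elim simp
qed

lemma powr_integral_enn2real_le:
  assumes p: "1 \<le> p" "p < \<infinity>" and f: "f \<in> Lp_space M p"
  shows "(\<integral>\<^sup>+x. ennreal (enn2real (P (\<lambda>x. ennreal (norm (f x))) x) powr enn2real p) \<partial>M) \<le> powr_integral M (enn2real p) f"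
proof -
  have [measurable]: "f \<in> borel_measurable M" using f by (auto simp: Lp_space_def)
  have "powr_integral M (enn2real p) f < \<infinity>" using f p by (simp add: Lp_space_iff)
  from nn_integral_powr_le[of "\<lambda>x. norm (f x)", OF _ _ enn2real_ge_1[OF p]] this
  show ?thesis by (simp add: powr_integral_def)
qed

text \<open>Pointwise domination by the positive operator already yields membership in
  \<open>L^p\<close> and the norm bound. It serves both the complexified operator and the extension
  of a dominated operator.\<close>

lemma Lp_of_norm_le:
  assumes p: "1 \<le> p" "p < \<infinity>" and f: "f \<in> Lp_space M p" and g: "g \<in> borel_measurable M"
    and le: "AE x in M. norm (g x) \<le> enn2real (P (\<lambda>x. ennreal (norm (f x))) x)"
  shows "g \<in> Lp_space M p" "Lp_norm M p g \<le> Lp_norm M p f"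
proof -
  have "powr_integral M (enn2real p) g \<le> (\<integral>\<^sup>+x. ennreal (enn2real (P (\<lambda>x. ennreal (norm (f x))) x) powr enn2real p) \<partial>M)"
    unfolding powr_integral_def using enn2real_ge_1[OF p]
    by (intro nn_integral_mono_AE) (use le in \<open>auto elim!: eventually_mono intro!: ennreal_leI powr_mono2\<close>)
  also have "\<dots> \<le> powr_integral M (enn2real p) f" by (rule powr_integral_enn2real_le) fact+
  finally have *: "powr_integral M (enn2real p) g \<le> powr_integral M (enn2real p) f" .
  moreover have "powr_integral M (enn2real p) f < \<infinity>" using f p by (simp add: Lp_space_iff)
  ultimately show "g \<in> Lp_space M p" using g p by (auto simp: Lp_space_iff)
  with * f p show "Lp_norm M p g \<le> Lp_norm M p f" by (simp add: Lp_norm_le_iff)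
qed

lemma complex_op_Lp:
  assumes p: "1 \<le> p" and f: "f \<in> Lp_space M p"
  shows "complex_op f \<in> Lp_space M p" "Lp_norm M p (complex_op f) \<le> Lp_norm M p f"
proof -
  have [measurable]: "f \<in> borel_measurable M" using f by (auto simp: Lp_space_def)
  have le: "AE x in M. norm (complex_op f x) \<le> enn2real (P (\<lambda>x. ennreal (norm (f x))) x)"
    by (rule norm_complex_op_le) (use finite_Lp[OF assms] in auto)
  have "complex_op f \<in> Lp_space M p \<and> Lp_norm M p (complex_op f) \<le> Lp_norm M p f"
  proof (cases "p = \<infinity>")
    case True
    have bound: "AE x in M. norm (complex_op f x) \<le> c" if c: "0 \<le> c" "AE x in M. norm (f x) \<le> c" for c
    proof -
      have "AE x in M. P (\<lambda>x. ennreal (norm (f x))) x \<le> ennreal c"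
        by (rule Linf) (use c in \<open>auto elim!: eventually_mono intro: ennreal_leI\<close>)
      with le show ?thesis by eventually_elim (use c in \<open>auto elim!: order_trans intro: enn2real_leI\<close>)
    qed
    have "complex_op f \<in> Lp_space M \<infinity>" using f bound unfolding True Linf_space_iff by auto
    then show ?thesis using f bound unfolding True by (intro conjI Linf_norm_leI) auto
  next
    case False
    then show ?thesis using Lp_of_norm_le[OF p _ f _ le] by (simp add: less_top)
  qed
  then show "complex_op f \<in> Lp_space M p" "Lp_norm M p (complex_op f) \<le> Lp_norm M p f" by auto
qed

lemma Lp_contraction_complex_op:
  assumes p: "1 \<le> p" "p < \<infinity>"
  shows "Lp_contraction M p complex_op"
  unfolding Lp_contraction_def Lp_linear_def
proof (intro conjI ballI allI impI)
  fix f g c assume f: "f \<in> Lp_space M p"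
  note fm = Lp_space_measurable[OF f]
  show "complex_op f \<in> Lp_space M p" "Lp_norm M p (complex_op f) \<le> Lp_norm M p f"
    by (rule complex_op_Lp[OF p(1) f])+
  show "AE x in M. complex_op (\<lambda>y. c * f y) x = c * complex_op f x"
    by (rule complex_op_scale[OF fm finite_Lp[OF p(1) f]])
  assume g: "g \<in> Lp_space M p"
  note gm = Lp_space_measurable[OF g]
  show "AE x in M. complex_op f x = complex_op g x" if "AE x in M. f x = g x"
    by (rule complex_op_cong[OF fm gm that])
  show "AE x in M. complex_op (\<lambda>y. f y + g y) x = complex_op f x + complex_op g x"
    by (rule complex_op_add[OF fm gm finite_Lp[OF p(1) f] finite_Lp[OF p(1) g]])
qed

lemma real_op_nonneg_eq:
  assumes [measurable]: "u \<in> borel_measurable M" and "AE x in M. 0 \<le> u x"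
  shows "AE x in M. real_op u x = enn2real (P (\<lambda>x. ennreal (u x)) x)"
proof -
  have "AE x in M. P (\<lambda>x. ennreal (- u x)) x = P (\<lambda>_. 0) x"
    by (rule AE_cong) (use assms(2) in \<open>auto elim!: eventually_mono simp: ennreal_neg\<close>)
  with zero show ?thesis by eventually_elim (simp add: real_op_def)
qed

lemma complex_op_nonneg_eq:
  assumes [measurable]: "f \<in> borel_measurable M" and f: "AE x in M. 0 \<le> f x"
  shows "AE x in M. complex_op f x = complex_of_real (enn2real (P (\<lambda>x. ennreal (norm (f x))) x))"
proof -
  have "AE x in M. real_op (\<lambda>x. Re (f x)) x = enn2real (P (\<lambda>x. ennreal (Re (f x))) x)"
    by (rule real_op_nonneg_eq) (use f in \<open>auto elim!: eventually_mono simp: less_eq_complex_def\<close>)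
  moreover have "AE x in M. real_op (\<lambda>x. Im (f x)) x = real_op (\<lambda>_. 0) x"
    by (rule real_op_cong) (use f in \<open>auto elim!: eventually_mono simp: less_eq_complex_def\<close>)
  moreover have "AE x in M. P (\<lambda>x. ennreal (Re (f x))) x = P (\<lambda>x. ennreal (norm (f x))) x"
  proof (rule AE_cong)
    show "AE x in M. ennreal (Re (f x)) = ennreal (norm (f x))"
      using f by eventually_elim (simp add: less_eq_complex_def cmod_eq_Re)
  qed measurable
  ultimately show ?thesis
    by eventually_elim (simp add: complex_op_def complex_eq_iff real_op_def)
qed

lemma Lp_positive_complex_op: "Lp_positive M p complex_op"
  unfolding Lp_positive_def
proof (intro ballI impI)
  fix f assume "f \<in> Lp_space M p" "AE x in M. 0 \<le> f x"
  from complex_op_nonneg_eq[OF Lp_space_measurable[OF this(1)] this(2)]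
  show "AE x in M. 0 \<le> complex_op f x" by eventually_elim (simp add: less_eq_complex_def)
qed

end

text \<open>The images under \<open>Q\<close> of the positive and negative part of \<open>u\<close>
  are usually not the positive and negative part of its real image, so \<open>P\<close> is evaluated
  by \<open>real_op_diff\<close> on that other representation. The separate \<open>R\<close> allows
  a composition law valid only almost everywhere.\<close>

lemma complex_op_comp:
  assumes P: "positive_contraction M P" and Q: "positive_contraction M Q"
    and R: "positive_contraction M R" and R_eq: "\<And>g. g \<in> borel_measurable M \<Longrightarrow> AE x in M. R g x = P (Q g) x"
    and f: "f \<in> borel_measurable M"
    and fin: "AE x in M. Q (\<lambda>x. ennreal (norm (f x))) x < \<infinity>" "AE x in M. R (\<lambda>x. ennreal (norm (f x))) x < \<infinity>"
  shows "AE x in M. positive_contraction.complex_op R f x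
    = positive_contraction.complex_op P (positive_contraction.complex_op Q f) x"
proof -
  interpret P: positive_contraction M P by fact
  interpret Q: positive_contraction M Q by fact
  interpret R: positive_contraction M R by fact
  interpret PQ: positive_contraction M "\<lambda>f. P (Q f)" by (rule positive_contraction_comp[OF P Q])
  note [measurable] = f P.measurable_op Q.measurable_op
  have R': "AE x in M. P (Q (\<lambda>x. ennreal (norm (f x)))) x < \<infinity>"
    using fin(2) R_eq[of "\<lambda>x. ennreal (norm (f x))"] by (auto elim: eventually_elim2)
  have real: "AE x in M. enn2real (R (\<lambda>x. ennreal (u x)) x) - enn2real (R (\<lambda>x. ennreal (- u x)) x) = P.real_op (Q.real_op u) x"
    if [measurable]: "u \<in> borel_measurable M" and le: "\<And>x. \<bar>u x\<bar> \<le> norm (f x)" for u :: "'a \<Rightarrow> real"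
  proof -
    have fin_part: "AE x in M. Q (\<lambda>x. ennreal (v x)) x < \<infinity>"
        "AE x in M. P (\<lambda>x. ennreal (enn2real (Q (\<lambda>x. ennreal (v x)) x))) x = P (Q (\<lambda>x. ennreal (v x))) x"
        "AE x in M. P (Q (\<lambda>x. ennreal (v x))) x < \<infinity>"
      if [measurable]: "v \<in> borel_measurable M" and vle: "\<And>x. v x \<le> norm (f x)" for v :: "'a \<Rightarrow> real"
    proof -
      show 1: "AE x in M. Q (\<lambda>x. ennreal (v x)) x < \<infinity>"
        by (rule Q.finite_mono[OF _ _ fin(1)]) (use vle in \<open>auto intro: ennreal_leI\<close>)
      show "AE x in M. P (\<lambda>x. ennreal (enn2real (Q (\<lambda>x. ennreal (v x)) x))) x = P (Q (\<lambda>x. ennreal (v x))) x"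
        by (rule P.AE_cong) (use 1 in auto)
      show "AE x in M. P (Q (\<lambda>x. ennreal (v x))) x < \<infinity>"
        by (rule PQ.finite_mono[OF _ _ R']) (use vle in \<open>auto intro: ennreal_leI\<close>)
    qed
    have ule: "u x \<le> norm (f x)" "- u x \<le> norm (f x)" for x using le[of x] by auto
    note F = fin_part[of u, OF _ ule(1)] fin_part[of "\<lambda>x. - u x", OF _ ule(2)]
    have "AE x in M. P.real_op (Q.real_op u) x
      = enn2real (P (\<lambda>x. ennreal (enn2real (Q (\<lambda>x. ennreal (u x)) x))) x)
        - enn2real (P (\<lambda>x. ennreal (enn2real (Q (\<lambda>x. ennreal (- u x)) x))) x)"
    proof (rule P.real_op_diff)
      show "AE x in M. P (\<lambda>x. ennreal (enn2real (Q (\<lambda>x. ennreal (u x)) x))) x < \<infinity>"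
        using F(2,3) by (auto elim: eventually_elim2)
      show "AE x in M. P (\<lambda>x. ennreal (enn2real (Q (\<lambda>x. ennreal (- u x)) x))) x < \<infinity>"
        using F(5,6) by (auto elim: eventually_elim2)
      show "AE x in M. Q.real_op u x = enn2real (Q (\<lambda>x. ennreal (u x)) x) - enn2real (Q (\<lambda>x. ennreal (- u x)) x)"
        by (simp add: Q.real_op_def)
    qed auto
    moreover have "AE x in M. R (\<lambda>x. ennreal (u x)) x = P (Q (\<lambda>x. ennreal (u x))) x" by (rule R_eq) measurable
    moreover have "AE x in M. R (\<lambda>x. ennreal (- u x)) x = P (Q (\<lambda>x. ennreal (- u x))) x" by (rule R_eq) measurable
    moreover have "AE x in M. P (\<lambda>x. ennreal (enn2real (Q (\<lambda>x. ennreal (u x)) x))) x = P (Q (\<lambda>x. ennreal (u x))) x"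
      by (rule F(2)) measurable
    moreover have "AE x in M. P (\<lambda>x. ennreal (enn2real (Q (\<lambda>x. ennreal (- u x)) x))) x = P (Q (\<lambda>x. ennreal (- u x))) x"
      by (rule F(5)) measurable
    ultimately show ?thesis by eventually_elim simp
  qed
  have Re: "(\<lambda>x. Re (Q.complex_op f x)) = Q.real_op (\<lambda>x. Re (f x))"
    and Im: "(\<lambda>x. Im (Q.complex_op f x)) = Q.real_op (\<lambda>x. Im (f x))"
    by (simp_all add: Q.complex_op_def)
  have "AE x in M. R.real_op (\<lambda>x. Re (f x)) x = P.real_op (Q.real_op (\<lambda>x. Re (f x))) x"
    unfolding R.real_op_def by (rule real) (auto intro: abs_Re_le_cmod)
  moreover have "AE x in M. R.real_op (\<lambda>x. Im (f x)) x = P.real_op (Q.real_op (\<lambda>x. Im (f x))) x"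
    unfolding R.real_op_def by (rule real) (auto intro: abs_Im_le_cmod)
  ultimately show ?thesis
    unfolding R.complex_op_def P.complex_op_def Re Im by eventually_elim simp
qed

section \<open>Uniqueness and existence of extensions to \<open>L^p\<close>\<close>

lemma Lp_contractionD:
  assumes "Lp_contraction M p B" "f \<in> Lp_space M p"
  shows "B f \<in> Lp_space M p" "Lp_norm M p (B f) \<le> Lp_norm M p f"
    "g \<in> Lp_space M p \<Longrightarrow> AE x in M. f x = g x \<Longrightarrow> AE x in M. B f x = B g x"
    "g \<in> Lp_space M p \<Longrightarrow> AE x in M. B (\<lambda>y. f y + g y) x = B f x + B g x"
    "AE x in M. B (\<lambda>y. c * f y) x = c * B f x"
  using assms unfolding Lp_contraction_def Lp_linear_def by blast+

lemma Lp_contraction_diff: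
  assumes p: "1 \<le> p" "p < \<infinity>" and B: "Lp_contraction M p B" and f: "f \<in> Lp_space M p" and g: "g \<in> Lp_space M p"
  shows "AE x in M. B (\<lambda>x. f x - g x) x = B f x - B g x"
    "powr_integral M (enn2real p) (\<lambda>x. B f x - B g x) \<le> powr_integral M (enn2real p) (\<lambda>x. f x - g x)"
proof -
  note g' = Lp_space_scale[OF p(2) g, of "-1"]
  show *: "AE x in M. B (\<lambda>x. f x - g x) x = B f x - B g x"
    using Lp_contractionD(4)[OF B f g'] Lp_contractionD(5)[OF B g, of "-1"]
    by (auto elim: eventually_elim2)
  note d = Lp_space_diff[OF p(2) f g]
  have "powr_integral M (enn2real p) (B (\<lambda>x. f x - g x)) \<le> powr_integral M (enn2real p) (\<lambda>x. f x - g x)"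
    using Lp_norm_le_iff[OF p Lp_contractionD(1)[OF B d] d] Lp_contractionD(2)[OF B d] by simp
  then show "powr_integral M (enn2real p) (\<lambda>x. B f x - B g x) \<le> powr_integral M (enn2real p) (\<lambda>x. f x - g x)"
    using powr_integral_cong[OF *] by simp
qed

text \<open>Cutoffs of \<open>f\<close> lie in the core and converge to \<open>f\<close> in
  \<open>L^p\<close>; both contractions transport this convergence and agree along the
  cutoffs.\<close>

lemma (in sigma_finite_measure) Lp_contraction_unique:
  assumes p: "1 \<le> p" "p < \<infinity>" and B: "Lp_contraction M p B" and B': "Lp_contraction M p B'"
    and eq: "\<And>f. f \<in> L1_Linf M \<Longrightarrow> AE x in M. B f x = B' f x" and f: "f \<in> Lp_space M p"
  shows "AE x in M. B f x = B' f x"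
proof -
  let ?q = "enn2real p"
  have q: "1 \<le> ?q" using enn2real_ge_1[OF p] .
  note fm [measurable] = Lp_space_measurable[OF f]
  define F where "F n = cutoff n f" for n
  have FV: "F n \<in> L1_Linf M" for n unfolding F_def by (rule cutoff_L1_Linf[OF fm])
  have FL: "F n \<in> Lp_space M p" for n by (rule L1_Linf_subset_Lp[OF p(1) FV])
  note [measurable] = Lp_contractionD(1)[OF B f, THEN Lp_space_measurable] Lp_contractionD(1)[OF B' f, THEN Lp_space_measurable]
    Lp_contractionD(1)[OF B FL, THEN Lp_space_measurable] Lp_contractionD(1)[OF B' FL, THEN Lp_space_measurable]
  have le: "powr_integral M ?q (\<lambda>x. B f x - B' f x)
      \<le> ennreal (2 powr ?q) * (powr_integral M ?q (\<lambda>x. F n x - f x) + powr_integral M ?q (\<lambda>x. F n x - f x))" for n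
  proof -
    have "powr_integral M ?q (\<lambda>x. B f x - B' f x) = powr_integral M ?q (\<lambda>x. (B' (F n) x - B' f x) + - 1 * (B (F n) x - B f x))"
      by (rule powr_integral_cong) (use eq[OF FV[of n]] in \<open>auto elim!: eventually_mono\<close>)
    also have "\<dots> \<le> ennreal (2 powr ?q) * (powr_integral M ?q (\<lambda>x. B' (F n) x - B' f x)
        + powr_integral M ?q (\<lambda>x. - 1 * (B (F n) x - B f x)))"
      by (rule powr_integral_add_le) (use q in auto)
    also have "powr_integral M ?q (\<lambda>x. - 1 * (B (F n) x - B f x)) = powr_integral M ?q (\<lambda>x. B (F n) x - B f x)"
      by (subst powr_integral_scale) auto
    also have "ennreal (2 powr ?q) * (powr_integral M ?q (\<lambda>x. B' (F n) x - B' f x) + powr_integral M ?q (\<lambda>x. B (F n) x - B f x))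
      \<le> ennreal (2 powr ?q) * (powr_integral M ?q (\<lambda>x. F n x - f x) + powr_integral M ?q (\<lambda>x. F n x - f x))"
      by (intro mult_left_mono add_mono Lp_contraction_diff(2)[OF p] B B' FL f) simp
    finally show ?thesis .
  qed
  have "(\<lambda>n. powr_integral M ?q (\<lambda>x. F n x - f x)) \<longlonglongrightarrow> 0"
    unfolding F_def by (rule powr_integral_cutoff) (use q f p in \<open>auto simp: Lp_space_iff\<close>)
  then have "(\<lambda>n. ennreal (2 powr ?q) * (powr_integral M ?q (\<lambda>x. F n x - f x) + powr_integral M ?q (\<lambda>x. F n x - f x)))
      \<longlonglongrightarrow> ennreal (2 powr ?q) * (0 + 0)"
    by (intro ennreal_tendsto_cmult tendsto_add) auto
  then have "powr_integral M ?q (\<lambda>x. B f x - B' f x) \<le> ennreal (2 powr ?q) * (0 + 0)"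
    by (rule LIMSEQ_le_const) (use le in auto)
  then have "powr_integral M ?q (\<lambda>x. B f x - B' f x) = 0" by simp
  then show ?thesis using q by (simp add: powr_integral_def nn_integral_0_iff_AE)
qed

lemma Lp_extension_spec:
  assumes "Lp_contraction M p B" "\<And>f. f \<in> Lp_space M 2 \<inter> Lp_space M p \<Longrightarrow> AE x in M. B f x = A f x"
  shows "Lp_contraction M p (Lp_extension M p A)"
    "f \<in> Lp_space M 2 \<inter> Lp_space M p \<Longrightarrow> AE x in M. Lp_extension M p A f x = A f x"
proof -
  have "\<exists>B. Lp_contraction M p B \<and> (\<forall>f\<in>Lp_space M 2 \<inter> Lp_space M p. AE x in M. B f x = A f x)"
    using assms by blast
  from someI_ex[OF this, folded Lp_extension_def]
  show "Lp_contraction M p (Lp_extension M p A)"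
    "f \<in> Lp_space M 2 \<inter> Lp_space M p \<Longrightarrow> AE x in M. Lp_extension M p A f x = A f x" by auto
qed

text \<open>Exhibiting one contraction with the right values on \<open>L^2 \<inter> L^p\<close>
  identifies the choice made in \<open>Lp_extension\<close> up to null sets; every later statement
  about extensions goes through such a candidate.\<close>

lemma (in sigma_finite_measure) Lp_extension_unique:
  assumes p: "1 \<le> p" "p < \<infinity>" and B: "Lp_contraction M p B"
    and eq: "\<And>f. f \<in> Lp_space M 2 \<inter> Lp_space M p \<Longrightarrow> AE x in M. B f x = A f x" and f: "f \<in> Lp_space M p"
  shows "AE x in M. Lp_extension M p A f x = B f x"
proof (rule Lp_contraction_unique[OF p Lp_extension_spec(1)[OF B eq] B _ f])
  fix g assume "g \<in> L1_Linf M"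
  then have "g \<in> Lp_space M 2 \<inter> Lp_space M p" using p L1_Linf_subset_Lp[of _ g M] by auto
  from Lp_extension_spec(2)[OF B eq this] eq[OF this]
  show "AE x in M. Lp_extension M p A g x = B g x" by (auto elim: eventually_elim2)
qed

lemma Cauchy_ennreal_majorant:
  fixes a :: "nat \<Rightarrow> complex"
  assumes le: "\<And>l k. l \<le> k \<Longrightarrow> ennreal (norm (a k - a l)) \<le> e l" and lim: "e \<longlonglongrightarrow> 0"
  shows "convergent a"
proof -
  have "Cauchy a"
    unfolding Cauchy_altdef2
  proof (intro allI impI)
    fix \<epsilon> :: real assume \<epsilon>: "0 < \<epsilon>"
    have "\<forall>\<^sub>F l in sequentially. e l < ennreal \<epsilon>" using lim \<epsilon> by (intro order_tendstoD) auto
    then obtain N where "e N < ennreal \<epsilon>" by (auto simp: eventually_sequentially)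
    then have "dist (a n) (a N) < \<epsilon>" if "n \<ge> N" for n
      using le[OF that] \<epsilon> by (auto simp: dist_norm ennreal_less_iff dest: le_less_trans)
    then show "\<exists>N. \<forall>n\<ge>N. dist (a n) (a N) < \<epsilon>" by blast
  qed
  then show ?thesis by (simp add: Cauchy_convergent_iff)
qed

text \<open>The extension of \<open>A\<close> to \<open>L\<^sup>p\<close> is the pointwise limit of \<open>A\<close> along cutoffs. It exists because
  \<open>|A f\<^sub>k - A f\<^sub>l|\<close> is dominated by the positive operator applied to \<open>|f - f\<^sub>l|\<close>.\<close>

lemma (in positive_contraction) dominated_extension:
  assumes A: "L1_Linf_contraction M A" and A2: "Lp_contraction M 2 A"
    and dom: "\<And>f. f \<in> L1_Linf M \<Longrightarrow> AE x in M. ennreal (norm (A f x)) \<le> P (\<lambda>x. ennreal (norm (f x))) x"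
    and p: "1 \<le> p" "p < \<infinity>"
  shows "\<exists>B. Lp_contraction M p B \<and> (\<forall>f\<in>Lp_space M 2 \<inter> Lp_space M p. AE x in M. B f x = A f x) \<and>
    (\<forall>f\<in>Lp_space M p. AE x in M. ennreal (norm (B f x)) \<le> P (\<lambda>x. ennreal (norm (f x))) x)"
proof -
  interpret A: L1_Linf_contraction M A by fact
  define B where "B f x = lim (\<lambda>k. A (cutoff k f) x)" for f x
  have V: "cutoff k f \<in> L1_Linf M" if "f \<in> borel_measurable M" for k f using that by (rule cutoff_L1_Linf)
  have norm_fin: "AE x in M. ennreal (norm (h x)) < \<infinity>" for h :: "'a \<Rightarrow> complex" by simp
  have null: "AE x in M. (\<lambda>k. P (\<lambda>x. ennreal (norm (d k x))) x) \<longlonglongrightarrow> 0"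
    if d: "\<And>k::nat. d k \<in> borel_measurable M" and h: "h \<in> Lp_space M p"
      and le: "\<And>k x. norm (d k x) \<le> norm (h x)" and lim: "\<And>x. x \<in> space M \<Longrightarrow> \<forall>\<^sub>F k in sequentially. d k x = 0"
    for d :: "nat \<Rightarrow> 'a \<Rightarrow> complex" and h
  proof (rule dominated_convergence[OF _ _ _ norm_fin finite_Lp[OF p(1) h]])
    note [measurable] = d Lp_space_measurable[OF h]
    show "(\<lambda>x. ennreal (norm (d k x))) \<in> borel_measurable M" for k by measurable
    show "(\<lambda>x. ennreal (norm (h x))) \<in> borel_measurable M" by measurable
    show "AE x in M. ennreal (norm (d k x)) \<le> ennreal (norm (h x))" for k using le by (auto intro: ennreal_leI)
    show "AE x in M. (\<lambda>k. ennreal (norm (d k x))) \<longlonglongrightarrow> 0"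
    proof (intro AE_I2 tendsto_eventually)
      fix x assume "x \<in> space M"
      from lim[OF this] show "\<forall>\<^sub>F k in sequentially. ennreal (norm (d k x)) = 0" by eventually_elim simp
    qed
  qed
  have conv: "AE x in M. (\<lambda>k. A (cutoff k f) x) \<longlonglongrightarrow> B f x" if f: "f \<in> Lp_space M p" for f
  proof -
    note fm [measurable] = Lp_space_measurable[OF f]
    have "AE x in M. \<forall>l k. l \<le> k \<longrightarrow> ennreal (norm (A (cutoff k f) x - A (cutoff l f) x))
        \<le> P (\<lambda>x. ennreal (norm (cutoff l f x - f x))) x"
      unfolding AE_all_countable
    proof (intro allI)
      fix l k :: nat
      show "AE x in M. l \<le> k \<longrightarrow> ennreal (norm (A (cutoff k f) x - A (cutoff l f) x))
        \<le> P (\<lambda>x. ennreal (norm (cutoff l f x - f x))) x"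
      proof (cases "l \<le> k")
        case True
        have "AE x in M. ennreal (norm (A (\<lambda>x. cutoff k f x - cutoff l f x) x)) \<le> P (\<lambda>x. ennreal (norm (cutoff k f x - cutoff l f x))) x"
          by (rule dom[OF L1_Linf_diff[OF V[OF fm] V[OF fm]]])
        moreover have "AE x in M. P (\<lambda>x. ennreal (norm (cutoff k f x - cutoff l f x))) x \<le> P (\<lambda>x. ennreal (norm (cutoff l f x - f x))) x"
        proof (rule mono)
          show "AE x in M. ennreal (norm (cutoff k f x - cutoff l f x)) \<le> ennreal (norm (cutoff l f x - f x))"
            \<comment> \<open>For \<open>l \<le> k\<close> the two cutoffs differ only at points
              that the cutoff at \<open>l\<close> discards, where the difference is 0 or
              \<open>f\<close>.\<close>
            using True incseqD[OF exhaustion(4) True] by (intro AE_I2 ennreal_leI) (auto simp: cutoff_def)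
        qed measurable
        ultimately show ?thesis using A.A_diff[OF V[OF fm, of k] V[OF fm, of l]]
          by eventually_elim (auto intro: order_trans)
      qed auto
    qed
    moreover have "AE x in M. (\<lambda>l. P (\<lambda>x. ennreal (norm (cutoff l f x - f x))) x) \<longlonglongrightarrow> 0"
    proof (rule null[where h = f and d = "\<lambda>l x. cutoff l f x - f x", OF _ f norm_cutoff_diff_le])
      show "\<forall>\<^sub>F k in sequentially. cutoff k f x - f x = 0" if "x \<in> space M" for x
        using cutoff_eventually[OF that, of f] by eventually_elim simp
    qed measurable
    ultimately show ?thesis
    proof eventually_elim
      case (elim x)
      have "convergent (\<lambda>k. A (cutoff k f) x)" by (rule Cauchy_ennreal_majorant[OF _ elim(2)]) (use elim(1) in auto)
      then show ?case unfolding B_def by (simp add: convergent_LIMSEQ_iff)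
    qed
  qed
  \<comment> \<open>Multiples and sums of cutoffs are not the cutoffs of the multiple or the sum, so
    linearity requires other approximating sequences with the same limit.\<close>
  have conv': "AE x in M. (\<lambda>k. A (g k) x) \<longlonglongrightarrow> B f x"
    if f: "f \<in> Lp_space M p" and g: "\<And>k. g k \<in> L1_Linf M" and h: "h \<in> Lp_space M p"
      and le: "\<And>k x. norm (g k x - cutoff k f x) \<le> norm (h x)"
      and lim: "\<And>x. x \<in> space M \<Longrightarrow> \<forall>\<^sub>F k in sequentially. g k x = f x" for f g h
  proof -
    note fm [measurable] = Lp_space_measurable[OF f]
    note [measurable] = L1_LinfD(1)[OF g]
    have "AE x in M. (\<lambda>k. P (\<lambda>x. ennreal (norm (g k x - cutoff k f x))) x) \<longlonglongrightarrow> 0"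
    proof (rule null[OF _ h le])
      show "\<forall>\<^sub>F k in sequentially. g k x - cutoff k f x = 0" if "x \<in> space M" for x
        using cutoff_eventually[OF that, of f] lim[OF that] by eventually_elim simp
    qed measurable
    moreover have "AE x in M. \<forall>k. ennreal (norm (A (\<lambda>x. g k x - cutoff k f x) x)) \<le> P (\<lambda>x. ennreal (norm (g k x - cutoff k f x))) x"
      unfolding AE_all_countable by (intro allI dom L1_Linf_diff g V fm)
    moreover have "AE x in M. \<forall>k. A (\<lambda>x. g k x - cutoff k f x) x = A (g k) x - A (cutoff k f) x"
      unfolding AE_all_countable by (intro allI A.A_diff g V fm)
    ultimately show ?thesis using conv[OF f]
    proof eventually_elim
      case (elim x)
      have "(\<lambda>k. ennreal (norm (A (g k) x - A (cutoff k f) x))) \<longlonglongrightarrow> ennreal 0"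
        by (rule tendsto_sandwich[OF _ _ tendsto_const, of _ _ sequentially "\<lambda>k. P (\<lambda>x. ennreal (norm (g k x - cutoff k f x))) x"])
          (use elim in auto)
      then have "(\<lambda>k. norm (A (g k) x - A (cutoff k f) x)) \<longlonglongrightarrow> 0" by (subst (asm) tendsto_ennreal_iff) auto
      then have "(\<lambda>k. A (g k) x - A (cutoff k f) x) \<longlonglongrightarrow> 0" by (rule tendsto_norm_zero_cancel)
      from tendsto_add[OF this elim(4)] show ?case by simp
    qed
  qed
  have bound: "AE x in M. ennreal (norm (B f x)) \<le> P (\<lambda>x. ennreal (norm (f x))) x" if f: "f \<in> Lp_space M p" for f
  proof -
    note fm [measurable] = Lp_space_measurable[OF f]
    have "AE x in M. \<forall>k. ennreal (norm (A (cutoff k f) x)) \<le> P (\<lambda>x. ennreal (norm (cutoff k f x))) x"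
      unfolding AE_all_countable by (intro allI dom V fm)
    moreover have "AE x in M. \<forall>k. P (\<lambda>x. ennreal (norm (cutoff k f x))) x \<le> P (\<lambda>x. ennreal (norm (f x))) x"
      unfolding AE_all_countable by (intro allI mono AE_I2 ennreal_leI norm_cutoff_le) measurable
    ultimately show ?thesis using conv[OF f]
    proof eventually_elim
      case (elim x)
      have "(\<lambda>k. ennreal (norm (A (cutoff k f) x))) \<longlonglongrightarrow> ennreal (norm (B f x))"
        by (intro tendsto_ennrealI tendsto_norm elim)
      then show ?case by (rule LIMSEQ_le_const2) (use elim(1,2) in \<open>blast intro: order_trans\<close>)
    qed
  qed
  have Bm: "B f \<in> borel_measurable M" if f: "f \<in> Lp_space M p" for f
  proof -
    note [measurable] = A.A_measurable[OF V[OF Lp_space_measurable[OF f]]]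
    show ?thesis unfolding B_def[abs_def] by measurable
  qed
  have "Lp_contraction M p B"
    unfolding Lp_contraction_def Lp_linear_def
  proof (intro conjI ballI allI impI)
    fix f g c assume f: "f \<in> Lp_space M p"
    note fm [measurable] = Lp_space_measurable[OF f]
    have "AE x in M. norm (B f x) \<le> enn2real (P (\<lambda>x. ennreal (norm (f x))) x)"
      using bound[OF f] finite_Lp[OF p(1) f]
      by eventually_elim (metis enn2real_ennreal enn2real_mono infinity_ennreal_def norm_ge_zero)
    from Lp_of_norm_le[OF p f Bm[OF f] this]
    show "B f \<in> Lp_space M p" "Lp_norm M p (B f) \<le> Lp_norm M p f" .
    have "AE x in M. (\<lambda>k. A (\<lambda>x. c * cutoff k f x) x) \<longlonglongrightarrow> B (\<lambda>x. c * f x) x"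
    proof (rule conv'[OF Lp_space_scale[OF p(2) f] L1_Linf_scale[OF V[OF fm]]])
      show "(\<lambda>x. 2 * c * f x) \<in> Lp_space M p" by (rule Lp_space_scale[OF p(2) f])
      show "norm (c * cutoff k f x - cutoff k (\<lambda>x. c * f x) x) \<le> norm (2 * c * f x)" for k x
        by (auto simp: cutoff_def norm_mult)
      show "\<forall>\<^sub>F k in sequentially. c * cutoff k f x = c * f x" if "x \<in> space M" for x
        using cutoff_eventually[OF that, of f] by eventually_elim simp
    qed
    moreover have "AE x in M. \<forall>k. A (\<lambda>x. c * cutoff k f x) x = c * A (cutoff k f) x"
      unfolding AE_all_countable by (intro allI A.scale V fm)
    ultimately show "AE x in M. B (\<lambda>y. c * f y) x = c * B f x"
      using conv[OF f]
    proof eventually_elim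
      case (elim x)
      have "(\<lambda>k. c * A (cutoff k f) x) \<longlonglongrightarrow> c * B f x" by (intro tendsto_intros elim)
      with elim(1,2) show ?case by (simp add: LIMSEQ_unique)
    qed
    assume g: "g \<in> Lp_space M p"
    note gm [measurable] = Lp_space_measurable[OF g]
    show "AE x in M. B f x = B g x" if eq: "AE x in M. f x = g x"
    proof -
      have "AE x in M. \<forall>k. A (cutoff k f) x = A (cutoff k g) x"
        unfolding AE_all_countable
        by (intro allI A.cong V fm gm) (use eq in \<open>auto elim!: eventually_mono simp: cutoff_def\<close>)
      with conv[OF f] conv[OF g] show ?thesis
        by eventually_elim (simp add: LIMSEQ_unique)
    qed
    have "AE x in M. (\<lambda>k. A (\<lambda>x. cutoff k f x + cutoff k g x) x) \<longlonglongrightarrow> B (\<lambda>x. f x + g x) x"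
    proof (rule conv'[OF Lp_space_add[OF p(2) f g] L1_Linf_add[OF V[OF fm] V[OF gm]]])
      let ?h = "\<lambda>x. complex_of_real (norm (f x)) + complex_of_real (norm (g x))"
      show "(\<lambda>x. 2 * ?h x) \<in> Lp_space M p"
        by (intro Lp_space_scale Lp_space_add p(2) Lp_space_dominated[OF p(2) f] Lp_space_dominated[OF p(2) g]) auto
      show "norm ((cutoff k f x + cutoff k g x) - cutoff k (\<lambda>x. f x + g x) x) \<le> norm (2 * ?h x)" for k x
      proof -
        have "norm ((cutoff k f x + cutoff k g x) - cutoff k (\<lambda>x. f x + g x) x)
          \<le> norm (cutoff k f x) + norm (cutoff k g x) + norm (cutoff k (\<lambda>x. f x + g x) x)"
          by (rule order_trans[OF norm_triangle_ineq4]) (simp add: norm_triangle_ineq)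
        also have "\<dots> \<le> norm (f x) + norm (g x) + norm (f x + g x)" by (intro add_mono norm_cutoff_le)
        also have "\<dots> \<le> 2 * (norm (f x) + norm (g x))" using norm_triangle_ineq[of "f x" "g x"] by simp
        also have "\<dots> = norm (2 * ?h x)"
          by (simp only: norm_mult of_real_add[symmetric] norm_of_real norm_numeral) simp
        finally show ?thesis .
      qed
      show "\<forall>\<^sub>F k in sequentially. cutoff k f x + cutoff k g x = f x + g x" if "x \<in> space M" for x
        using cutoff_eventually[OF that, of f] cutoff_eventually[OF that, of g] by eventually_elim simp
    qed
    moreover have "AE x in M. \<forall>k. A (\<lambda>x. cutoff k f x + cutoff k g x) x = A (cutoff k f) x + A (cutoff k g) x"
      unfolding AE_all_countable by (intro allI A.add V fm gm)
    ultimately show "AE x in M. B (\<lambda>y. f y + g y) x = B f x + B g x"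
      using conv[OF f] conv[OF g]
    proof eventually_elim
      case (elim x)
      have "(\<lambda>k. A (cutoff k f) x + A (cutoff k g) x) \<longlonglongrightarrow> B f x + B g x" by (intro tendsto_intros elim)
      with elim(1,2) show ?case by (simp add: LIMSEQ_unique)
    qed
  qed
  moreover have "AE x in M. B f x = A f x" if f: "f \<in> Lp_space M 2 \<inter> Lp_space M p" for f
  proof -
    have f2: "f \<in> Lp_space M 2" and fp: "f \<in> Lp_space M p" using f by auto
    note fm [measurable] = Lp_space_measurable[OF f2]
    have two: "1 \<le> (2::ennreal)" "(2::ennreal) < \<infinity>" by auto
    have c2: "cutoff k f \<in> Lp_space M 2" for k by (rule L1_Linf_subset_Lp[OF two(1) V[OF fm]])
    note [measurable] = Lp_contractionD(1)[OF A2 f2, THEN Lp_space_measurable] Lp_contractionD(1)[OF A2 c2, THEN Lp_space_measurable]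
    have lim: "(\<lambda>k. powr_integral M (enn2real 2) (\<lambda>x. cutoff k f x - f x)) \<longlonglongrightarrow> 0"
      by (rule powr_integral_cutoff) (use f2 in \<open>auto simp: Lp_space_iff\<close>)
    \<comment> \<open>The contraction property on \<open>L^2\<close> sends \<open>A\<close> of the
      cutoffs to \<open>A f\<close> in mean; a subsequence does so pointwise, and its pointwise
      limit is \<open>B f\<close> by construction.\<close>
    have "(\<lambda>k. powr_integral M (enn2real 2) (\<lambda>x. A (cutoff k f) x - A f x)) \<longlonglongrightarrow> 0"
      by (rule tendsto_sandwich[OF _ _ tendsto_const lim])
        (use Lp_contraction_diff(2)[OF two A2 c2 f2] in auto)
    then obtain r where r: "strict_mono r" "AE x in M. (\<lambda>n. A (cutoff (r n) f) x - A f x) \<longlonglongrightarrow> 0"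
      using powr_integral_subseq_AE[of "\<lambda>k x. A (cutoff k f) x - A f x" M "enn2real 2"] by auto
    from r(2) conv[OF fp] show ?thesis
    proof eventually_elim
      case (elim x)
      have "(\<lambda>n. A (cutoff (r n) f) x) \<longlonglongrightarrow> B f x" using LIMSEQ_subseq_LIMSEQ[OF elim(2) r(1)] by (simp add: o_def)
      moreover have "(\<lambda>n. A (cutoff (r n) f) x) \<longlonglongrightarrow> A f x" using elim(1) by (simp add: LIM_zero_iff)
      ultimately show ?case by (rule LIMSEQ_unique)
    qed
  qed
  ultimately show ?thesis using bound by blast
qed

section \<open>The dominating semigroup on \<open>L^p\<close>\<close>

lemma L1_Linf_eq: "f \<in> L1_Linf M \<longleftrightarrow> f \<in> Lp_space M 1 \<inter> Lp_space M \<infinity>"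
proof
  show "f \<in> L1_Linf M \<Longrightarrow> f \<in> Lp_space M 1 \<inter> Lp_space M \<infinity>" using L1_Linf_subset_Lp[of _ f M] by auto
  assume f: "f \<in> Lp_space M 1 \<inter> Lp_space M \<infinity>"
  then have [measurable]: "f \<in> borel_measurable M" by (auto dest: Lp_space_measurable)
  have "(\<integral>\<^sup>+x. norm (f x) \<partial>M) < \<infinity>" using f by (auto simp: Lp_space_iff powr_integral_def)
  then have "integrable M f" by (simp add: integrable_iff_bounded)
  moreover have "f \<in> Lp_space M \<infinity>" using f by blast
  then obtain c where "AE x in M. norm (f x) \<le> c" using Linf_space_iff by blast
  ultimately show "f \<in> L1_Linf M" unfolding L1_Linf_def by blast
qed

text \<open>The exponents 1 and infinity of the contraction property give invariance of the core and
  the two bounds there; the exponent 2 upgrades boundedness on \<open>L^2\<close> to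
  contractivity.\<close>

lemma contraction_property_L1_Linf_semigroup:
  assumes M: "sigma_finite_measure M" and T: "Lp_semigroup M 2 T" and contr: "contraction_property M T"
  shows "L1_Linf_semigroup M T" "0 \<le> t \<Longrightarrow> Lp_contraction M 2 (T t)"
proof -
  interpret sigma_finite_measure M by fact
  have lin: "Lp_linear M 2 (T t)" if "0 \<le> t" for t
    using T that unfolding Lp_semigroup_def Lp_bounded_linear_def by auto
  have cp: "T t f \<in> Lp_space M q \<and> Lp_norm M q (T t f) \<le> Lp_norm M q f"
    if "0 \<le> t" "1 \<le> q" "f \<in> Lp_space M 2" "f \<in> Lp_space M q" for t q f
    using contr that unfolding contraction_property_def by auto
  show "Lp_contraction M 2 (T t)" if "0 \<le> t" for t
    using lin[OF that] cp[OF that, of 2] unfolding Lp_contraction_def by auto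
  have V: "f \<in> Lp_space M 2" "f \<in> Lp_space M 1" "f \<in> Lp_space M \<infinity>" if "f \<in> L1_Linf M" for f
    using that L1_Linf_subset_Lp[of _ f M] by auto
  have closed: "T t f \<in> L1_Linf M" if "0 \<le> t" "f \<in> L1_Linf M" for t f
    using cp[OF that(1) _ V(1)[OF that(2)], of 1] cp[OF that(1) _ V(1)[OF that(2)], of \<infinity>] V[OF that(2)]
    unfolding L1_Linf_eq by auto
  show "L1_Linf_semigroup M T"
  proof (intro L1_Linf_semigroup.intro L1_Linf_semigroup_axioms.intro sigma_finite_measure_axioms)
    fix t :: real assume t: "0 \<le> t"
    show "L1_Linf_contraction M (T t)"
    proof unfold_locales
      fix f g c assume f: "f \<in> L1_Linf M"
      show "T t f \<in> L1_Linf M" by (rule closed[OF t f])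
      show "AE x in M. T t (\<lambda>y. c * f y) x = c * T t f x"
        using lin[OF t] V(1)[OF f] unfolding Lp_linear_def by blast
      show "(\<integral>\<^sup>+x. norm (T t f x) \<partial>M) \<le> (\<integral>\<^sup>+x. norm (f x) \<partial>M)"
        using cp[OF t _ V(1,2)[OF f]] V(2)[OF f] V(2)[OF closed[OF t f]]
          Lp_norm_le_iff[of 1 "T t f" M f]
        by (simp add: powr_integral_def)
      show "AE x in M. norm (T t f x) \<le> b" if "AE x in M. norm (f x) \<le> b" for b
      proof (cases "0 \<le> b")
        case True
        with that Linf_norm_leD[OF V(3)[OF closed[OF t f]] V(3)[OF f]] cp[OF t _ V(1,3)[OF f]]
        show ?thesis by auto
      next
        case False
        with that have "AE x in M. False" by (auto elim!: eventually_mono dest: order_trans[OF norm_ge_zero])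
        then show ?thesis by eventually_elim simp
      qed
      assume g: "g \<in> L1_Linf M"
      show "AE x in M. T t f x = T t g x" if "AE x in M. f x = g x"
        using lin[OF t] V(1)[OF f] V(1)[OF g] that unfolding Lp_linear_def by blast
      show "AE x in M. T t (\<lambda>y. f y + g y) x = T t f x + T t g x"
        using lin[OF t] V(1)[OF f] V(1)[OF g] unfolding Lp_linear_def by blast
    qed
  next
    fix f assume "f \<in> L1_Linf M"
    with V(1) T show "AE x in M. T 0 f x = f x" unfolding Lp_semigroup_def by blast
  next
    fix s t :: real and f assume "0 \<le> s" "0 \<le> t" "f \<in> L1_Linf M"
    with V(1) T show "AE x in M. T (s + t) f x = T s (T t f) x" unfolding Lp_semigroup_def by blast
  qed
qed

context L1_Linf_semigroup
begin

definition dominating :: "real \<Rightarrow> ('a \<Rightarrow> complex) \<Rightarrow> 'a \<Rightarrow> complex" where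
  "dominating t = positive_contraction.complex_op (dominant t)"

lemma Lp_semigroup_dominating:
  assumes p: "1 \<le> p" "p < \<infinity>"
  shows "Lp_semigroup M p dominating"
  unfolding Lp_semigroup_def
proof (intro conjI allI impI ballI)
  fix t :: real assume t: "0 \<le> t"
  have "Lp_contraction M p (dominating t)"
    unfolding dominating_def by (rule positive_contraction.Lp_contraction_complex_op[OF positive_contraction_dominant[OF t] p])
  then show "Lp_bounded_linear M p (dominating t)"
    unfolding Lp_contraction_def Lp_bounded_linear_def by (auto intro!: exI[of _ 1])
next
  fix f assume f: "f \<in> Lp_space M p"
  interpret P: positive_contraction M "dominant 0" by (rule positive_contraction_dominant) simp
  note [measurable] = Lp_space_measurable[OF f]
  have z: "AE x in M. dominant 0 (\<lambda>x. ennreal (u x)) x = ennreal (u x)" if [measurable]: "u \<in> borel_measurable M" for u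
    by (rule dominant_0) measurable
  have "AE x in M. P.real_op u x = u x" if [measurable]: "u \<in> borel_measurable M" for u
  proof -
    have "AE x in M. dominant 0 (\<lambda>x. ennreal (- u x)) x = ennreal (- u x)" by (rule z) measurable
    with z[OF that] show ?thesis
    proof eventually_elim
      case (elim x)
      then show ?case by (cases "0 \<le> u x") (auto simp: P.real_op_def ennreal_neg)
    qed
  qed
  from this[of "\<lambda>x. Re (f x)"] this[of "\<lambda>x. Im (f x)"]
  show "AE x in M. dominating 0 f x = f x"
    unfolding dominating_def P.complex_op_def by (auto elim!: eventually_elim2)
next
  fix s t :: real and f assume st: "0 \<le> s" "0 \<le> t" and f: "f \<in> Lp_space M p"
  have st': "0 \<le> s + t" using st by simp
  show "AE x in M. dominating (s + t) f x = dominating s (dominating t f) x"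
    unfolding dominating_def
    by (rule complex_op_comp[OF positive_contraction_dominant positive_contraction_dominant positive_contraction_dominant
          dominant_add _ positive_contraction.finite_Lp[OF positive_contraction_dominant p(1) f] 
          positive_contraction.finite_Lp[OF positive_contraction_dominant p(1) f]])
      (use st st' Lp_space_measurable[OF f] in auto)
qed

lemma positive_Lp_semigroup_dominating: "1 \<le> p \<Longrightarrow> p < \<infinity> \<Longrightarrow> positive_Lp_semigroup M p dominating"
  unfolding positive_Lp_semigroup_def using Lp_semigroup_dominating
  by (auto simp: dominating_def intro: positive_contraction.Lp_positive_complex_op positive_contraction_dominant)

lemma contraction_property_dominating: "contraction_property M dominating"
  unfolding contraction_property_def dominating_def
  by (auto intro: positive_contraction.complex_op_Lp positive_contraction_dominant)

lemma Lp_extension_dominating: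
  assumes p: "1 \<le> p" "p < \<infinity>" and t: "0 \<le> t" and f: "f \<in> Lp_space M p"
  shows "AE x in M. Lp_extension M p (dominating t) f x = dominating t f x"
  by (rule Lp_extension_unique[OF p _ _ f])
    (auto simp: dominating_def intro: positive_contraction.Lp_contraction_complex_op p positive_contraction_dominant t)

lemma norm_Lp_extension_le:
  assumes T2: "Lp_contraction M 2 (T t)"
    and p: "1 \<le> p" "p < \<infinity>" and t: "0 \<le> t" and f: "f \<in> Lp_space M p"
  shows "AE x in M. complex_of_real (norm (Lp_extension M p (T t) f x))
    \<le> Lp_extension M p (dominating t) (\<lambda>y. complex_of_real (norm (f y))) x"
proof -
  interpret P: positive_contraction M "dominant t" by (rule positive_contraction_dominant[OF t])
  obtain B where B: "Lp_contraction M p B" "\<And>f. f \<in> Lp_space M 2 \<inter> Lp_space M p \<Longrightarrow> AE x in M. B f x = T t f x"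
    "AE x in M. ennreal (norm (B f x)) \<le> dominant t (\<lambda>x. ennreal (norm (f x))) x"
    using P.dominated_extension[OF contr[OF t] T2 norm_le_dominant[OF t] p] f by blast
  let ?g = "\<lambda>y. complex_of_real (norm (f y))"
  note [measurable] = Lp_space_measurable[OF f]
  have g: "?g \<in> Lp_space M p" by (rule Lp_space_dominated[OF p(2) f]) auto
  have "AE x in M. dominating t ?g x = complex_of_real (enn2real (dominant t (\<lambda>x. ennreal (norm (?g x))) x))"
    unfolding dominating_def by (rule P.complex_op_nonneg_eq) (auto simp: less_eq_complex_def)
  moreover have "AE x in M. Lp_extension M p (T t) f x = B f x"
    by (rule Lp_extension_unique[OF p B(1) _ f]) (rule B(2))
  ultimately show ?thesis using B(3) Lp_extension_dominating[OF p t g] P.finite_Lp[OF p(1) f]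
  proof eventually_elim
    case (elim x)
    have "norm (B f x) \<le> enn2real (dominant t (\<lambda>x. ennreal (norm (f x))) x)"
      using enn2real_mono[OF elim(3)] elim(5) by simp
    then show ?case unfolding elim(2,4,1) by (simp add: less_eq_complex_def)
  qed
qed

end

section \<open>Measurable semigroups\<close>

text \<open>Take a compact \<open>K\<close> inside \<open>E\<close> of positive measure and an open
  \<open>U\<close> around it with \<open>U - K\<close> of smaller measure than \<open>K\<close>. A
  small translate of \<open>K\<close> stays in \<open>U\<close>; were it disjoint from
  \<open>K\<close>, it would fit into \<open>U - K\<close>.\<close>

lemma Steinhaus:
  fixes E :: "real set"
  assumes E: "E \<in> sets lebesgue" "bounded E" "0 < emeasure lebesgue E"
  obtains d where "0 < d" "\<And>h. \<bar>h\<bar> < d \<Longrightarrow> \<exists>r\<in>E. r + h \<in> E"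
proof -
  have Elm: "E \<in> lmeasurable" using E(1,2) by (rule bounded_set_imp_lmeasurable[rotated])
  obtain m where m: "emeasure lebesgue E = ennreal m" "0 < m"
    using Elm E(3) by (cases "emeasure lebesgue E") (auto simp: fmeasurable_def)
  obtain K where K: "closed K" "K \<subseteq> E" "E - K \<in> lmeasurable" "emeasure lebesgue (E - K) < ennreal m"
    using sets_lebesgue_inner_closed[OF E(1) m(2)] by blast
  have cK: "compact K" using K(1,2) E(2) by (meson bounded_subset compact_eq_bounded_closed)
  have Klm: "K \<in> lmeasurable" using cK by (rule lmeasurable_compact)
  define k where "k = measure lebesgue K"
  have "emeasure lebesgue E \<le> emeasure lebesgue (E - K) + emeasure lebesgue K"
    using emeasure_subadditive[of "E - K" lebesgue K] K(2,3) Klm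
    by (auto simp: Un_absorb2 Un_absorb1 fmeasurable_def)
  with K(4) m have "emeasure lebesgue K \<noteq> 0" by auto
  then have k: "0 < k" using Klm by (simp add: k_def emeasure_eq_measure2 zero_less_measure_iff)
  obtain U where U: "open U" "K \<subseteq> U" "U - K \<in> lmeasurable" "emeasure lebesgue (U - K) < ennreal k"
    using sets_lebesgue_outer_open[of K k] Klm k by (metis fmeasurableD)
  obtain d where d: "0 < d" "(\<Union>x\<in>K. ball x d) \<subseteq> U"
    using compact_subset_open_imp_ball_epsilon_subset[OF cK U(1,2)] by blast
  have "\<exists>r\<in>E. r + h \<in> E" if h: "\<bar>h\<bar> < d" for h
  proof (rule ccontr)
    assume "\<not> (\<exists>r\<in>E. r + h \<in> E)"
    then have disj: "((+) h ` K) \<inter> K = {}" using K(2) by (auto simp: add.commute)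
    have "((+) h ` K) \<subseteq> U" using d(2) h by (force simp: dist_norm)
    with disj have sub: "((+) h ` K) \<subseteq> U - K" by auto
    have "k = measure lebesgue ((+) h ` K)" by (simp add: k_def measure_translation)
    also have "\<dots> \<le> measure lebesgue (U - K)"
      by (rule measure_mono_fmeasurable[OF sub _ U(3)]) (use measurable_translation[OF Klm] in auto)
    also have "\<dots> < k" using U(3,4) k by (simp add: emeasure_eq_measure2 ennreal_less_iff)
    finally show False by simp
  qed
  with d(1) that show ?thesis by blast
qed

lemma powr_integral_minus_commute:
  "powr_integral M q (\<lambda>x. f x - g x) = powr_integral M q (\<lambda>x. g x - f x)"
  by (simp add: powr_integral_def norm_minus_commute)

lemma powr_integral_triangle:
  assumes [measurable]: "f \<in> borel_measurable M" "g \<in> borel_measurable M" "h \<in> borel_measurable M" and "0 \<le> q"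
  shows "powr_integral M q (\<lambda>x. f x - h x)
    \<le> ennreal (2 powr q) * (powr_integral M q (\<lambda>x. f x - g x) + powr_integral M q (\<lambda>x. g x - h x))"
  using powr_integral_add_le[of "\<lambda>x. f x - g x" M "\<lambda>x. g x - h x" q] assms by simp

lemma Lp_norm_tendsto_0_iff:
  assumes p: "1 \<le> p" "p < \<infinity>" and f: "\<And>n. f n \<in> Lp_space M p"
  shows "(\<lambda>n. Lp_norm M p (f n)) \<longlonglongrightarrow> 0 \<longleftrightarrow> (\<lambda>n. powr_integral M (enn2real p) (f n)) \<longlonglongrightarrow> 0"
proof -
  let ?q = "enn2real p"
  have q: "1 \<le> ?q" using enn2real_ge_1[OF p] .
  have fin: "powr_integral M ?q (f n) < \<infinity>" for n using f p by (simp add: Lp_space_iff)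
  have norm: "Lp_norm M p (f n) = enn2real (powr_integral M ?q (f n)) powr (1 / ?q)" for n
    by (rule Lp_norm_eq[OF p(2) Lp_space_measurable[OF f]])
  have eq: "powr_integral M ?q (f n) = ennreal (Lp_norm M p (f n) powr ?q)" for n
    unfolding norm using q fin[of n] by (simp add: powr_powr)
  show ?thesis
  proof
    assume "(\<lambda>n. Lp_norm M p (f n)) \<longlonglongrightarrow> 0"
    then have "(\<lambda>n. Lp_norm M p (f n) powr ?q) \<longlonglongrightarrow> 0 powr ?q"
      by (rule tendsto_powr'[OF _ tendsto_const]) (use q in \<open>auto simp: norm\<close>)
    then show "(\<lambda>n. powr_integral M ?q (f n)) \<longlonglongrightarrow> 0" unfolding eq using tendsto_ennrealI by fastforce
  next
    assume *: "(\<lambda>n. powr_integral M ?q (f n)) \<longlonglongrightarrow> 0"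
    have "(\<lambda>n. enn2real (powr_integral M ?q (f n))) \<longlonglongrightarrow> 0"
      by (rule tendsto_enn2real) (use * in simp_all)
    then have "(\<lambda>n. enn2real (powr_integral M ?q (f n)) powr (1 / ?q)) \<longlonglongrightarrow> 0 powr (1 / ?q)"
      by (rule tendsto_powr'[OF _ tendsto_const]) (use q in auto)
    then show "(\<lambda>n. Lp_norm M p (f n)) \<longlonglongrightarrow> 0" unfolding norm by simp
  qed
qed

text \<open>A measurable orbit is nearly constant on some set \<open>E\<close> of positive measure. By Steinhaus, every
  small \<open>h\<close> is a difference of two points of \<open>E\<close>, and contractivity transports the resulting
  estimate to all later times.\<close>

lemma measurable_semigroup_continuous:
  assumes p: "1 \<le> p" "p < \<infinity>" and T: "Lp_semigroup M p T" and contr: "\<And>t. 0 \<le> t \<Longrightarrow> Lp_contraction M p (T t)"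
    and meas: "measurable_Lp_family M p T" and f: "f \<in> Lp_space M p" and t: "0 < t" and \<epsilon>: "0 < (\<epsilon>::real)"
  obtains d where "0 < d" "\<And>h. 0 \<le> h \<Longrightarrow> h < d \<Longrightarrow> powr_integral M (enn2real p) (\<lambda>x. T (t + h) f x - T t f x) \<le> ennreal \<epsilon>"
proof -
  let ?q = "enn2real p" let ?L = "lebesgue_on {0::real..}"
  let ?N = "powr_integral M ?q"
  have q: "1 \<le> ?q" using enn2real_ge_1[OF p] .
  define C where "C = 2 powr ?q"
  have C: "0 < C" by (simp add: C_def)
  \<comment> \<open>The triangle inequality with constant \<open>C\<close> is used twice, the second
    time for two equal terms: \<open>C * (C * e + C * e) = \<epsilon>\<close>.\<close>
  define e where "e = \<epsilon> / (2 * C * C)"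
  have e: "0 < e" using \<epsilon> C by (simp add: e_def)
  have uL: "T r f \<in> Lp_space M p" if "0 \<le> r" for r by (rule Lp_contractionD(1)[OF contr[OF that] f])
  obtain s :: "nat \<Rightarrow> real \<Rightarrow> 'a \<Rightarrow> complex" where s: "\<And>n. simple_function ?L (s n)"
    "\<And>n r. 0 \<le> r \<Longrightarrow> s n r \<in> Lp_space M p"
    "AE r in ?L. (\<lambda>n. Lp_norm M p (\<lambda>x. s n r x - T r f x)) \<longlonglongrightarrow> 0"
    using meas f unfolding measurable_Lp_family_def Lp_strongly_measurable_def by blast
  have tri: "?N (\<lambda>x. a x - c x) \<le> ennreal C * (?N (\<lambda>x. a x - b x) + ?N (\<lambda>x. b x - c x))"
    if "a \<in> Lp_space M p" "b \<in> Lp_space M p" "c \<in> Lp_space M p" for a b c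
    unfolding C_def by (rule powr_integral_triangle) (use that q in \<open>auto dest: Lp_space_measurable\<close>)
  have lim: "AE r in ?L. (\<lambda>n. ?N (\<lambda>x. s n r x - T r f x)) \<longlonglongrightarrow> 0"
    using s(3) AE_space
  proof eventually_elim
    case (elim r)
    then have "0 \<le> r" by simp
    from Lp_space_diff[OF p(2) s(2)[OF this] uL[OF this]] elim(1) show ?case
      by (subst (asm) Lp_norm_tendsto_0_iff[OF p]) auto
  qed
  then obtain Z where Z: "Z \<in> null_sets ?L" "\<And>r. 0 \<le> r \<Longrightarrow> r \<notin> Z \<Longrightarrow> (\<lambda>n. ?N (\<lambda>x. s n r x - T r f x)) \<longlonglongrightarrow> 0"
    by (auto elim!: AE_E3)
  \<comment> \<open>Closeness is tested between the simple functions \<open>s m\<close> and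
    \<open>s n\<close>, not against \<open>T r f\<close>: this makes the set measurable. The
    possible values \<open>c\<close> are finitely many for each \<open>n\<close>, so countably many
    sets cover [0, t] up to the null set \<open>Z\<close>.\<close>
  define G where "G n c = {r \<in> {0..t}. s n r = c \<and> (\<forall>m\<ge>n. ?N (\<lambda>x. s m r x - s n r x) \<le> ennreal e)} - Z" for n c
  have Gs: "G n c \<in> sets ?L" for n c
  proof -
    have [measurable]: "Z \<in> sets ?L" using Z(1) by auto
    have [measurable]: "(\<lambda>r. ?N (\<lambda>x. s m r x - s n r x)) \<in> borel_measurable ?L" for m
      using simple_function_compose2[OF s(1)[of m] s(1)[of n], of "\<lambda>f g. ?N (\<lambda>x. f x - g x)"]
      by (rule borel_measurable_simple_function)
    have [measurable]: "Measurable.pred ?L (\<lambda>r. s n r = c)"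
      using simple_function_eq_measurable simple_functionD(2)[OF s(1)[of n], of "{c}"]
      by (simp add: pred_def vimage_def Int_def conj_commute)
    have [measurable]: "(\<lambda>r. r) \<in> borel_measurable ?L"
      by (rule measurable_restrict_space1) (rule measurable_completion, simp)
    have "{r \<in> space ?L. r \<le> t \<and> s n r = c \<and> (\<forall>m. m \<ge> n \<longrightarrow> ?N (\<lambda>x. s m r x - s n r x) \<le> ennreal e)} - Z \<in> sets ?L"
      by measurable
    also have "{r \<in> space ?L. r \<le> t \<and> s n r = c \<and> (\<forall>m. m \<ge> n \<longrightarrow> ?N (\<lambda>x. s m r x - s n r x) \<le> ennreal e)} - Z = G n c"
      by (auto simp: G_def)
    finally show ?thesis .
  qed
  have cover: "{0..t} \<subseteq> (\<Union>n. \<Union>c\<in>s n ` {0..}. G n c) \<union> Z"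
  proof
    fix r assume r: "r \<in> {0..t}"
    then have r0: "0 \<le> r" by simp
    show "r \<in> (\<Union>n. \<Union>c\<in>s n ` {0..}. G n c) \<union> Z"
    proof (cases "r \<in> Z")
      case False
      \<comment> \<open>Two such terms with the factor \<open>C\<close> add up to
        \<open>e\<close>.\<close>
      have "0 < e / (2 * C)" using e C by simp
      with Z(2)[OF r0 False] have "\<forall>\<^sub>F n in sequentially. ?N (\<lambda>x. s n r x - T r f x) < ennreal (e / (2 * C))"
        by (intro order_tendstoD) auto
      then obtain n where n: "\<And>m. m \<ge> n \<Longrightarrow> ?N (\<lambda>x. s m r x - T r f x) < ennreal (e / (2 * C))"
        by (auto simp: eventually_sequentially)
      have "?N (\<lambda>x. s m r x - s n r x) \<le> ennreal e" if "m \<ge> n" for m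
      proof -
        have "?N (\<lambda>x. s m r x - s n r x) \<le> ennreal C * (?N (\<lambda>x. s m r x - T r f x) + ?N (\<lambda>x. s n r x - T r f x))"
          using tri[OF s(2)[OF r0, of m] uL[OF r0] s(2)[OF r0, of n]]
            powr_integral_minus_commute[of M ?q "T r f" "s n r"] by simp
        also have "\<dots> \<le> ennreal C * (ennreal (e / (2 * C)) + ennreal (e / (2 * C)))"
          using n[OF that] n[of n] by (intro mult_left_mono add_mono) auto
        also have "\<dots> = ennreal e"
          using e C by (simp add: ennreal_plus[symmetric] ennreal_mult[symmetric] del: ennreal_plus)
        finally show ?thesis .
      qed
      then show ?thesis using r False by (auto simp: G_def)
    qed auto
  qed
  have "\<exists>n c. G n c \<notin> null_sets ?L \<and> c \<in> s n ` {0..}"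
  proof (rule ccontr)
    assume "\<not> ?thesis"
    then have "(\<Union>n. \<Union>c\<in>s n ` {0..}. G n c) \<union> Z \<in> null_sets ?L"
      using Z(1) simple_functionD(1)[OF s(1)]
      by (intro null_sets.Un null_sets_UN null_sets_UN') (auto intro: countable_finite)
    moreover have "{0..t} \<in> sets ?L" by (auto simp: sets_restrict_space_iff)
    ultimately have "{0..t} \<in> null_sets ?L" using cover by (rule null_sets_subset)
    then have "emeasure lebesgue {0..t} = 0" by (auto simp: null_sets_restrict_space)
    then show False using t by simp
  qed
  then obtain n c where nc: "G n c \<notin> null_sets ?L" "c \<in> s n ` {0..}" by blast
  have cL: "c \<in> Lp_space M p" using nc(2) s(2) by auto
  have GE: "G n c \<in> sets lebesgue" using Gs[of n c] by (auto simp: sets_restrict_space_iff)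
  have "G n c \<subseteq> {0..}" by (auto simp: G_def)
  with nc(1) null_sets_restrict_space[of "{0..}" lebesgue "G n c"] have "G n c \<notin> null_sets lebesgue" by simp
  with GE have "0 < emeasure lebesgue (G n c)"
    unfolding null_sets_def zero_less_iff_neq_zero by blast
  moreover have "bounded (G n c)" by (rule bounded_subset[of "{0..t}"]) (auto simp: G_def)
  ultimately obtain d where d: "0 < d" "\<And>h. \<bar>h\<bar> < d \<Longrightarrow> \<exists>r\<in>G n c. r + h \<in> G n c"
    using Steinhaus[OF GE] by blast
  have near: "?N (\<lambda>x. T r f x - c x) \<le> ennreal (C * e)" if r: "r \<in> G n c" for r
  proof -
    have r0: "0 \<le> r" and rZ: "r \<notin> Z" and sc: "s n r = c" and le: "\<And>m. m \<ge> n \<Longrightarrow> ?N (\<lambda>x. s m r x - c x) \<le> ennreal e"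
      using r by (auto simp: G_def)
    have "(\<lambda>m. ennreal C * (?N (\<lambda>x. s m r x - T r f x) + ennreal e)) \<longlonglongrightarrow> ennreal C * (0 + ennreal e)"
      by (intro ennreal_tendsto_cmult tendsto_add tendsto_const Z(2) r0 rZ) simp
    then have "?N (\<lambda>x. T r f x - c x) \<le> ennreal C * (0 + ennreal e)"
    proof (rule LIMSEQ_le_const, intro exI[of _ n] allI impI)
      fix m assume "n \<le> m"
      have "?N (\<lambda>x. T r f x - c x) \<le> ennreal C * (?N (\<lambda>x. T r f x - s m r x) + ?N (\<lambda>x. s m r x - c x))"
        by (rule tri[OF uL[OF r0] s(2)[OF r0] cL])
      also have "\<dots> \<le> ennreal C * (?N (\<lambda>x. s m r x - T r f x) + ennreal e)"
        using le[OF \<open>n \<le> m\<close>] powr_integral_minus_commute[of M ?q "T r f" "s m r"]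
        by (intro mult_left_mono add_mono) auto
      finally show "?N (\<lambda>x. T r f x - c x) \<le> ennreal C * (?N (\<lambda>x. s m r x - T r f x) + ennreal e)" .
    qed
    then show ?thesis using C e by (simp add: ennreal_mult)
  qed
  show ?thesis
  proof (rule that[OF d(1)])
    fix h assume h: "0 \<le> h" "h < d"
    then obtain r where r: "r \<in> G n c" "r + h \<in> G n c" using d(2)[of h] by auto
    then have r0: "0 \<le> r" "r \<le> t" by (auto simp: G_def)
    have rh: "0 \<le> r + h" "0 \<le> t - r" using r0 h by auto
    \<comment> \<open>Both \<open>T (t + h) f\<close> and \<open>T t f\<close> are images under
      \<open>T (t - r)\<close> of orbit points at the times \<open>r + h\<close> and
      \<open>r\<close> in \<open>G n c\<close>, so contractivity carries the estimate from
      \<open>r\<close> to \<open>t\<close>.\<close>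
    have AE1: "AE x in M. T ((t - r) + (r + h)) f x = T (t - r) (T (r + h) f) x"
      using T rh f unfolding Lp_semigroup_def by blast
    have AE2: "AE x in M. T ((t - r) + r) f x = T (t - r) (T r f) x"
      using T rh(2) r0(1) f unfolding Lp_semigroup_def by blast
    have "?N (\<lambda>x. T (t + h) f x - T t f x) = ?N (\<lambda>x. T (t - r) (T (r + h) f) x - T (t - r) (T r f) x)"
      by (rule powr_integral_cong) (use AE1 AE2 in \<open>auto elim: eventually_elim2 simp: algebra_simps\<close>)
    also have "\<dots> \<le> ?N (\<lambda>x. T (r + h) f x - T r f x)"
      by (rule Lp_contraction_diff(2)[OF p contr[OF rh(2)] uL[OF rh(1)] uL[OF r0(1)]])
    also have "\<dots> \<le> ennreal C * (?N (\<lambda>x. T (r + h) f x - c x) + ?N (\<lambda>x. c x - T r f x))"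
      by (rule tri[OF uL[OF rh(1)] cL uL[OF r0(1)]])
    also have "\<dots> \<le> ennreal C * (ennreal (C * e) + ennreal (C * e))"
      using near[OF r(1)] near[OF r(2)] powr_integral_minus_commute[of M ?q c "T r f"]
      by (intro mult_left_mono add_mono) auto
    also have "ennreal (C * e) + ennreal (C * e) = ennreal (C * e + C * e)"
      using C e by (intro ennreal_plus[symmetric]) auto
    also have "ennreal C * \<dots> = ennreal (C * (C * e + C * e))"
      using C e by (intro ennreal_mult[symmetric]) auto
    also have "C * (C * e + C * e) = \<epsilon>" using C by (simp add: e_def field_simps)
    finally show "?N (\<lambda>x. T (t + h) f x - T t f x) \<le> ennreal \<epsilon>" .
  qed
qed

section \<open>Asymptotic domination in measure\<close>

lemma tendsto_0_of_le_eps: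
  fixes y :: "nat \<Rightarrow> ennreal"
  assumes "\<And>e::real. 0 < e \<Longrightarrow> \<exists>z. z \<longlonglongrightarrow> 0 \<and> (\<forall>n. y n \<le> ennreal e + z n)"
  shows "y \<longlonglongrightarrow> 0"
proof (rule order_tendstoI)
  fix a :: ennreal assume "0 < a"
  then obtain e where e: "0 < e" "ennreal e + ennreal e \<le> a"
  proof (cases a)
    case (real r)
    with \<open>0 < a\<close> have "0 < r / 2" by simp
    then show ?thesis using real by (intro that[of "r / 2"]) (simp_all add: ennreal_plus[symmetric] del: ennreal_plus)
  qed (use that[of 1] in simp)
  obtain z where z: "z \<longlonglongrightarrow> 0" "\<And>n. y n \<le> ennreal e + z n" using assms[OF e(1)] by blast
  have "\<forall>\<^sub>F n in sequentially. z n < ennreal e" using z(1) e(1) by (intro order_tendstoD) auto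
  then show "\<forall>\<^sub>F n in sequentially. y n < a"
  proof eventually_elim
    case (elim n)
    have "y n \<le> ennreal e + z n" by (rule z)
    also have "\<dots> < ennreal e + ennreal e" using elim by (simp add: ennreal_add_left_cancel_less)
    also have "\<dots> \<le> a" by (rule e)
    finally show ?case .
  qed
qed simp

lemma min_1_add_le: "min 1 (y + z) \<le> min 1 y + min 1 (z :: ennreal)"
  by (auto simp: min_def add_increasing add_increasing2)

lemma ennreal_le_diff_add: "x \<le> (x - y) + (y :: ennreal)"
  by (metis add.commute diff_add_self_ennreal linorder_le_cases order_refl)

lemma ennreal_diff_add_le:
  fixes a b c d :: ennreal
  shows "(b + d) - (a + c) \<le> (b - a) + (d - c)"
proof -
  have "b + d \<le> ((b - a) + a) + ((d - c) + c)" by (intro add_mono ennreal_le_diff_add)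
  then have "b + d \<le> (a + c) + ((b - a) + (d - c))" by (simp add: ac_simps)
  \<comment> \<open>Subtracting infinity from infinity gives infinity in \<open>ennreal\<close>, so
    this case is compared separately.\<close>
  moreover have "(b - a) + (d - c) = top" if "b + d = top" "a + c = top"
    using that by (cases a; cases b; cases c; cases d) (auto simp: ennreal_top_minus)
  ultimately show ?thesis by (auto simp: ennreal_minus_le_iff)
qed

lemma ennreal_diff_triangle:
  fixes a b c :: ennreal
  assumes "b < top"
  shows "b - a \<le> (b - c) + (c - a)"
proof -
  have "b \<le> (b - c) + ((c - a) + a)" by (rule order_trans[OF ennreal_le_diff_add add_left_mono[OF ennreal_le_diff_add]])
  then show ?thesis using assms by (auto simp: ennreal_minus_le_iff ac_simps)
qed

lemma powr_diff_add_le: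
  fixes x y p :: real
  assumes "0 \<le> y" "y \<le> x" "1 \<le> p"
  shows "(x - y) powr p + y powr p \<le> x powr p"
proof -
  have split: "z powr p = z * z powr (p - 1)" if "0 \<le> z" for z :: real
    using that by (cases "z = 0") (auto simp: powr_diff)
  have "(x - y) powr p + y powr p = (x - y) * (x - y) powr (p - 1) + y * y powr (p - 1)"
    using assms by (simp add: split)
  also have "\<dots> \<le> (x - y) * x powr (p - 1) + y * x powr (p - 1)"
    using assms by (intro add_mono mult_left_mono powr_mono2) auto
  also have "\<dots> = x powr p" using assms by (simp add: split algebra_simps)
  finally show ?thesis .
qed

lemma tendsto_0_subseq:
  fixes X :: "nat \<Rightarrow> ennreal"
  assumes "\<And>r::nat \<Rightarrow> nat. strict_mono r \<Longrightarrow> \<exists>q. strict_mono (q :: nat \<Rightarrow> nat) \<and> (\<lambda>n. X (r (q n))) \<longlonglongrightarrow> 0"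
  shows "X \<longlonglongrightarrow> 0"
proof (rule order_tendstoI)
  fix a :: ennreal assume a: "0 < a"
  show "\<forall>\<^sub>F n in sequentially. X n < a"
  proof (rule ccontr)
    assume "\<not> (\<forall>\<^sub>F n in sequentially. X n < a)"
    then have "\<exists>\<^sub>F n in sequentially. a \<le> X n" by (simp add: frequently_def not_le)
    then have "infinite {n. a \<le> X n}" by (simp add: frequently_cofinite cofinite_eq_sequentially[symmetric])
    then obtain r :: "nat \<Rightarrow> nat" where r: "strict_mono r" "\<And>n. r n \<in> {n. a \<le> X n}"
      using infinite_enumerate by blast
    obtain q where q: "strict_mono q" "(\<lambda>n. X (r (q n))) \<longlonglongrightarrow> 0" using assms[OF r(1)] by blast
    have "\<forall>\<^sub>F n in sequentially. X (r (q n)) < a" by (rule order_tendstoD(2)[OF q(2) a])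
    then obtain n where "X (r (q n)) < a" by (auto simp: eventually_sequentially)
    then show False using r(2)[of "q n"] by simp
  qed
qed simp

text \<open>Asymptotic domination \<open>liminf a\<^sub>n \<ge> b\<close> in measure, with respect to an equivalent finite
  measure \<open>w \<mu>\<close>.\<close>

definition asymp_dominates :: "'a measure \<Rightarrow> ('a \<Rightarrow> ennreal) \<Rightarrow> (nat \<Rightarrow> 'a \<Rightarrow> ennreal) \<Rightarrow> ('a \<Rightarrow> ennreal) \<Rightarrow> bool" where
  "asymp_dominates M w a b \<longleftrightarrow> (\<lambda>n. \<integral>\<^sup>+x. min 1 (b x - a n x) * w x \<partial>M) \<longlonglongrightarrow> 0"

lemma asymp_dominates_mono:
  assumes "asymp_dominates M w a b" "\<And>n. AE x in M. a n x \<le> a' n x"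
  shows "asymp_dominates M w a' b"
  unfolding asymp_dominates_def
proof (rule tendsto_sandwich[OF _ _ tendsto_const assms(1)[unfolded asymp_dominates_def]])
  show "\<forall>\<^sub>F n in sequentially. (\<integral>\<^sup>+x. min 1 (b x - a' n x) * w x \<partial>M) \<le> (\<integral>\<^sup>+x. min 1 (b x - a n x) * w x \<partial>M)"
  proof (rule always_eventually, rule allI, rule nn_integral_mono_AE)
    fix n
    show "AE x in M. min 1 (b x - a' n x) * w x \<le> min 1 (b x - a n x) * w x"
      using assms(2)[of n]
      by eventually_elim (intro mult_right_mono min.mono order_refl ennreal_minus_mono, simp_all)
  qed
qed simp

lemma asymp_dominates_add:
  assumes [measurable]: "w \<in> borel_measurable M" "\<And>n. a n \<in> borel_measurable M" "b \<in> borel_measurable M"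
    "\<And>n. a' n \<in> borel_measurable M" "b' \<in> borel_measurable M"
    and D: "asymp_dominates M w a b" "asymp_dominates M w a' b'"
  shows "asymp_dominates M w (\<lambda>n x. a n x + a' n x) (\<lambda>x. b x + b' x)"
  unfolding asymp_dominates_def
proof (rule tendsto_sandwich[OF _ _ tendsto_const])
  show "(\<lambda>n. (\<integral>\<^sup>+x. min 1 (b x - a n x) * w x \<partial>M) + (\<integral>\<^sup>+x. min 1 (b' x - a' n x) * w x \<partial>M)) \<longlonglongrightarrow> 0"
    using tendsto_add[OF D[unfolded asymp_dominates_def]] by simp
  show "\<forall>\<^sub>F n in sequentially. (\<integral>\<^sup>+x. min 1 ((b x + b' x) - (a n x + a' n x)) * w x \<partial>M)
      \<le> (\<integral>\<^sup>+x. min 1 (b x - a n x) * w x \<partial>M) + (\<integral>\<^sup>+x. min 1 (b' x - a' n x) * w x \<partial>M)"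
  proof (intro always_eventually allI)
    fix n
    have "min 1 (b x + b' x - (a n x + a' n x)) * w x \<le> min 1 (b x - a n x) * w x + min 1 (b' x - a' n x) * w x" for x
    proof -
      have "min 1 (b x + b' x - (a n x + a' n x)) \<le> min 1 ((b x - a n x) + (b' x - a' n x))"
        by (intro min.mono order_refl ennreal_diff_add_le)
      also have "\<dots> \<le> min 1 (b x - a n x) + min 1 (b' x - a' n x)" by (rule min_1_add_le)
      finally show ?thesis by (simp add: distrib_right[symmetric] mult_right_mono)
    qed
    then have "(\<integral>\<^sup>+x. min 1 ((b x + b' x) - (a n x + a' n x)) * w x \<partial>M)
      \<le> (\<integral>\<^sup>+x. min 1 (b x - a n x) * w x + min 1 (b' x - a' n x) * w x \<partial>M)"
      by (intro nn_integral_mono)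
    also have "\<dots> = (\<integral>\<^sup>+x. min 1 (b x - a n x) * w x \<partial>M) + (\<integral>\<^sup>+x. min 1 (b' x - a' n x) * w x \<partial>M)"
      by (rule nn_integral_add) measurable
    finally show "(\<integral>\<^sup>+x. min 1 ((b x + b' x) - (a n x + a' n x)) * w x \<partial>M)
      \<le> (\<integral>\<^sup>+x. min 1 (b x - a n x) * w x \<partial>M) + (\<integral>\<^sup>+x. min 1 (b' x - a' n x) * w x \<partial>M)" .
  qed
qed simp

text \<open>The distance from \<open>b\<close> to \<open>c k\<close> in weighted measure is small
  for one large \<open>k\<close>, independently of \<open>n\<close>; for that \<open>k\<close> the
  hypothesis takes over. Finiteness of \<open>b\<close> is what makes \<open>b - c k\<close> tend to
  0.\<close>

lemma asymp_dominates_SUP: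
  assumes [measurable]: "w \<in> borel_measurable M" "\<And>n. a n \<in> borel_measurable M" "b \<in> borel_measurable M"
    "\<And>k. c k \<in> borel_measurable M"
    and w: "(\<integral>\<^sup>+x. w x \<partial>M) < \<infinity>" and D: "\<And>k::nat. asymp_dominates M w a (c k)"
    and inc: "AE x in M. incseq (\<lambda>k. c k x)" and b: "AE x in M. b x = (SUP k. c k x)" and fin: "AE x in M. b x < \<infinity>"
  shows "asymp_dominates M w a b"
  unfolding asymp_dominates_def
proof (rule tendsto_0_of_le_eps)
  fix e :: real assume e: "0 < e"
  have "(\<lambda>k. \<integral>\<^sup>+x. min 1 (b x - c k x) * w x \<partial>M) \<longlonglongrightarrow> (\<integral>\<^sup>+x. 0 \<partial>M)"
  proof (rule nn_integral_dominated_convergence[OF _ _ _ _ w])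
    show "AE x in M. min 1 (b x - c k x) * w x \<le> w x" for k
      using mult_right_mono[of "min 1 _" 1 "w _"] by auto
    have "AE x in M. w x \<noteq> \<infinity>" by (rule nn_integral_PInf_AE) (use w in auto)
    then show "AE x in M. (\<lambda>k. min 1 (b x - c k x) * w x) \<longlonglongrightarrow> 0"
      using inc b fin
    proof eventually_elim
      case (elim x)
      have "(\<lambda>k. c k x) \<longlonglongrightarrow> b x" using LIMSEQ_SUP[OF elim(2)] elim(3) by simp
      then have "(\<lambda>k. b x - c k x) \<longlonglongrightarrow> b x - b x"
        using elim(4) by (intro tendsto_diff_ennreal tendsto_const) auto
      then have "(\<lambda>k. b x - c k x) \<longlonglongrightarrow> 0" using elim(4) by simp
      then have "(\<lambda>k. min 1 (b x - c k x)) \<longlonglongrightarrow> min 1 0" by (intro tendsto_min tendsto_const)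
      then have "(\<lambda>k. w x * min 1 (b x - c k x)) \<longlonglongrightarrow> w x * min 1 0"
        using elim(1) by (intro ennreal_tendsto_cmult) (auto simp: less_top)
      then show ?case by (simp add: mult.commute)
    qed
  qed measurable
  then have "(\<lambda>k. \<integral>\<^sup>+x. min 1 (b x - c k x) * w x \<partial>M) \<longlonglongrightarrow> 0" by simp
  then have "\<forall>\<^sub>F k in sequentially. (\<integral>\<^sup>+x. min 1 (b x - c k x) * w x \<partial>M) < ennreal e"
    using e by (intro order_tendstoD) auto
  then obtain k where k: "(\<integral>\<^sup>+x. min 1 (b x - c k x) * w x \<partial>M) < ennreal e" by (auto simp: eventually_sequentially)
  show "\<exists>z. z \<longlonglongrightarrow> 0 \<and> (\<forall>n. (\<integral>\<^sup>+x. min 1 (b x - a n x) * w x \<partial>M) \<le> ennreal e + z n)"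
  proof (intro exI conjI allI)
    show "(\<lambda>n. \<integral>\<^sup>+x. min 1 (c k x - a n x) * w x \<partial>M) \<longlonglongrightarrow> 0" using D[of k] by (simp add: asymp_dominates_def)
    fix n
    have "(\<integral>\<^sup>+x. min 1 (b x - a n x) * w x \<partial>M) \<le> (\<integral>\<^sup>+x. min 1 (b x - c k x) * w x + min 1 (c k x - a n x) * w x \<partial>M)"
    proof (rule nn_integral_mono_AE)
      show "AE x in M. min 1 (b x - a n x) * w x \<le> min 1 (b x - c k x) * w x + min 1 (c k x - a n x) * w x"
        using fin
      proof eventually_elim
        case (elim x)
        have "min 1 (b x - a n x) \<le> min 1 ((b x - c k x) + (c k x - a n x))"
          using elim by (intro min.mono order_refl ennreal_diff_triangle) auto
        also have "\<dots> \<le> min 1 (b x - c k x) + min 1 (c k x - a n x)" by (rule min_1_add_le)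
        finally show ?case by (simp add: distrib_right[symmetric] mult_right_mono)
      qed
    qed
    also have "\<dots> = (\<integral>\<^sup>+x. min 1 (b x - c k x) * w x \<partial>M) + (\<integral>\<^sup>+x. min 1 (c k x - a n x) * w x \<partial>M)"
      by (rule nn_integral_add) measurable
    also have "\<dots> \<le> ennreal e + (\<integral>\<^sup>+x. min 1 (c k x - a n x) * w x \<partial>M)" using k by (intro add_right_mono) simp
    finally show "(\<integral>\<^sup>+x. min 1 (b x - a n x) * w x \<partial>M) \<le> ennreal e + (\<integral>\<^sup>+x. min 1 (c k x - a n x) * w x \<partial>M)" .
  qed
qed

text \<open>Markov's inequality: where \<open>|f n - g| \<le> d\<close> the integrand is at most
  \<open>d * w\<close>, and elsewhere 1 is at most the q-th power of
  \<open>|f n - g| / d\<close>.\<close>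

lemma asymp_dominates_norm:
  assumes [measurable]: "w \<in> borel_measurable M" "\<And>n. f n \<in> borel_measurable M" "g \<in> borel_measurable M"
    and w: "(\<integral>\<^sup>+x. w x \<partial>M) < \<infinity>" "\<And>x. w x \<le> 1" and q: "0 < q"
    and lim: "(\<lambda>n. powr_integral M q (\<lambda>x. f n x - g x)) \<longlonglongrightarrow> 0"
  shows "asymp_dominates M w (\<lambda>n x. ennreal (norm (f n x))) (\<lambda>x. ennreal (norm (g x)))"
  unfolding asymp_dominates_def
proof (rule tendsto_0_of_le_eps)
  fix e :: real assume e: "0 < e"
  obtain W where W: "(\<integral>\<^sup>+x. w x \<partial>M) = ennreal W" "0 \<le> W" using w(1) by (cases "\<integral>\<^sup>+x. w x \<partial>M") auto
  \<comment> \<open>Chosen so that the part with small difference contributes at most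
    \<open>e\<close>; the 1 covers \<open>W = 0\<close>.\<close>
  define d where "d = e / (W + 1)"
  have d: "0 < d" using e W by (simp add: d_def)
  have dW: "d * W \<le> e"
  proof -
    have "d * W \<le> d * (W + 1)" using d by (intro mult_left_mono) auto
    also have "\<dots> = e" using W by (simp add: d_def)
    finally show ?thesis .
  qed
  show "\<exists>z. z \<longlonglongrightarrow> 0 \<and> (\<forall>n. (\<integral>\<^sup>+x. min 1 (ennreal (norm (g x)) - ennreal (norm (f n x))) * w x \<partial>M) \<le> ennreal e + z n)"
  proof (intro exI conjI allI)
    show "(\<lambda>n. ennreal (1 / d powr q) * powr_integral M q (\<lambda>x. f n x - g x)) \<longlonglongrightarrow> 0"
      using ennreal_tendsto_cmult[OF _ lim, of "ennreal (1 / d powr q)"] by simp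
    fix n
    have pt: "min 1 (ennreal (norm (g x)) - ennreal (norm (f n x))) * w x
        \<le> ennreal d * w x + ennreal (1 / d powr q) * ennreal (norm (f n x - g x) powr q)" for x
    proof (cases "norm (f n x - g x) \<le> d")
      case True
      have "ennreal (norm (g x)) - ennreal (norm (f n x)) = ennreal (norm (g x) - norm (f n x))"
        by (simp add: ennreal_minus)
      also have "\<dots> \<le> ennreal d"
        using True norm_triangle_ineq2[of "g x" "f n x"] by (intro ennreal_leI) (simp add: norm_minus_commute)
      finally have "min 1 (ennreal (norm (g x)) - ennreal (norm (f n x))) \<le> ennreal d" by (simp add: min.coboundedI2)
      then have "min 1 (ennreal (norm (g x)) - ennreal (norm (f n x))) * w x \<le> ennreal d * w x" by (rule mult_right_mono) simp
      then show ?thesis by (rule order_trans) simp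
    next
      case False
      have "min 1 (ennreal (norm (g x)) - ennreal (norm (f n x))) * w x \<le> 1 * 1"
        using w(2) by (intro mult_mono) auto
      also have "\<dots> \<le> ennreal (1 / d powr q * norm (f n x - g x) powr q)"
      proof -
        have "d powr q \<le> norm (f n x - g x) powr q" using False d q by (intro powr_mono2) auto
        then have "1 \<le> 1 / d powr q * norm (f n x - g x) powr q" using d by (simp add: field_simps)
        then show ?thesis by simp
      qed
      also have "\<dots> = ennreal (1 / d powr q) * ennreal (norm (f n x - g x) powr q)" by (rule ennreal_mult) auto
      finally show ?thesis by (rule order_trans) simp
    qed
    have "(\<integral>\<^sup>+x. min 1 (ennreal (norm (g x)) - ennreal (norm (f n x))) * w x \<partial>M)
      \<le> (\<integral>\<^sup>+x. ennreal d * w x + ennreal (1 / d powr q) * ennreal (norm (f n x - g x) powr q) \<partial>M)"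
      by (intro nn_integral_mono pt)
    also have "\<dots> = ennreal d * (\<integral>\<^sup>+x. w x \<partial>M) + ennreal (1 / d powr q) * powr_integral M q (\<lambda>x. f n x - g x)"
      unfolding powr_integral_def by (subst nn_integral_add, measurable) (simp add: nn_integral_cmult)
    also have "ennreal d * (\<integral>\<^sup>+x. w x \<partial>M) \<le> ennreal e"
      unfolding W using d W dW by (simp add: ennreal_mult[symmetric] ennreal_leI)
    finally show "(\<integral>\<^sup>+x. min 1 (ennreal (norm (g x)) - ennreal (norm (f n x))) * w x \<partial>M)
        \<le> ennreal e + ennreal (1 / d powr q) * powr_integral M q (\<lambda>x. f n x - g x)"
      by (meson add_right_mono order_trans)
  qed
qed

text \<open>Domination from below together with the bound \<open>\<integral>a\<^sub>n\<^sup>p \<le> \<integral>b\<^sup>p\<close> forces convergence: pointwise,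
  \<open>|a - b|\<^sup>p + min a b\<^sup>p \<le> a\<^sup>p + max 0 (b - a)\<^sup>p\<close>.\<close>

lemma asymp_dominates_tendsto:
  fixes a :: "nat \<Rightarrow> 'a \<Rightarrow> real"
  assumes [measurable]: "w \<in> borel_measurable M" "\<And>n. a n \<in> borel_measurable M" "b \<in> borel_measurable M"
    and w: "(\<integral>\<^sup>+x. w x \<partial>M) < \<infinity>" "\<And>x. x \<in> space M \<Longrightarrow> 0 < w x" "\<And>x. w x \<le> 1"
    and nn: "\<And>n x. 0 \<le> a n x" "\<And>x. 0 \<le> b x" and p: "1 \<le> p"
    and fin: "(\<integral>\<^sup>+x. ennreal (b x powr p) \<partial>M) < \<infinity>"
    and le: "\<And>n. (\<integral>\<^sup>+x. ennreal (a n x powr p) \<partial>M) \<le> (\<integral>\<^sup>+x. ennreal (b x powr p) \<partial>M)"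
    and D: "asymp_dominates M w (\<lambda>n x. ennreal (a n x)) (\<lambda>x. ennreal (b x))"
  shows "(\<lambda>n. \<integral>\<^sup>+x. ennreal (\<bar>a n x - b x\<bar> powr p) \<partial>M) \<longlonglongrightarrow> 0"
proof (rule tendsto_0_subseq)
  fix r :: "nat \<Rightarrow> nat" assume r: "strict_mono r"
  \<comment> \<open>Convergence in weighted measure is convergence in \<open>L^1\<close> of
    \<open>v\<close>; a subsequence tends to 0 almost everywhere, and positivity of \<open>w\<close>
    allows dividing it out.\<close>
  define v where "v n x = enn2real (min 1 (ennreal (b x) - ennreal (a n x)) * w x)" for n x
  have wfin: "w x < top" for x using w(3)[of x] by (rule le_less_trans) simp
  have v: "ennreal (v n x) = min 1 (ennreal (b x) - ennreal (a n x)) * w x" for n x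
    unfolding v_def by (rule ennreal_enn2real) (use wfin[of x] in \<open>auto simp: ennreal_mult_less_top min_less_iff_disj\<close>)
  have v0: "0 \<le> v n x" for n x by (simp add: v_def)
  have [measurable]: "v n \<in> borel_measurable M" for n unfolding v_def[abs_def] by measurable
  have vle: "(\<integral>\<^sup>+x. ennreal (v n x) \<partial>M) \<le> (\<integral>\<^sup>+x. w x \<partial>M)" for n
    unfolding v by (intro nn_integral_mono) (use mult_right_mono[of "min 1 _" 1 "w _"] in auto)
  have vfin: "(\<integral>\<^sup>+x. ennreal (v n x) \<partial>M) < \<infinity>" for n by (rule le_less_trans[OF vle w(1)])
  have "(\<lambda>n. \<integral>\<^sup>+x. ennreal (v n x) \<partial>M) \<longlonglongrightarrow> 0" unfolding v using D by (simp add: asymp_dominates_def)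
  then have "(\<lambda>n. \<integral>\<^sup>+x. ennreal (v (r n) x) \<partial>M) \<longlonglongrightarrow> 0" using LIMSEQ_subseq_LIMSEQ[OF _ r] by (simp add: o_def)
  then have "(\<lambda>n. enn2real (\<integral>\<^sup>+x. ennreal (v (r n) x) \<partial>M)) \<longlonglongrightarrow> 0"
    by (intro tendsto_enn2real) simp_all
  moreover have "(LINT x|M. norm (v (r n) x)) = enn2real (\<integral>\<^sup>+x. ennreal (v (r n) x) \<partial>M)" for n
    using v0 by (subst integral_eq_nn_integral) auto
  ultimately have "(\<lambda>n. LINT x|M. norm (v (r n) x)) \<longlonglongrightarrow> 0" by simp
  moreover have "integrable M (v (r n))" for n using vfin[of "r n"] v0 by (simp add: integrable_iff_bounded)
  ultimately obtain q where q: "strict_mono q" "AE x in M. (\<lambda>n. v (r (q n)) x) \<longlonglongrightarrow> 0"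
    using tendsto_L1_AE_subseq[of M "\<lambda>n. v (r n)"] by auto
  \<comment> \<open>The deficit \<open>d\<close> and the overlap \<open>m\<close> are both bounded
    by \<open>b\<close>, so dominated convergence applies to them, unlike to \<open>a\<close>, which
    has no pointwise bound.\<close>
  define d where "d n x = max 0 (b x - a (r (q n)) x)" for n x
  define m where "m n x = min (a (r (q n)) x) (b x)" for n x
  have [measurable]: "d n \<in> borel_measurable M" "m n \<in> borel_measurable M" for n
    unfolding d_def[abs_def] m_def[abs_def] by measurable
  have dm: "0 \<le> d n x" "d n x \<le> b x" "0 \<le> m n x" "m n x \<le> b x" "m n x = b x - d n x" for n x
    using nn(1)[of "r (q n)" x] nn(2)[of x] by (auto simp: d_def m_def)
  have dlim: "AE x in M. (\<lambda>n. d n x) \<longlonglongrightarrow> 0"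
    using q(2) AE_space
  proof eventually_elim
    case (elim x)
    obtain W where W: "w x = ennreal W" "0 < W" using w(2)[OF elim(2)] wfin[of x] by (cases "w x") auto
    have "v (r (q n)) x = min 1 (d n x) * W" for n
    proof -
      have "ennreal (v (r (q n)) x) = min 1 (ennreal (d n x)) * ennreal W"
        unfolding v W using nn(1)[of "r (q n)" x] by (simp add: ennreal_minus d_def max_def ennreal_neg)
      also have "\<dots> = ennreal (min 1 (d n x) * W)"
        using dm(1)[of n x] W(2) by (subst ennreal_mult) (auto simp: min_def)
      finally show ?thesis using v0 dm(1)[of n x] W(2) by (subst (asm) ennreal_inj) auto
    qed
    then have "(\<lambda>n. min 1 (d n x) * W) \<longlonglongrightarrow> 0" using elim(1) by simp
    then have "(\<lambda>n. min 1 (d n x) * W / W) \<longlonglongrightarrow> 0 / W" using W(2) by (intro tendsto_divide tendsto_const) auto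
    then have lim: "(\<lambda>n. min 1 (d n x)) \<longlonglongrightarrow> 0" using W(2) by simp
    then have "\<forall>\<^sub>F n in sequentially. min 1 (d n x) < 1" by (rule order_tendstoD) simp
    then have "\<forall>\<^sub>F n in sequentially. min 1 (d n x) = d n x" by eventually_elim auto
    with lim show ?case by (rule Lim_transform_eventually)
  qed
  have "(\<lambda>n. \<integral>\<^sup>+x. ennreal (d n x powr p) \<partial>M) \<longlonglongrightarrow> (\<integral>\<^sup>+x. 0 \<partial>M)"
  proof (rule nn_integral_dominated_convergence[OF _ _ _ _ fin])
    show "AE x in M. ennreal (d n x powr p) \<le> ennreal (b x powr p)" for n
      using dm p by (intro AE_I2 ennreal_leI powr_mono2) auto
    show "AE x in M. (\<lambda>n. ennreal (d n x powr p)) \<longlonglongrightarrow> 0"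
      using dlim
    proof eventually_elim
      case (elim x)
      have "(\<lambda>n. d n x powr p) \<longlonglongrightarrow> 0 powr p"
        by (rule tendsto_powr'[OF elim tendsto_const]) (use p dm in auto)
      then show ?case using tendsto_ennrealI by fastforce
    qed
  qed measurable
  then have dint: "(\<lambda>n. \<integral>\<^sup>+x. ennreal (d n x powr p) \<partial>M) \<longlonglongrightarrow> 0" by simp
  have mint: "(\<lambda>n. \<integral>\<^sup>+x. ennreal (m n x powr p) \<partial>M) \<longlonglongrightarrow> (\<integral>\<^sup>+x. ennreal (b x powr p) \<partial>M)"
  proof (rule nn_integral_dominated_convergence[OF _ _ _ _ fin])
    show "AE x in M. ennreal (m n x powr p) \<le> ennreal (b x powr p)" for n
      using dm p by (intro AE_I2 ennreal_leI powr_mono2) auto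
    show "AE x in M. (\<lambda>n. ennreal (m n x powr p)) \<longlonglongrightarrow> ennreal (b x powr p)"
      using dlim
    proof eventually_elim
      case (elim x)
      have "(\<lambda>n. m n x) \<longlonglongrightarrow> b x - 0" unfolding dm(5) by (intro tendsto_intros elim)
      then have "(\<lambda>n. m n x powr p) \<longlonglongrightarrow> (b x - 0) powr p"
        by (rule tendsto_powr'[OF _ tendsto_const]) (use p dm in auto)
      then show ?case by (intro tendsto_ennrealI) simp
    qed
  qed measurable
  let ?b = "\<integral>\<^sup>+x. ennreal (b x powr p) \<partial>M"
  have key: "(\<integral>\<^sup>+x. ennreal (\<bar>a (r (q n)) x - b x\<bar> powr p) \<partial>M)
      \<le> (?b + (\<integral>\<^sup>+x. ennreal (d n x powr p) \<partial>M)) - (\<integral>\<^sup>+x. ennreal (m n x powr p) \<partial>M)" for n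
  proof -
    have "(\<integral>\<^sup>+x. ennreal (\<bar>a (r (q n)) x - b x\<bar> powr p) \<partial>M) + (\<integral>\<^sup>+x. ennreal (m n x powr p) \<partial>M)
      = (\<integral>\<^sup>+x. ennreal (\<bar>a (r (q n)) x - b x\<bar> powr p) + ennreal (m n x powr p) \<partial>M)"
      by (rule nn_integral_add[symmetric]) measurable
    also have "\<dots> \<le> (\<integral>\<^sup>+x. ennreal (a (r (q n)) x powr p) + ennreal (d n x powr p) \<partial>M)"
    proof (rule nn_integral_mono)
      fix x
      have "\<bar>a (r (q n)) x - b x\<bar> powr p + m n x powr p \<le> a (r (q n)) x powr p + d n x powr p"
      proof (cases "a (r (q n)) x \<le> b x")
        case True
        then show ?thesis by (simp add: d_def m_def)
      next
        case False
        then show ?thesis using powr_diff_add_le[OF nn(2)[of x], of "a (r (q n)) x" p] p by (simp add: d_def m_def)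
      qed
      then show "ennreal (\<bar>a (r (q n)) x - b x\<bar> powr p) + ennreal (m n x powr p)
          \<le> ennreal (a (r (q n)) x powr p) + ennreal (d n x powr p)"
        by (simp add: ennreal_plus[symmetric] ennreal_leI del: ennreal_plus)
    qed
    also have "\<dots> = (\<integral>\<^sup>+x. ennreal (a (r (q n)) x powr p) \<partial>M) + (\<integral>\<^sup>+x. ennreal (d n x powr p) \<partial>M)"
      by (rule nn_integral_add) measurable
    also have "\<dots> \<le> ?b + (\<integral>\<^sup>+x. ennreal (d n x powr p) \<partial>M)" by (rule add_right_mono[OF le])
    finally have *: "(\<integral>\<^sup>+x. ennreal (\<bar>a (r (q n)) x - b x\<bar> powr p) \<partial>M) + (\<integral>\<^sup>+x. ennreal (m n x powr p) \<partial>M)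
      \<le> ?b + (\<integral>\<^sup>+x. ennreal (d n x powr p) \<partial>M)" .
    have "(\<integral>\<^sup>+x. ennreal (m n x powr p) \<partial>M) \<le> ?b"
      using dm p by (intro nn_integral_mono ennreal_leI powr_mono2) auto
    with fin have "(\<integral>\<^sup>+x. ennreal (m n x powr p) \<partial>M) \<noteq> top" by (auto simp: top_unique)
    from ennreal_minus_mono[OF * order_refl[of "\<integral>\<^sup>+x. ennreal (m n x powr p) \<partial>M"]] this show ?thesis
      by (simp add: ennreal_add_diff_cancel_right)
  qed
  have lim: "(\<lambda>n. (?b + (\<integral>\<^sup>+x. ennreal (d n x powr p) \<partial>M)) - (\<integral>\<^sup>+x. ennreal (m n x powr p) \<partial>M)) \<longlonglongrightarrow> (?b + 0) - ?b"
    using fin by (intro tendsto_diff_ennreal tendsto_add tendsto_const dint mint) auto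
  have "(\<lambda>n. \<integral>\<^sup>+x. ennreal (\<bar>a (r (q n)) x - b x\<bar> powr p) \<partial>M) \<longlonglongrightarrow> 0"
    by (rule tendsto_sandwich[OF _ _ tendsto_const, of _ _ _ "\<lambda>n. (?b + (\<integral>\<^sup>+x. ennreal (d n x powr p) \<partial>M)) - (\<integral>\<^sup>+x. ennreal (m n x powr p) \<partial>M)"])
      (use key lim fin in auto)
  with q(1) show "\<exists>q. strict_mono q \<and> (\<lambda>n. \<integral>\<^sup>+x. ennreal (\<bar>a (r (q n)) x - b x\<bar> powr p) \<partial>M) \<longlonglongrightarrow> 0" by blast
qed

lemma (in sigma_finite_measure) ex_bounded_weight:
  "\<exists>w\<in>borel_measurable M. (\<integral>\<^sup>+x. w x \<partial>M) < \<infinity> \<and> (\<forall>x\<in>space M. 0 < w x) \<and> (\<forall>x. w x \<le> (1::ennreal))"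
proof -
  obtain h where h [measurable]: "h \<in> borel_measurable M" and hfin: "integral\<^sup>N M h \<noteq> \<infinity>"
    and hpos: "\<And>x. x \<in> space M \<Longrightarrow> 0 < h x \<and> h x < \<infinity>"
    using Ex_finite_integrable_function by auto
  have "(\<integral>\<^sup>+x. min 1 (h x) \<partial>M) \<le> integral\<^sup>N M h" by (intro nn_integral_mono) simp
  then have "(\<integral>\<^sup>+x. min 1 (h x) \<partial>M) < \<infinity>" using hfin by (auto simp: less_top top_unique)
  then show ?thesis using hpos by (intro bexI[of _ "\<lambda>x. min 1 (h x)"]) auto
qed

section \<open>Right continuity of the dominating semigroup\<close>

text \<open>Only sequences strictly to the right of \<open>t\<close> occur: norms of the dominating
  orbit are controlled at later times by earlier ones, and an interval of a partition can be
  lengthened by a positive amount.\<close>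

locale right_continuous_L1_Linf_semigroup = L1_Linf_semigroup +
  assumes right_continuous: "\<lbrakk>f \<in> L1_Linf M; 0 < t; \<And>n. t < r n; r \<longlonglongrightarrow> t\<rbrakk>
    \<Longrightarrow> (\<lambda>n::nat. powr_integral M 2 (\<lambda>x. T (r n) f x - T t f x)) \<longlonglongrightarrow> 0"
begin

context
  fixes w :: "'a \<Rightarrow> ennreal"
  assumes w [measurable]: "w \<in> borel_measurable M" and w_int: "(\<integral>\<^sup>+x. w x \<partial>M) < \<infinity>" and w_le: "\<And>x. w x \<le> 1"
begin

lemma variation_asymp_dominates:
  assumes us: "set us \<subseteq> pos_L1_Linf M" and t: "0 < t" and r: "\<And>n::nat. t < r n" "r \<longlonglongrightarrow> t"
  shows "asymp_dominates M w (\<lambda>n. L1_Linf_contraction.variation (T (r n)) us) (L1_Linf_contraction.variation (T t) us)"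
  using us
proof (induction us)
  case Nil
  have r0: "0 \<le> r n" for n using r(1)[of n] t by simp
  show ?case using t
    by (simp add: asymp_dominates_def L1_Linf_contraction.variation_def[OF contr] r0)
next
  case (Cons u us)
  have r0: "0 \<le> r n" for n using r(1)[of n] t by simp
  have t0: "0 \<le> t" using t by simp
  have u: "u \<in> pos_L1_Linf M" and us: "set us \<subseteq> pos_L1_Linf M" using Cons.prems by auto
  note [measurable] = L1_Linf_contraction.variation_measurable[OF contr[OF r0] us]
    L1_Linf_contraction.variation_measurable[OF contr[OF t0] us]
    L1_Linf_contraction.A_real_measurable[OF contr[OF r0] u]
    L1_Linf_contraction.A_real_measurable[OF contr[OF t0] u]
  have "asymp_dominates M w (\<lambda>n x. ennreal (norm (T (r n) (\<lambda>y. complex_of_real (u y)) x)))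
      (\<lambda>x. ennreal (norm (T t (\<lambda>y. complex_of_real (u y)) x)))"
    by (rule asymp_dominates_norm[OF _ _ _ w_int w_le _ right_continuous[OF of_real_L1_Linf[OF u] t r]]) auto
  from asymp_dominates_add[OF _ _ _ _ _ this Cons.IH[OF us]]
  show ?case
    by (simp add: L1_Linf_contraction.variation_Cons[OF contr[OF r0], abs_def]
        L1_Linf_contraction.variation_Cons[OF contr[OF t0], abs_def])
qed

text \<open>A decomposition below \<open>v\<close> is admissible for every \<open>T (r n)\<close> at
  once, so its variation is a common lower bound for the moduli; taking the supremum over
  decompositions keeps asymptotic domination.\<close>

lemma modulus_asymp_dominates:
  assumes v [measurable]: "v \<in> borel_measurable M" and t: "0 < t" and r: "\<And>n::nat. t < r n" "r \<longlonglongrightarrow> t"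
    and fin: "AE x in M. modulus_at t v x < \<infinity>"
  shows "asymp_dominates M w (\<lambda>n. modulus_at (r n) v) (modulus_at t v)"
proof -
  have r0: "0 \<le> r n" for n using r(1)[of n] t by simp
  have t0: "0 \<le> t" using t by simp
  interpret A: L1_Linf_contraction M "T t" by (rule contr[OF t0])
  obtain U where U: "\<And>n. set (U n) \<subseteq> pos_L1_Linf M"
    "\<And>n. AE x in M. ennreal (\<Sum>u\<leftarrow>U n. u x) \<le> v x"
    "AE x in M. incseq (\<lambda>n. A.variation (U n) x)" "AE x in M. A.modulus v x = (SUP n. A.variation (U n) x)"
    using A.modulus_sequence[of v] by blast
  note [measurable] = L1_Linf_contraction.modulus_measurable[OF contr[OF r0]] A.variation_measurable[OF U(1)]
  show ?thesis
  proof (rule asymp_dominates_SUP[OF w _ _ _ w_int _ U(3,4) fin])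
    fix k
    show "asymp_dominates M w (\<lambda>n. modulus_at (r n) v) (A.variation (U k))"
      by (rule asymp_dominates_mono[OF variation_asymp_dominates[OF U(1) t r]])
        (rule L1_Linf_contraction.variation_le_modulus[OF contr[OF r0] U(1,2)])
  qed measurable
qed

text \<open>Lengthening only the first interval of a partition of \<open>t\<close> gives a partition of \<open>r n\<close>.\<close>

lemma dominant_asymp_dominates:
  assumes v [measurable]: "v \<in> borel_measurable M" and t: "0 < t" and r: "\<And>n::nat. t < r n" "r \<longlonglongrightarrow> t"
    and fin: "AE x in M. dominant t v x < \<infinity>"
  shows "asymp_dominates M w (\<lambda>n. dominant (r n) v) (dominant t v)"
proof -
  have r0: "0 \<le> r n" for n using r(1)[of n] t by simp
  have t0: "0 \<le> t" using t by simp
  obtain U :: "nat \<Rightarrow> real list" where U: "\<And>n. U n \<in> partitions t" "AE x in M. incseq (\<lambda>n. partition_op (U n) v x)"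
    "AE x in M. dominant t v x = (SUP n. partition_op (U n) v x)"
    using dominant_sequence[OF t0 v] by blast
  note [measurable] = dominant_measurable[OF r0 v] dominant_measurable[OF t0 v]
    positive_contraction.measurable_op[OF partitions_pc[OF U(1)] v]
  show ?thesis
  proof (rule asymp_dominates_SUP[OF w _ _ _ w_int _ U(2,3) fin])
    fix k
    obtain a ts where Uk: "U k = a # ts" using U(1)[of k] t by (cases "U k") (auto simp: partitions_def)
    then have a: "0 < a" and ts: "\<forall>s\<in>set ts. 0 < s" and sum: "a + sum_list ts = t"
      using U(1)[of k] by (auto simp: partitions_def)
    let ?v = "partition_op ts v"
    have vm: "?v \<in> borel_measurable M" by (rule positive_contraction.measurable_op[OF partition_op[OF ts] v])
    have "AE x in M. modulus_at a ?v x < \<infinity>"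
      using partition_op_le_dominant[OF t0 v U(1)[of k]] fin unfolding Uk by eventually_elim (simp add: le_less_trans)
    moreover have "a < a + (r n - t)" for n using r(1)[of n] by simp
    moreover have "(\<lambda>n. a + (r n - t)) \<longlonglongrightarrow> a"
    proof -
      have "(\<lambda>n. a + (r n - t)) \<longlonglongrightarrow> a + (t - t)" by (intro tendsto_intros r)
      then show ?thesis by simp
    qed
    ultimately have "asymp_dominates M w (\<lambda>n. modulus_at (a + (r n - t)) ?v) (modulus_at a ?v)"
      by (intro modulus_asymp_dominates[OF vm a])
    moreover have "AE x in M. modulus_at (a + (r n - t)) ?v x \<le> dominant (r n) v x" for n
    proof -
      have "(a + (r n - t)) # ts \<in> partitions (r n)"
        using a ts sum r(1)[of n] by (auto simp: partitions_def)
      from partition_op_le_dominant[OF r0 v this] show ?thesis by simp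
    qed
    ultimately have "asymp_dominates M w (\<lambda>n. dominant (r n) v) (modulus_at a ?v)" by (rule asymp_dominates_mono)
    then show "asymp_dominates M w (\<lambda>n. dominant (r n) v) (partition_op (U k) v)" unfolding Uk by simp
  qed measurable
qed

end

lemma dominant_right_continuous:
  fixes u :: "'a \<Rightarrow> real"
  assumes u [measurable]: "u \<in> borel_measurable M" and u0: "\<And>x. 0 \<le> u x" and p: "1 \<le> p"
    and fin: "(\<integral>\<^sup>+x. ennreal (u x powr p) \<partial>M) < \<infinity>"
    and t: "0 < t" and r: "\<And>n::nat. t < r n" "r \<longlonglongrightarrow> t"
  shows "(\<lambda>n. \<integral>\<^sup>+x. ennreal (\<bar>enn2real (dominant (r n) (\<lambda>x. ennreal (u x)) x)
    - enn2real (dominant t (\<lambda>x. ennreal (u x)) x)\<bar> powr p) \<partial>M) \<longlonglongrightarrow> 0"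
proof -
  have r0: "0 \<le> r n" for n using r(1)[of n] t by simp
  have t0: "0 \<le> t" using t by simp
  let ?u = "\<lambda>x. ennreal (u x)"
  have um: "?u \<in> borel_measurable M" by measurable
  note [measurable] = dominant_measurable[OF r0 um] dominant_measurable[OF t0 um]
  have finite: "AE x in M. dominant s ?u x < \<infinity>" if "0 \<le> s" for s
    using positive_contraction.powr_le[OF positive_contraction_dominant[OF that] u u0 p fin]
    by eventually_elim simp
  define b where "b x = enn2real (dominant t ?u x)" for x
  define a where "a n x = enn2real (dominant (r n) ?u x)" for n x
  have [measurable]: "b \<in> borel_measurable M" "a n \<in> borel_measurable M" for n
    unfolding a_def[abs_def] b_def[abs_def] by measurable
  have beq: "AE x in M. ennreal (b x) = dominant t ?u x" using finite[OF t0] by eventually_elim (simp add: b_def)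
  have aeq: "AE x in M. ennreal (a n x) = dominant (r n) ?u x" for n
    using finite[OF r0[of n]] by eventually_elim (simp add: a_def)
  have bint: "(\<integral>\<^sup>+x. ennreal (b x powr p) \<partial>M) \<le> (\<integral>\<^sup>+x. ennreal (u x powr p) \<partial>M)"
    unfolding b_def by (rule positive_contraction.nn_integral_powr_le[OF positive_contraction_dominant[OF t0] u u0 p fin])
  then have bfin: "(\<integral>\<^sup>+x. ennreal (b x powr p) \<partial>M) < \<infinity>" using fin by (rule le_less_trans)
  \<comment> \<open>By the semigroup law the value at \<open>r n\<close> is the operator at time
    \<open>r n - t\<close> applied to the value at \<open>t\<close>, hence has no larger
    norm.\<close>
  have le: "(\<integral>\<^sup>+x. ennreal (a n x powr p) \<partial>M) \<le> (\<integral>\<^sup>+x. ennreal (b x powr p) \<partial>M)" for n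
  proof -
    have rt: "0 \<le> r n - t" using r(1)[of n] by simp
    interpret Q: positive_contraction M "dominant (r n - t)" by (rule positive_contraction_dominant[OF rt])
    have "AE x in M. dominant (r n - t + t) ?u x = dominant (r n - t) (dominant t ?u) x"
      by (rule dominant_add[OF rt t0 um])
    moreover have "AE x in M. dominant (r n - t) (\<lambda>x. ennreal (b x)) x = dominant (r n - t) (dominant t ?u) x"
      by (rule Q.AE_cong[OF _ _ beq]) measurable
    ultimately have "AE x in M. a n x = enn2real (dominant (r n - t) (\<lambda>x. ennreal (b x)) x)"
      by eventually_elim (simp add: a_def)
    then have "(\<integral>\<^sup>+x. ennreal (a n x powr p) \<partial>M)
        = (\<integral>\<^sup>+x. ennreal (enn2real (dominant (r n - t) (\<lambda>x. ennreal (b x)) x) powr p) \<partial>M)"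
      by (intro nn_integral_cong_AE) (auto elim!: eventually_mono)
    also have "\<dots> \<le> (\<integral>\<^sup>+x. ennreal (b x powr p) \<partial>M)"
      by (rule Q.nn_integral_powr_le[OF _ _ p bfin]) (auto simp: b_def)
    finally show ?thesis .
  qed
  obtain w where w [measurable]: "w \<in> borel_measurable M" and w_int: "(\<integral>\<^sup>+x. w x \<partial>M) < \<infinity>"
    and w_pos: "\<And>x. x \<in> space M \<Longrightarrow> 0 < w x" and w_le: "\<And>x. w x \<le> 1"
    using ex_bounded_weight by blast
  have "asymp_dominates M w (\<lambda>n. dominant (r n) ?u) (dominant t ?u)"
    by (rule dominant_asymp_dominates[OF w w_int w_le um t r finite[OF t0]])
  moreover have "(\<integral>\<^sup>+x. min 1 (dominant t ?u x - dominant (r n) ?u x) * w x \<partial>M)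
      = (\<integral>\<^sup>+x. min 1 (ennreal (b x) - ennreal (a n x)) * w x \<partial>M)" for n
    by (rule nn_integral_cong_AE) (use beq aeq[of n] in \<open>auto elim: eventually_elim2\<close>)
  ultimately have "asymp_dominates M w (\<lambda>n x. ennreal (a n x)) (\<lambda>x. ennreal (b x))"
    by (simp add: asymp_dominates_def)
  from asymp_dominates_tendsto[OF w _ _ w_int w_pos w_le _ _ p bfin le this]
  show ?thesis by (simp add: a_def b_def)
qed

text \<open>A complex function is a combination of four nonnegative parts, each bounded by
  \<open>|f|\<close>, to which the nonnegative case applies.\<close>

lemma dominating_right_continuous:
  assumes p: "1 \<le> p" "p < \<infinity>" and f: "f \<in> Lp_space M p" and t: "0 < t" and r: "\<And>n::nat. t < r n" "r \<longlonglongrightarrow> t"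
  shows "(\<lambda>n. powr_integral M (enn2real p) (\<lambda>x. dominating (r n) f x - dominating t f x)) \<longlonglongrightarrow> 0"
proof -
  let ?q = "enn2real p" let ?N = "powr_integral M ?q"
  have q: "1 \<le> ?q" using enn2real_ge_1[OF p] .
  have r0: "0 \<le> r n" for n using r(1)[of n] t by simp
  have t0: "0 \<le> t" using t by simp
  note fm [measurable] = Lp_space_measurable[OF f]
  define \<Delta> where "\<Delta> u n x = complex_of_real (enn2real (dominant (r n) (\<lambda>x. ennreal (u x)) x)
      - enn2real (dominant t (\<lambda>x. ennreal (u x)) x))" for u n x
  have \<Delta>m [measurable]: "\<Delta> u n \<in> borel_measurable M" if [measurable]: "u \<in> borel_measurable M" for u n
  proof -
    have um: "(\<lambda>x. ennreal (u x)) \<in> borel_measurable M" by measurable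
    note [measurable] = dominant_measurable[OF r0 um] dominant_measurable[OF t0 um]
    show ?thesis unfolding \<Delta>_def[abs_def] by measurable
  qed
  have lim: "(\<lambda>n. ?N (\<Delta> u n)) \<longlonglongrightarrow> 0"
    if [measurable]: "u \<in> borel_measurable M" and le: "\<And>x. u x \<le> norm (f x)" for u :: "'a \<Rightarrow> real"
  proof -
    have "(\<integral>\<^sup>+x. ennreal (max 0 (u x) powr ?q) \<partial>M) \<le> ?N f"
      unfolding powr_integral_def using q le by (intro nn_integral_mono ennreal_leI powr_mono2) auto
    also have "\<dots> < \<infinity>" using f p by (simp add: Lp_space_iff)
    finally have "(\<lambda>n. \<integral>\<^sup>+x. ennreal (\<bar>enn2real (dominant (r n) (\<lambda>x. ennreal (max 0 (u x))) x)
      - enn2real (dominant t (\<lambda>x. ennreal (max 0 (u x))) x)\<bar> powr ?q) \<partial>M) \<longlonglongrightarrow> 0"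
      by (intro dominant_right_continuous q t r) auto
    \<comment> \<open>The nonnegative case concerns \<open>max 0 u\<close>, while the operator sees
      \<open>u\<close> through \<open>ennreal\<close>, which discards negative values
      anyway.\<close>
    moreover have "ennreal (max 0 z) = ennreal z" for z by (simp add: max_def ennreal_neg)
    ultimately show ?thesis by (simp add: powr_integral_def \<Delta>_def norm_of_real del: of_real_diff)
  qed
  have comb: "(\<lambda>n. ?N (\<lambda>x. F n x + c * G n x)) \<longlonglongrightarrow> 0"
    if [measurable]: "\<And>n. F n \<in> borel_measurable M" "\<And>n. G n \<in> borel_measurable M"
      and "(\<lambda>n. ?N (F n)) \<longlonglongrightarrow> 0" "(\<lambda>n. ?N (G n)) \<longlonglongrightarrow> 0" for F G :: "nat \<Rightarrow> 'a \<Rightarrow> complex" and c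
  proof (rule tendsto_sandwich[OF _ _ tendsto_const])
    show "\<forall>\<^sub>F n in sequentially. ?N (\<lambda>x. F n x + c * G n x)
        \<le> ennreal (2 powr ?q) * (?N (F n) + ennreal (norm c powr ?q) * ?N (G n))"
    proof (rule always_eventually, rule allI)
      fix n
      show "?N (\<lambda>x. F n x + c * G n x) \<le> ennreal (2 powr ?q) * (?N (F n) + ennreal (norm c powr ?q) * ?N (G n))"
        using powr_integral_add_le[of "F n" M "\<lambda>x. c * G n x" ?q] powr_integral_scale[of "G n" M ?q c] q by simp
    qed
    have "(\<lambda>n. ennreal (2 powr ?q) * (?N (F n) + ennreal (norm c powr ?q) * ?N (G n)))
      \<longlonglongrightarrow> ennreal (2 powr ?q) * (0 + ennreal (norm c powr ?q) * 0)"
      by (intro ennreal_tendsto_cmult tendsto_add that) auto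
    then show "(\<lambda>n. ennreal (2 powr ?q) * (?N (F n) + ennreal (norm c powr ?q) * ?N (G n))) \<longlonglongrightarrow> 0" by simp
  qed auto
  have re: "(\<lambda>n. ?N (\<lambda>x. \<Delta> (\<lambda>x. Re (f x)) n x + (-1) * \<Delta> (\<lambda>x. - Re (f x)) n x)) \<longlonglongrightarrow> 0"
  proof (intro comb lim)
    show "Re (f x) \<le> norm (f x)" "- Re (f x) \<le> norm (f x)" for x using abs_Re_le_cmod[of "f x"] by auto
  qed measurable
  have im: "(\<lambda>n. ?N (\<lambda>x. \<Delta> (\<lambda>x. Im (f x)) n x + (-1) * \<Delta> (\<lambda>x. - Im (f x)) n x)) \<longlonglongrightarrow> 0"
  proof (intro comb lim)
    show "Im (f x) \<le> norm (f x)" "- Im (f x) \<le> norm (f x)" for x using abs_Im_le_cmod[of "f x"] by auto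
  qed measurable
  have "(\<lambda>n. ?N (\<lambda>x. (\<Delta> (\<lambda>x. Re (f x)) n x + (-1) * \<Delta> (\<lambda>x. - Re (f x)) n x)
      + \<i> * (\<Delta> (\<lambda>x. Im (f x)) n x + (-1) * \<Delta> (\<lambda>x. - Im (f x)) n x))) \<longlonglongrightarrow> 0"
    by (rule comb[OF _ _ re im]) measurable
  moreover have "dominating (r n) f x - dominating t f x = (\<Delta> (\<lambda>x. Re (f x)) n x + (-1) * \<Delta> (\<lambda>x. - Re (f x)) n x)
      + \<i> * (\<Delta> (\<lambda>x. Im (f x)) n x + (-1) * \<Delta> (\<lambda>x. - Im (f x)) n x)" for n x
    unfolding dominating_def
    by (simp add: positive_contraction.complex_op_def[OF positive_contraction_dominant] r0 t0
        positive_contraction.real_op_def[OF positive_contraction_dominant] \<Delta>_def complex_eq_iff)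
  ultimately show ?thesis by simp
qed

text \<open>The value 1 outside \<open>[0, n)\<close> only keeps the range finite.\<close>

definition right_grid :: "nat \<Rightarrow> real \<Rightarrow> real" where
  "right_grid n t = (if 0 \<le> t \<and> t < real n then (real_of_int \<lfloor>real (Suc n) * t\<rfloor> + 1) / real (Suc n) else 1)"

lemma right_grid_bounds:
  assumes "0 \<le> t" "t < real n"
  shows "t < right_grid n t" "right_grid n t \<le> t + 1 / real (Suc n)"
proof -
  have "real (Suc n) * t < real_of_int \<lfloor>real (Suc n) * t\<rfloor> + 1" "real_of_int \<lfloor>real (Suc n) * t\<rfloor> \<le> real (Suc n) * t"
    by linarith+
  then show "t < right_grid n t" "right_grid n t \<le> t + 1 / real (Suc n)"
    using assms by (simp_all add: right_grid_def field_simps del: of_nat_Suc)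
qed

lemma right_grid_nonneg: "0 \<le> right_grid n t"
  using right_grid_bounds(1)[of t n] by (cases "0 \<le> t \<and> t < real n") (auto simp: right_grid_def)

lemma simple_function_right_grid: "simple_function (lebesgue_on {0..}) (right_grid n)"
proof (rule simple_function_borel_measurable)
  have "right_grid n \<in> borel_measurable borel" unfolding right_grid_def[abs_def] by measurable
  then show "right_grid n \<in> borel_measurable (lebesgue_on {0..})"
    by (intro measurable_restrict_space1 measurable_completion) simp
  have "range (right_grid n) \<subseteq> insert 1 ((\<lambda>k. (real_of_int k + 1) / real (Suc n)) ` {0..int (Suc n * n)})"
  proof
    fix y assume "y \<in> range (right_grid n)"
    then obtain t where y: "y = right_grid n t" by auto
    show "y \<in> insert 1 ((\<lambda>k. (real_of_int k + 1) / real (Suc n)) ` {0..int (Suc n * n)})"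
    proof (cases "0 \<le> t \<and> t < real n")
      case True
      have "real (Suc n) * t \<le> real (Suc n) * real n" using True by (intro mult_left_mono) auto
      then have "\<lfloor>real (Suc n) * t\<rfloor> \<le> \<lfloor>real (Suc n * n)\<rfloor>" by (intro floor_mono) (simp only: of_nat_mult)
      then have "\<lfloor>real (Suc n) * t\<rfloor> \<le> int (Suc n * n)" by (simp only: floor_of_nat)
      moreover have "0 \<le> \<lfloor>real (Suc n) * t\<rfloor>" using True by simp
      ultimately show ?thesis using True unfolding y right_grid_def by auto
    qed (auto simp: y right_grid_def)
  qed
  then show "finite (right_grid n ` space (lebesgue_on {0..}))"
    by (rule finite_subset[rotated, OF finite_subset]) auto
qed

text \<open>Evaluating the orbit at grid points slightly to the right of \<open>t\<close> gives
  simple functions of \<open>t\<close>, and right continuity is exactly their convergence. The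
  family \<open>B\<close> may be any representative of the dominating one, so that the chosen
  extensions are covered.\<close>

lemma measurable_Lp_family_dominating:
  assumes p: "1 \<le> p" "p < \<infinity>"
    and B: "\<And>t f. 0 \<le> t \<Longrightarrow> f \<in> Lp_space M p \<Longrightarrow> B t f \<in> Lp_space M p"
      "\<And>t f. 0 \<le> t \<Longrightarrow> f \<in> Lp_space M p \<Longrightarrow> AE x in M. B t f x = dominating t f x"
  shows "measurable_Lp_family M p B"
  unfolding measurable_Lp_family_def Lp_strongly_measurable_def
proof (intro ballI exI conjI allI impI)
  fix f assume f: "f \<in> Lp_space M p"
  let ?s = "\<lambda>n t. B (right_grid n t) f"
  show "simple_function (lebesgue_on {0..}) (?s n)" for n
    by (rule simple_function_compose1[OF simple_function_right_grid])
  show "?s n t \<in> Lp_space M p" for n t by (rule B(1)[OF right_grid_nonneg f])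
  \<comment> \<open>Right continuity is available only for positive times; the single point 0 is a
    null set.\<close>
  have "AE t in lebesgue_on {0::real..}. t \<noteq> 0"
  proof -
    have "{0::real} \<in> null_sets (lebesgue_on {0..})" by (simp add: null_sets_restrict_space)
    then have "AE t in lebesgue_on {0::real..}. t \<notin> {0}" by (rule AE_not_in)
    then show ?thesis by simp
  qed
  then show "AE t in lebesgue_on {0..}. (\<lambda>n. Lp_norm M p (\<lambda>x. ?s n t x - B t f x)) \<longlonglongrightarrow> 0"
    using AE_space
  proof eventually_elim
    case (elim t)
    then have t: "0 < t" "0 \<le> t" by auto
    \<comment> \<open>The grid follows \<open>t\<close> only once its index exceeds
      \<open>t\<close>, so the sequence is started at \<open>N\<close>.\<close>
    obtain N :: nat where N: "t < real N" using reals_Archimedean2 by blast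
    define r where "r n = right_grid (n + N) t" for n
    have tN: "t < real (n + N)" for n using N by simp
    have r1: "t < r n" for n unfolding r_def by (rule right_grid_bounds(1)[OF t(2) tN])
    have r2: "r \<longlonglongrightarrow> t"
    proof (rule tendsto_sandwich[of "\<lambda>_. t" r sequentially "\<lambda>n. t + 1 / real (Suc (n + N))"])
      have "(\<lambda>n. t + 1 / real (Suc (n + N))) \<longlonglongrightarrow> t + 0"
        by (intro tendsto_add tendsto_const LIMSEQ_ignore_initial_segment[OF LIMSEQ_inverse_real_of_nat[unfolded inverse_eq_divide]])
      then show "(\<lambda>n. t + 1 / real (Suc (n + N))) \<longlonglongrightarrow> t" by simp
      show "\<forall>\<^sub>F n in sequentially. r n \<le> t + 1 / real (Suc (n + N))"
        unfolding r_def by (intro always_eventually allI right_grid_bounds(2)[OF t(2) tN])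
    qed (use r1 in \<open>auto simp: less_imp_le\<close>)
    have r0: "0 \<le> r n" for n using r1[of n] t by simp
    have "(\<lambda>n. powr_integral M (enn2real p) (\<lambda>x. dominating (r n) f x - dominating t f x)) \<longlonglongrightarrow> 0"
      by (rule dominating_right_continuous[OF p f t(1) r1 r2])
    moreover have "powr_integral M (enn2real p) (\<lambda>x. B (r n) f x - B t f x)
        = powr_integral M (enn2real p) (\<lambda>x. dominating (r n) f x - dominating t f x)" for n
      by (rule powr_integral_cong) (use B(2)[OF r0[of n] f] B(2)[OF t(2) f] in \<open>auto elim: eventually_elim2\<close>)
    ultimately have "(\<lambda>n. powr_integral M (enn2real p) (\<lambda>x. B (r n) f x - B t f x)) \<longlonglongrightarrow> 0" by simp
    then have "(\<lambda>n. Lp_norm M p (\<lambda>x. B (r n) f x - B t f x)) \<longlonglongrightarrow> 0"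
      by (subst Lp_norm_tendsto_0_iff[OF p Lp_space_diff[OF p(2) B(1)[OF r0 f] B(1)[OF t(2) f]]])
    then show ?case unfolding r_def by (rule LIMSEQ_offset)
  qed
qed

end

section \<open>Passage to the chosen extensions and conclusion\<close>

text \<open>\<open>Lp_extension\<close> is chosen separately for each \<open>t\<close>, so the
  semigroup law has to be transferred from the explicit operators through equality almost
  everywhere.\<close>

lemma Lp_semigroup_cong:
  assumes T: "Lp_semigroup M p T"
    and B: "\<And>t. 0 \<le> t \<Longrightarrow> Lp_bounded_linear M p (B t)"
    and eq: "\<And>t f. 0 \<le> t \<Longrightarrow> f \<in> Lp_space M p \<Longrightarrow> AE x in M. B t f x = T t f x"
  shows "Lp_semigroup M p B"
  unfolding Lp_semigroup_def
proof (intro conjI allI impI ballI)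
  fix f assume f: "f \<in> Lp_space M p"
  have "AE x in M. T 0 f x = f x" using T f unfolding Lp_semigroup_def by blast
  with eq[OF order_refl f] show "AE x in M. B 0 f x = f x" by eventually_elim simp
next
  fix s t :: real and f assume st: "0 \<le> s" "0 \<le> t" and f: "f \<in> Lp_space M p"
  have Bf: "B t f \<in> Lp_space M p" using B[OF st(2)] f unfolding Lp_bounded_linear_def Lp_linear_def by blast
  have lin: "Lp_linear M p (T t)" "Lp_linear M p (T s)"
    using T st unfolding Lp_semigroup_def Lp_bounded_linear_def by blast+
  then have Tf: "T t f \<in> Lp_space M p" using f unfolding Lp_linear_def by blast
  have st': "0 \<le> s + t" using st by simp
  have "AE x in M. T s (B t f) x = T s (T t f) x"
    using lin(2) Bf Tf eq[OF st(2) f] unfolding Lp_linear_def by blast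
  moreover have "AE x in M. T (s + t) f x = T s (T t f) x" using T st f unfolding Lp_semigroup_def by blast
  ultimately show "AE x in M. B (s + t) f x = B s (B t f) x"
    using eq[OF st' f] eq[OF st(1) Bf] by eventually_elim simp
qed (rule B)

theorem theorem3p1:
  fixes M :: "'a measure"
    and T :: "real \<Rightarrow> ('a \<Rightarrow> complex) \<Rightarrow> ('a \<Rightarrow> complex)"
  assumes "sigma_finite_measure M"
    and "Lp_semigroup M 2 T"
    and "contraction_property M T"
  shows "\<exists>S :: real \<Rightarrow> ('a \<Rightarrow> complex) \<Rightarrow> ('a \<Rightarrow> complex).
      positive_Lp_semigroup M 2 S \<and>
      contraction_property M S \<and>
      (\<forall>p::ennreal. \<forall>t::real. 1 \<le> p \<and> p < \<infinity> \<and> 0 \<le> t \<longrightarrow>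
         (\<forall>f\<in>Lp_space M p. AE x in M.
            complex_of_real (norm (Lp_extension M p (T t) f x))
              \<le> Lp_extension M p (S t) (\<lambda>y. complex_of_real (norm (f y))) x)) \<and>
      (measurable_Lp_family M 2 T \<longrightarrow>
         (\<forall>p::ennreal. 1 \<le> p \<and> p < \<infinity> \<longrightarrow>
            Lp_semigroup M p (\<lambda>t. Lp_extension M p (S t)) \<and>
            measurable_Lp_family M p (\<lambda>t. Lp_extension M p (S t))))"
proof -
  interpret L1_Linf_semigroup M T by (rule contraction_property_L1_Linf_semigroup[OF assms])
  note T2 = contraction_property_L1_Linf_semigroup(2)[OF assms]
  have two: "1 \<le> (2::ennreal)" "(2::ennreal) < \<infinity>" by auto
  have ext_contr: "Lp_contraction M p (Lp_extension M p (dominating t))" if "1 \<le> p" "p < \<infinity>" "0 \<le> t" for p t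
    by (rule Lp_extension_spec(1)[of _ _ "dominating t"])
      (use that in \<open>auto simp: dominating_def intro: positive_contraction.Lp_contraction_complex_op positive_contraction_dominant\<close>)
  have semi: "Lp_semigroup M p (\<lambda>t. Lp_extension M p (dominating t))" if p: "1 \<le> p" "p < \<infinity>" for p
  proof (rule Lp_semigroup_cong[OF Lp_semigroup_dominating[OF p]])
    show "Lp_bounded_linear M p (Lp_extension M p (dominating t))" if "0 \<le> t" for t
      using ext_contr[OF p that] unfolding Lp_contraction_def Lp_bounded_linear_def by (auto intro!: exI[of _ 1])
  qed (rule Lp_extension_dominating[OF p])
  have meas: "measurable_Lp_family M p (\<lambda>t. Lp_extension M p (dominating t))"
    if mT: "measurable_Lp_family M 2 T" and p: "1 \<le> p" "p < \<infinity>" for p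
  proof -
    interpret right_continuous_L1_Linf_semigroup M T
    proof (intro right_continuous_L1_Linf_semigroup.intro right_continuous_L1_Linf_semigroup_axioms.intro L1_Linf_semigroup_axioms)
      fix f t and r :: "nat \<Rightarrow> real"
      assume f: "f \<in> L1_Linf M" and t: "0 < t" and r: "\<And>n. t < r n" "r \<longlonglongrightarrow> t"
      show "(\<lambda>n. powr_integral M 2 (\<lambda>x. T (r n) f x - T t f x)) \<longlonglongrightarrow> 0"
      proof (rule tendsto_0_of_le_eps)
        fix e :: real assume e: "0 < e"
        obtain d where d: "0 < d" "\<And>h. 0 \<le> h \<Longrightarrow> h < d \<Longrightarrow> powr_integral M (enn2real 2) (\<lambda>x. T (t + h) f x - T t f x) \<le> ennreal e"
          using measurable_semigroup_continuous[OF two assms(2) T2 mT L1_Linf_subset_Lp[OF two(1) f] t e] by blast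
        have "\<forall>\<^sub>F n in sequentially. r n < t + d" using r(2) d(1) by (intro order_tendstoD) auto
        then obtain N where N: "\<And>n. n \<ge> N \<Longrightarrow> r n < t + d" by (auto simp: eventually_sequentially)
        have le: "powr_integral M 2 (\<lambda>x. T (r n) f x - T t f x) \<le> ennreal e" if "n \<ge> N" for n
          using d(2)[of "r n - t"] r(1)[of n] N[OF that] by simp
        show "\<exists>z. z \<longlonglongrightarrow> 0 \<and> (\<forall>n. powr_integral M 2 (\<lambda>x. T (r n) f x - T t f x) \<le> ennreal e + z n)"
        proof (intro exI conjI allI)
          \<comment> \<open>Infinite values at the finitely many early indices make the bound hold
            for every \<open>n\<close> without changing the limit.\<close>
          show "(\<lambda>n. if n \<ge> N then 0 else top :: ennreal) \<longlonglongrightarrow> 0"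
            by (rule tendsto_eventually) (auto simp: eventually_sequentially)
        qed (use le in auto)
      qed
    qed
    show ?thesis
      by (rule measurable_Lp_family_dominating[OF p Lp_contractionD(1)[OF ext_contr[OF p]] Lp_extension_dominating[OF p]])
  qed
  show ?thesis
    using positive_Lp_semigroup_dominating[OF two] contraction_property_dominating
      norm_Lp_extension_le[OF T2] semi meas
    by (intro exI[of _ dominating]) auto
qed

end
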